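(* Let $k$ be a field, let $\mathcal{C},\mathcal{D}$ be finite strict tensor categories over $k$, and let $F:\mathcal{C}\to\mathcal{D}$ be an exact $k$-linear strict monoidal functor. If $\mathrm{Ext}^1_{\mathcal{Z}(F)}(\mathbf{1},\mathbf{1})=0$ then $H^1_{\mathrm{DY}}(F)=0$. In particular, if $k$ has characteristic $0$ and is algebraically closed, then $H^1_{\mathrm{DY}}(F)=0$.
   Context: A tensor category over $k$ is a $k$-linear abelian rigid monoidal category with $k$-bilinear tensor product whose unit $\mathbf{1}$ is simple with $\mathrm{End}(\mathbf{1})\cong k$. It is finite if it is equivalent, as a $k$-linear category, to the category of finite-dimensional modules over a finite-dimensional $k$-algebra. A half-braiding relative to $F$ on $V\in\mathcal{D}$ is a natural isomorphism $\rho^V_X:V\otimes F(X)\to F(X)\otimes V$ ($X\in\mathcal{C}$) with $\rho^V_{X\otimes Y}=(\mathrm{id}_{F(X)}\otimes\rho^V_Y)(\rho^V_X\otimes\mathrm{id}_{F(Y)})$. The centralizer $\mathcal{Z}(F)$ has as objects the pairs $(V,\rho^V)$, and as morphisms the morphisms in $\mathcal{D}$ commuting with the half-braidings. It is a finite tensor category with tensor product $(V,\rho^V)\otimes(W,\rho^W)=(V\otimes W,(\rho^V\otimes\mathrm{id}_W)(\mathrm{id}_V\otimes\rho^W))$ and unit $\mathbf{1}=(\mathbf{1},\mathrm{id})$. $\mathrm{Ext}^1_{\mathcal{Z}(F)}$ is the usual Ext group in the abelian category $\mathcal{Z}(F)$. $H^\bullet_{\mathrm{DY}}(F)$ (trivial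 coefficients) is the cohomology of the complex whose $n$-cochains are the natural endomorphisms $f_{X_1,\dots,X_n}$ of $F(X_1)\otimes\cdots\otimes F(X_n)$ (for $n=0$: $\mathrm{End}(\mathbf{1})$), with differential $$\delta^n(f)_{X_0,\dots,X_n}=\mathrm{id}_{F(X_0)}\otimes f_{X_1,\dots,X_n}+\sum_{i=1}^n(-1)^if_{X_0,\dots,X_{i-1}\otimes X_i,\dots,X_n}+(-1)^{n+1}f_{X_0,\dots,X_{n-1}}\otimes\mathrm{id}_{F(X_n)}.$$ *)

theory Defs
  imports
    "Jordan_Normal_Form.VS_Connect"
    "HOL-Algebra.Elementary_Groups"
    "HOL-Algebra.AbelCoset"
begin

section \<open>Categories with hom-sets in a type, over a field given as a type\<close>

text \<open>
  The ground field is a type \<^typ>\<open>'k::field\<close>; wherever HOL-Algebra wants a ring record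
  for it we use \<^term>\<open>class_ring :: 'k::field ring\<close>.
\<close>

record ('o, 'm) cat =
  Obj  :: "'o set"
  Hom  :: "'o \<Rightarrow> 'o \<Rightarrow> 'm set"
  Id   :: "'o \<Rightarrow> 'm"
  Comp :: "'m \<Rightarrow> 'm \<Rightarrow> 'm" (infixl \<open>\<cdot>\<index>\<close> 70)

record ('o, 'm, 'k) lin_cat = "('o, 'm) cat" +
  Zero  :: "'o \<Rightarrow> 'o \<Rightarrow> 'm"
  Add   :: "'m \<Rightarrow> 'm \<Rightarrow> 'm"
  Scale :: "'k \<Rightarrow> 'm \<Rightarrow> 'm"

record ('o, 'm, 'k) tensor_cat = "('o, 'm, 'k) lin_cat" +
  Unit :: "'o"
  TObj :: "'o \<Rightarrow> 'o \<Rightarrow> 'o" (infixr \<open>\<boxtimes>\<index>\<close> 75)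
  TMor :: "'m \<Rightarrow> 'm \<Rightarrow> 'm" (infixr \<open>\<star>\<index>\<close> 75)

locale category =
  fixes C :: "('o, 'm, 'x) cat_scheme" (structure)
  assumes Hom_disjoint: "f \<in> Hom C X Y \<Longrightarrow> f \<in> Hom C X' Y' \<Longrightarrow> X = X' \<and> Y = Y'"
    and Hom_Obj: "f \<in> Hom C X Y \<Longrightarrow> X \<in> Obj C \<and> Y \<in> Obj C"
    and Id_Hom: "X \<in> Obj C \<Longrightarrow> Id C X \<in> Hom C X X"
    and Comp_Hom: "f \<in> Hom C X Y \<Longrightarrow> g \<in> Hom C Y Z \<Longrightarrow> g \<cdot> f \<in> Hom C X Z"
    and Comp_Id: "f \<in> Hom C X Y \<Longrightarrow> f \<cdot> Id C X = f"
    and Id_Comp: "f \<in> Hom C X Y \<Longrightarrow> Id C Y \<cdot> f = f"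
    and Comp_assoc: "f \<in> Hom C W X \<Longrightarrow> g \<in> Hom C X Y \<Longrightarrow> h \<in> Hom C Y Z
      \<Longrightarrow> (h \<cdot> g) \<cdot> f = h \<cdot> (g \<cdot> f)"

text \<open>The fields \<^const>\<open>mult\<close> and \<^const>\<open>one\<close> of the HOL-Algebra module record play no
  role for a vector space.\<close>

definition hom_space ::
  "('o, 'm, 'k, 'x) lin_cat_scheme \<Rightarrow> 'o \<Rightarrow> 'o \<Rightarrow> ('k, 'm) module" where
  "hom_space C X Y = \<lparr>carrier = Hom C X Y, mult = undefined, one = undefined,
     zero = Zero C X Y, add = Add C, smult = Scale C\<rparr>"

locale linear_category = category C
  for C :: "('o, 'm, 'k::field, 'x) lin_cat_scheme" (structure) +
  assumes Hom_vectorspace: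
      "X \<in> Obj C \<Longrightarrow> Y \<in> Obj C \<Longrightarrow> vectorspace (class_ring :: 'k ring) (hom_space C X Y)"
    and Comp_Add_left: "f \<in> Hom C X Y \<Longrightarrow> g \<in> Hom C Y Z \<Longrightarrow> g' \<in> Hom C Y Z
      \<Longrightarrow> Add C g g' \<cdot> f = Add C (g \<cdot> f) (g' \<cdot> f)"
    and Comp_Add_right: "f \<in> Hom C X Y \<Longrightarrow> f' \<in> Hom C X Y \<Longrightarrow> g \<in> Hom C Y Z
      \<Longrightarrow> g \<cdot> Add C f f' = Add C (g \<cdot> f) (g \<cdot> f')"
    and Comp_Scale_left: "f \<in> Hom C X Y \<Longrightarrow> g \<in> Hom C Y Z
      \<Longrightarrow> Scale C c g \<cdot> f = Scale C c (g \<cdot> f)"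
    and Comp_Scale_right: "f \<in> Hom C X Y \<Longrightarrow> g \<in> Hom C Y Z
      \<Longrightarrow> g \<cdot> Scale C c f = Scale C c (g \<cdot> f)"

section \<open>Abelian categories\<close>

definition isomorphism :: "('o, 'm, 'x) cat_scheme \<Rightarrow> 'o \<Rightarrow> 'o \<Rightarrow> 'm \<Rightarrow> bool" where
  "isomorphism C X Y f \<longleftrightarrow> f \<in> Hom C X Y \<and>
     (\<exists>g \<in> Hom C Y X. g \<cdot>\<^bsub>C\<^esub> f = Id C X \<and> f \<cdot>\<^bsub>C\<^esub> g = Id C Y)"

definition monomorphism :: "('o, 'm, 'x) cat_scheme \<Rightarrow> 'o \<Rightarrow> 'o \<Rightarrow> 'm \<Rightarrow> bool" where
  "monomorphism C X Y f \<longleftrightarrow> f \<in> Hom C X Y \<and>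
     (\<forall>W. \<forall>g \<in> Hom C W X. \<forall>h \<in> Hom C W X. f \<cdot>\<^bsub>C\<^esub> g = f \<cdot>\<^bsub>C\<^esub> h \<longrightarrow> g = h)"

definition epimorphism :: "('o, 'm, 'x) cat_scheme \<Rightarrow> 'o \<Rightarrow> 'o \<Rightarrow> 'm \<Rightarrow> bool" where
  "epimorphism C X Y f \<longleftrightarrow> f \<in> Hom C X Y \<and>
     (\<forall>Z. \<forall>g \<in> Hom C Y Z. \<forall>h \<in> Hom C Y Z. g \<cdot>\<^bsub>C\<^esub> f = h \<cdot>\<^bsub>C\<^esub> f \<longrightarrow> g = h)"

definition zero_object :: "('o, 'm, 'x) cat_scheme \<Rightarrow> 'o \<Rightarrow> bool" where
  "zero_object C Z \<longleftrightarrow> Z \<in> Obj C \<and>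
     (\<forall>X \<in> Obj C. (\<exists>!f. f \<in> Hom C X Z) \<and> (\<exists>!f. f \<in> Hom C Z X))"

text \<open>\<open>i : K \<rightarrow> X\<close> is a kernel, and \<open>p : Y \<rightarrow> Q\<close> is a cokernel, of \<open>f : X \<rightarrow> Y\<close>.\<close>

definition is_kernel ::
  "('o, 'm, 'k, 'x) lin_cat_scheme \<Rightarrow> 'o \<Rightarrow> 'o \<Rightarrow> 'm \<Rightarrow> 'o \<Rightarrow> 'm \<Rightarrow> bool" where
  "is_kernel C X Y f K i \<longleftrightarrow> f \<in> Hom C X Y \<and> i \<in> Hom C K X \<and> f \<cdot>\<^bsub>C\<^esub> i = Zero C K Y \<and>
     (\<forall>W. \<forall>g \<in> Hom C W X. f \<cdot>\<^bsub>C\<^esub> g = Zero C W Y \<longrightarrow> (\<exists>!h. h \<in> Hom C W K \<and> i \<cdot>\<^bsub>C\<^esub> h = g))"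

definition is_cokernel ::
  "('o, 'm, 'k, 'x) lin_cat_scheme \<Rightarrow> 'o \<Rightarrow> 'o \<Rightarrow> 'm \<Rightarrow> 'o \<Rightarrow> 'm \<Rightarrow> bool" where
  "is_cokernel C X Y f Q p \<longleftrightarrow> f \<in> Hom C X Y \<and> p \<in> Hom C Y Q \<and> p \<cdot>\<^bsub>C\<^esub> f = Zero C X Q \<and>
     (\<forall>Z. \<forall>g \<in> Hom C Y Z. g \<cdot>\<^bsub>C\<^esub> f = Zero C X Z \<longrightarrow> (\<exists>!h. h \<in> Hom C Q Z \<and> h \<cdot>\<^bsub>C\<^esub> p = g))"

definition is_biproduct ::
  "('o, 'm, 'k, 'x) lin_cat_scheme \<Rightarrow> 'o \<Rightarrow> 'o \<Rightarrow> 'o \<Rightarrow> 'm \<Rightarrow> 'm \<Rightarrow> 'm \<Rightarrow> 'm \<Rightarrow> bool" where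
  "is_biproduct C X Y S j1 j2 q1 q2 \<longleftrightarrow>
     j1 \<in> Hom C X S \<and> j2 \<in> Hom C Y S \<and> q1 \<in> Hom C S X \<and> q2 \<in> Hom C S Y \<and>
     q1 \<cdot>\<^bsub>C\<^esub> j1 = Id C X \<and> q2 \<cdot>\<^bsub>C\<^esub> j2 = Id C Y \<and>
     q1 \<cdot>\<^bsub>C\<^esub> j2 = Zero C Y X \<and> q2 \<cdot>\<^bsub>C\<^esub> j1 = Zero C X Y \<and>
     Add C (j1 \<cdot>\<^bsub>C\<^esub> q1) (j2 \<cdot>\<^bsub>C\<^esub> q2) = Id C S"

locale abelian_linear_category = linear_category C
  for C :: "('o, 'm, 'k::field, 'x) lin_cat_scheme" (structure) +
  assumes ex_zero_object: "\<exists>Z. zero_object C Z"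
    and ex_biproduct: "X \<in> Obj C \<Longrightarrow> Y \<in> Obj C \<Longrightarrow> \<exists>S j1 j2 q1 q2. is_biproduct C X Y S j1 j2 q1 q2"
    and ex_kernel: "f \<in> Hom C X Y \<Longrightarrow> \<exists>K i. is_kernel C X Y f K i"
    and ex_cokernel: "f \<in> Hom C X Y \<Longrightarrow> \<exists>Q p. is_cokernel C X Y f Q p"
    and mono_normal: "monomorphism C K X i \<Longrightarrow> \<exists>Y f. is_kernel C X Y f K i"
    and epi_normal: "epimorphism C Y Q p \<Longrightarrow> \<exists>X f. is_cokernel C X Y f Q p"

definition simple_object :: "('o, 'm, 'x) cat_scheme \<Rightarrow> 'o \<Rightarrow> bool" where
  "simple_object C S \<longleftrightarrow> S \<in> Obj C \<and> \<not> zero_object C S \<and>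
     (\<forall>X i. monomorphism C X S i \<longrightarrow> zero_object C X \<or> isomorphism C X S i)"

text \<open>The sequence \<open>0 \<rightarrow> B \<rightarrow> E \<rightarrow> A \<rightarrow> 0\<close> with maps \<open>i\<close>, \<open>p\<close> is exact.\<close>

definition short_exact ::
  "('o, 'm, 'k, 'x) lin_cat_scheme \<Rightarrow> 'o \<Rightarrow> 'm \<Rightarrow> 'o \<Rightarrow> 'm \<Rightarrow> 'o \<Rightarrow> bool" where
  "short_exact C B i E p A \<longleftrightarrow> is_kernel C E A p B i \<and> is_cokernel C B E i A p"

section \<open>Yoneda Ext\<close>

definition extensions ::
  "('o, 'm, 'k, 'x) lin_cat_scheme \<Rightarrow> 'o \<Rightarrow> 'o \<Rightarrow> ('o \<times> 'm \<times> 'm) set" where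
  "extensions C A B = {(E, i, p). short_exact C B i E p A}"

definition extension_equiv ::
  "('o, 'm, 'k, 'x) lin_cat_scheme \<Rightarrow> 'o \<Rightarrow> 'o \<Rightarrow> (('o \<times> 'm \<times> 'm) \<times> ('o \<times> 'm \<times> 'm)) set" where
  "extension_equiv C A B = {((E, i, p), (E', i', p')).
     (E, i, p) \<in> extensions C A B \<and> (E', i', p') \<in> extensions C A B \<and>
     (\<exists>\<phi>. isomorphism C E E' \<phi> \<and> \<phi> \<cdot>\<^bsub>C\<^esub> i = i' \<and> p' \<cdot>\<^bsub>C\<^esub> \<phi> = p)}"

text \<open>
  \<open>(E, i, p)\<close> is a Baer sum of \<open>(E1, i1, p1)\<close> and \<open>(E2, i2, p2)\<close>: with \<open>S = E1 \<oplus> E2\<close>,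
  the object \<open>Y = E1 \<times>\<^sub>A E2\<close> is the kernel of \<open>p1 q1 - p2 q2 : S \<rightarrow> A\<close>, and \<open>E\<close> is the quotient of
  \<open>Y\<close> by the antidiagonal copy \<open>b \<mapsto> (i1 b, - i2 b)\<close> of \<open>B\<close>.
\<close>

definition is_baer_sum ::
  "('o, 'm, 'k::field, 'x) lin_cat_scheme \<Rightarrow> 'o \<Rightarrow> 'o
     \<Rightarrow> 'o \<times> 'm \<times> 'm \<Rightarrow> 'o \<times> 'm \<times> 'm \<Rightarrow> 'o \<times> 'm \<times> 'm \<Rightarrow> bool" where
  "is_baer_sum C A B = (\<lambda>(E1, i1, p1) (E2, i2, p2) (E, i, p).
     \<exists>S j1 j2 q1 q2 Y \<kappa> \<theta> \<theta>1 \<pi>.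
       is_biproduct C E1 E2 S j1 j2 q1 q2 \<and>
       is_kernel C S A (Add C (p1 \<cdot>\<^bsub>C\<^esub> q1) (Scale C (-1) (p2 \<cdot>\<^bsub>C\<^esub> q2))) Y \<kappa> \<and>
       \<theta> \<in> Hom C B Y \<and> \<kappa> \<cdot>\<^bsub>C\<^esub> \<theta> = Add C (j1 \<cdot>\<^bsub>C\<^esub> i1) (Scale C (-1) (j2 \<cdot>\<^bsub>C\<^esub> i2)) \<and>
       \<theta>1 \<in> Hom C B Y \<and> \<kappa> \<cdot>\<^bsub>C\<^esub> \<theta>1 = j1 \<cdot>\<^bsub>C\<^esub> i1 \<and>
       is_cokernel C B Y \<theta> E \<pi> \<and>
       i = \<pi> \<cdot>\<^bsub>C\<^esub> \<theta>1 \<and> p \<in> Hom C E A \<and> p \<cdot>\<^bsub>C\<^esub> \<pi> = p1 \<cdot>\<^bsub>C\<^esub> (q1 \<cdot>\<^bsub>C\<^esub> \<kappa>))"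

text \<open>The neutral element is the class of \<open>A \<oplus> B\<close>, that is, the set of all split extensions.\<close>

definition Ext1 ::
  "('o, 'm, 'k::field, 'x) lin_cat_scheme \<Rightarrow> 'o \<Rightarrow> 'o \<Rightarrow> ('o \<times> 'm \<times> 'm) set monoid" where
  "Ext1 C A B = \<lparr>carrier = extensions C A B // extension_equiv C A B,
     mult = (\<lambda>a b. {e \<in> extensions C A B. \<exists>e1 \<in> a. \<exists>e2 \<in> b. is_baer_sum C A B e1 e2 e}),
     one = {(E, i, p) \<in> extensions C A B. \<exists>s \<in> Hom C A E. p \<cdot>\<^bsub>C\<^esub> s = Id C A}\<rparr>"

section \<open>Functors and equivalences\<close>

record ('o, 'm, 'p, 'n) funct =
  OMap :: "'o \<Rightarrow> 'p"
  MMap :: "'m \<Rightarrow> 'n"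

locale linear_functor =
  fixes C :: "('c, 'f, 'k::field, 'x) lin_cat_scheme"
    and D :: "('d, 'g, 'k, 'y) lin_cat_scheme"
    and F :: "('c, 'f, 'd, 'g) funct"
  assumes OMap_Obj: "X \<in> Obj C \<Longrightarrow> OMap F X \<in> Obj D"
    and MMap_Hom: "f \<in> Hom C X Y \<Longrightarrow> MMap F f \<in> Hom D (OMap F X) (OMap F Y)"
    and MMap_Id: "X \<in> Obj C \<Longrightarrow> MMap F (Id C X) = Id D (OMap F X)"
    and MMap_Comp: "f \<in> Hom C X Y \<Longrightarrow> g \<in> Hom C Y Z
      \<Longrightarrow> MMap F (g \<cdot>\<^bsub>C\<^esub> f) = MMap F g \<cdot>\<^bsub>D\<^esub> MMap F f"
    and MMap_Add: "f \<in> Hom C X Y \<Longrightarrow> g \<in> Hom C X Y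
      \<Longrightarrow> MMap F (Add C f g) = Add D (MMap F f) (MMap F g)"
    and MMap_Scale: "f \<in> Hom C X Y \<Longrightarrow> MMap F (Scale C c f) = Scale D c (MMap F f)"

definition id_funct :: "('o, 'm, 'o, 'm) funct" where
  "id_funct = \<lparr>OMap = (\<lambda>X. X), MMap = (\<lambda>f. f)\<rparr>"

definition comp_funct ::
  "('p, 'n, 'q, 'l) funct \<Rightarrow> ('o, 'm, 'p, 'n) funct \<Rightarrow> ('o, 'm, 'q, 'l) funct" where
  "comp_funct G F = \<lparr>OMap = OMap G \<circ> OMap F, MMap = MMap G \<circ> MMap F\<rparr>"

definition natural_isomorphism ::
  "('c, 'f, 'x) cat_scheme \<Rightarrow> ('d, 'g, 'y) cat_scheme
     \<Rightarrow> ('c, 'f, 'd, 'g) funct \<Rightarrow> ('c, 'f, 'd, 'g) funct \<Rightarrow> ('c \<Rightarrow> 'g) \<Rightarrow> bool" where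
  "natural_isomorphism C D F G \<eta> \<longleftrightarrow>
     (\<forall>X \<in> Obj C. isomorphism D (OMap F X) (OMap G X) (\<eta> X)) \<and>
     (\<forall>X Y. \<forall>f \<in> Hom C X Y. MMap G f \<cdot>\<^bsub>D\<^esub> \<eta> X = \<eta> Y \<cdot>\<^bsub>D\<^esub> MMap F f)"

definition linearly_equivalent ::
  "('c, 'f, 'k::field, 'x) lin_cat_scheme \<Rightarrow> ('d, 'g, 'k, 'y) lin_cat_scheme \<Rightarrow> bool" where
  "linearly_equivalent C D \<longleftrightarrow>
     (\<exists>F G \<eta> \<epsilon>. linear_functor C D F \<and> linear_functor D C G \<and>
        natural_isomorphism C C id_funct (comp_funct G F) \<eta> \<and>
        natural_isomorphism D D (comp_funct F G) id_funct \<epsilon>)"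

definition exact_functor ::
  "('c, 'f, 'k, 'x) lin_cat_scheme \<Rightarrow> ('d, 'g, 'k, 'y) lin_cat_scheme
     \<Rightarrow> ('c, 'f, 'd, 'g) funct \<Rightarrow> bool" where
  "exact_functor C D F \<longleftrightarrow>
     (\<forall>B i E p A. short_exact C B i E p A \<longrightarrow>
        short_exact D (OMap F B) (MMap F i) (OMap F E) (MMap F p) (OMap F A))"

section \<open>Finite-dimensional modules over a finite-dimensional algebra\<close>

definition fin_dim_space :: "('k::field, 'v, 'x) module_scheme \<Rightarrow> bool" where
  "fin_dim_space V \<longleftrightarrow>
     vectorspace (class_ring :: 'k ring) V \<and> vectorspace.fin_dim (class_ring :: 'k ring) V"

definition fin_dim_algebra :: "('k::field, 'a) module \<Rightarrow> bool" where
  "fin_dim_algebra A \<longleftrightarrow> ring A \<and> fin_dim_space A \<and>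
     (\<forall>c. \<forall>a \<in> carrier A. \<forall>b \<in> carrier A.
        (c \<odot>\<^bsub>A\<^esub> a) \<otimes>\<^bsub>A\<^esub> b = c \<odot>\<^bsub>A\<^esub> (a \<otimes>\<^bsub>A\<^esub> b) \<and>
        a \<otimes>\<^bsub>A\<^esub> (c \<odot>\<^bsub>A\<^esub> b) = c \<odot>\<^bsub>A\<^esub> (a \<otimes>\<^bsub>A\<^esub> b))"

record ('k, 'a, 'v) alg_module = "('k, 'v) module" +
  act :: "'a \<Rightarrow> 'v \<Rightarrow> 'v"

definition is_fin_dim_module ::
  "('k::field, 'a) module \<Rightarrow> ('k, 'a, 'v) alg_module \<Rightarrow> bool" where
  "is_fin_dim_module A M \<longleftrightarrow> fin_dim_space M \<and>
     (\<forall>a \<in> carrier A. \<forall>m \<in> carrier M. act M a m \<in> carrier M) \<and>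
     (\<forall>a \<in> carrier A. \<forall>b \<in> carrier A. \<forall>m \<in> carrier M.
        act M (a \<oplus>\<^bsub>A\<^esub> b) m = act M a m \<oplus>\<^bsub>M\<^esub> act M b m \<and>
        act M (a \<otimes>\<^bsub>A\<^esub> b) m = act M a (act M b m)) \<and>
     (\<forall>a \<in> carrier A. \<forall>m \<in> carrier M. \<forall>n \<in> carrier M.
        act M a (m \<oplus>\<^bsub>M\<^esub> n) = act M a m \<oplus>\<^bsub>M\<^esub> act M a n) \<and>
     (\<forall>c. \<forall>a \<in> carrier A. \<forall>m \<in> carrier M.
        act M (c \<odot>\<^bsub>A\<^esub> a) m = c \<odot>\<^bsub>M\<^esub> act M a m \<and>
        act M a (c \<odot>\<^bsub>M\<^esub> m) = c \<odot>\<^bsub>M\<^esub> act M a m) \<and>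
     (\<forall>m \<in> carrier M. act M \<one>\<^bsub>A\<^esub> m = m)"

definition module_maps ::
  "('k::field, 'a) module \<Rightarrow> ('k, 'a, 'v) alg_module \<Rightarrow> ('k, 'a, 'v) alg_module \<Rightarrow> ('v \<Rightarrow> 'v) set" where
  "module_maps A M N = {f \<in> carrier M \<rightarrow>\<^sub>E carrier N.
     (\<forall>m \<in> carrier M. \<forall>n \<in> carrier M. f (m \<oplus>\<^bsub>M\<^esub> n) = f m \<oplus>\<^bsub>N\<^esub> f n) \<and>
     (\<forall>c. \<forall>m \<in> carrier M. f (c \<odot>\<^bsub>M\<^esub> m) = c \<odot>\<^bsub>N\<^esub> f m) \<and>
     (\<forall>a \<in> carrier A. \<forall>m \<in> carrier M. f (act M a m) = act N a (f m))}"

text \<open>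
  A morphism carries its source and target: it is a triple \<open>(M, f, N)\<close> with \<open>f\<close> a module map.
\<close>

definition fd_modules ::
  "('k::field, 'a) module
     \<Rightarrow> (('k, 'a, 'v) alg_module,
         ('k, 'a, 'v) alg_module \<times> ('v \<Rightarrow> 'v) \<times> ('k, 'a, 'v) alg_module, 'k) lin_cat" where
  "fd_modules A = \<lparr>
     Obj = {M. is_fin_dim_module A M},
     Hom = (\<lambda>M N. {(M, f, N) | f. is_fin_dim_module A M \<and> is_fin_dim_module A N \<and> f \<in> module_maps A M N}),
     Id = (\<lambda>M. (M, (\<lambda>m \<in> carrier M. m), M)),
     Comp = (\<lambda>(N, g, P) (M, f, N'). (M, compose (carrier M) g f, P)),
     Zero = (\<lambda>M N. (M, (\<lambda>m \<in> carrier M. \<zero>\<^bsub>N\<^esub>), N)),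
     Add = (\<lambda>(M, f, N) (M', g, N'). (M, (\<lambda>m \<in> carrier M. f m \<oplus>\<^bsub>N\<^esub> g m), N)),
     Scale = (\<lambda>c (M, f, N). (M, (\<lambda>m \<in> carrier M. c \<odot>\<^bsub>N\<^esub> f m), N))\<rparr>"

text \<open>
  HOL cannot quantify over the carrier types of the algebra and of its modules. Carriers are taken
  as subsets of \<^typ>\<open>nat \<Rightarrow> 'k\<close>, with arbitrary operations: since this type contains a copy of \<open>k\<^sup>n\<close>
  for each \<open>n\<close>, every finite-dimensional algebra, and every finite-dimensional module over it,
  occurs up to isomorphism.
\<close>

definition finite_linear_category ::
  "('o, 'm, 'k::field, 'x) lin_cat_scheme \<Rightarrow> bool" where
  "finite_linear_category C \<longleftrightarrow> (\<exists>A :: ('k, nat \<Rightarrow> 'k) module. fin_dim_algebra A \<and>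
     linearly_equivalent C
       (fd_modules A :: (('k, nat \<Rightarrow> 'k, nat \<Rightarrow> 'k) alg_module, _, 'k) lin_cat))"

section \<open>Finite strict tensor categories\<close>

text \<open>\<open>Y\<close> is a left dual of \<open>X\<close>; equivalently, \<open>X\<close> is a right dual of \<open>Y\<close>.\<close>

definition left_dual :: "('o, 'm, 'k, 'x) tensor_cat_scheme \<Rightarrow> 'o \<Rightarrow> 'o \<Rightarrow> bool" where
  "left_dual C X Y \<longleftrightarrow> X \<in> Obj C \<and> Y \<in> Obj C \<and>
     (\<exists>ev \<in> Hom C (Y \<boxtimes>\<^bsub>C\<^esub> X) (Unit C). \<exists>coev \<in> Hom C (Unit C) (X \<boxtimes>\<^bsub>C\<^esub> Y).
        (Id C X \<star>\<^bsub>C\<^esub> ev) \<cdot>\<^bsub>C\<^esub> (coev \<star>\<^bsub>C\<^esub> Id C X) = Id C X \<and>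
        (ev \<star>\<^bsub>C\<^esub> Id C Y) \<cdot>\<^bsub>C\<^esub> (Id C Y \<star>\<^bsub>C\<^esub> coev) = Id C Y)"

locale finite_strict_tensor_category = abelian_linear_category C
  for C :: "('o, 'm, 'k::field, 'x) tensor_cat_scheme" (structure) +
  assumes Unit_Obj: "Unit C \<in> Obj C"
    and TObj_Obj: "X \<in> Obj C \<Longrightarrow> Y \<in> Obj C \<Longrightarrow> X \<boxtimes> Y \<in> Obj C"
    and TMor_Hom: "f \<in> Hom C X Y \<Longrightarrow> g \<in> Hom C X' Y' \<Longrightarrow> f \<star> g \<in> Hom C (X \<boxtimes> X') (Y \<boxtimes> Y')"
    and TMor_Id: "X \<in> Obj C \<Longrightarrow> Y \<in> Obj C \<Longrightarrow> Id C X \<star> Id C Y = Id C (X \<boxtimes> Y)"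
    and TMor_Comp: "f \<in> Hom C X Y \<Longrightarrow> g \<in> Hom C Y Z \<Longrightarrow> f' \<in> Hom C X' Y' \<Longrightarrow> g' \<in> Hom C Y' Z'
      \<Longrightarrow> (g \<cdot> f) \<star> (g' \<cdot> f') = (g \<star> g') \<cdot> (f \<star> f')"
    and TObj_assoc: "X \<in> Obj C \<Longrightarrow> Y \<in> Obj C \<Longrightarrow> Z \<in> Obj C \<Longrightarrow> (X \<boxtimes> Y) \<boxtimes> Z = X \<boxtimes> (Y \<boxtimes> Z)"
    and TObj_Unit: "X \<in> Obj C \<Longrightarrow> X \<boxtimes> Unit C = X"
    and Unit_TObj: "X \<in> Obj C \<Longrightarrow> Unit C \<boxtimes> X = X"
    and TMor_assoc: "f \<in> Hom C X X' \<Longrightarrow> g \<in> Hom C Y Y' \<Longrightarrow> h \<in> Hom C Z Z'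
      \<Longrightarrow> (f \<star> g) \<star> h = f \<star> (g \<star> h)"
    and TMor_Unit: "f \<in> Hom C X Y \<Longrightarrow> f \<star> Id C (Unit C) = f"
    and Unit_TMor: "f \<in> Hom C X Y \<Longrightarrow> Id C (Unit C) \<star> f = f"
    and TMor_Add_left: "f \<in> Hom C X Y \<Longrightarrow> f' \<in> Hom C X Y \<Longrightarrow> g \<in> Hom C X' Y'
      \<Longrightarrow> Add C f f' \<star> g = Add C (f \<star> g) (f' \<star> g)"
    and TMor_Add_right: "f \<in> Hom C X Y \<Longrightarrow> g \<in> Hom C X' Y' \<Longrightarrow> g' \<in> Hom C X' Y'
      \<Longrightarrow> f \<star> Add C g g' = Add C (f \<star> g) (f \<star> g')"
    and TMor_Scale_left: "f \<in> Hom C X Y \<Longrightarrow> g \<in> Hom C X' Y'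
      \<Longrightarrow> Scale C c f \<star> g = Scale C c (f \<star> g)"
    and TMor_Scale_right: "f \<in> Hom C X Y \<Longrightarrow> g \<in> Hom C X' Y'
      \<Longrightarrow> f \<star> Scale C c g = Scale C c (f \<star> g)"
    and ex_left_dual: "X \<in> Obj C \<Longrightarrow> \<exists>Y. left_dual C X Y"
    and ex_right_dual: "X \<in> Obj C \<Longrightarrow> \<exists>Y. left_dual C Y X"
    and Unit_simple: "simple_object C (Unit C)"
    \<comment> \<open>an algebra isomorphism from \<open>k\<close> to \<open>End(1)\<close> can only be the structure map\<close>
    and End_Unit: "bij_betw (\<lambda>c. Scale C c (Id C (Unit C))) UNIV (Hom C (Unit C) (Unit C))"
    and finite_linear: "finite_linear_category C"

definition strict_monoidal_functor ::
  "('c, 'f, 'k, 'x) tensor_cat_scheme \<Rightarrow> ('d, 'g, 'k, 'y) tensor_cat_scheme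
     \<Rightarrow> ('c, 'f, 'd, 'g) funct \<Rightarrow> bool" where
  "strict_monoidal_functor C D F \<longleftrightarrow>
     OMap F (Unit C) = Unit D \<and>
     (\<forall>X \<in> Obj C. \<forall>Y \<in> Obj C. OMap F (X \<boxtimes>\<^bsub>C\<^esub> Y) = OMap F X \<boxtimes>\<^bsub>D\<^esub> OMap F Y) \<and>
     (\<forall>X Y X' Y'. \<forall>f \<in> Hom C X Y. \<forall>g \<in> Hom C X' Y'.
        MMap F (f \<star>\<^bsub>C\<^esub> g) = MMap F f \<star>\<^bsub>D\<^esub> MMap F g)"

section \<open>The centralizer of a functor\<close>

text \<open>Half-braidings are made \<^const>\<open>undefined\<close> off the objects of \<open>C\<close>, so that equality of
  half-braidings is equality of their components.\<close>

definition half_braiding ::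
  "('c, 'f, 'k, 'x) tensor_cat_scheme \<Rightarrow> ('d, 'g, 'k, 'y) tensor_cat_scheme
     \<Rightarrow> ('c, 'f, 'd, 'g) funct \<Rightarrow> 'd \<Rightarrow> ('c \<Rightarrow> 'g) \<Rightarrow> bool" where
  "half_braiding C D F V \<rho> \<longleftrightarrow> V \<in> Obj D \<and> \<rho> \<in> extensional (Obj C) \<and>
     (\<forall>X \<in> Obj C. isomorphism D (V \<boxtimes>\<^bsub>D\<^esub> OMap F X) (OMap F X \<boxtimes>\<^bsub>D\<^esub> V) (\<rho> X)) \<and>
     (\<forall>X Y. \<forall>f \<in> Hom C X Y.
        (MMap F f \<star>\<^bsub>D\<^esub> Id D V) \<cdot>\<^bsub>D\<^esub> \<rho> X = \<rho> Y \<cdot>\<^bsub>D\<^esub> (Id D V \<star>\<^bsub>D\<^esub> MMap F f)) \<and>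
     (\<forall>X \<in> Obj C. \<forall>Y \<in> Obj C.
        \<rho> (X \<boxtimes>\<^bsub>C\<^esub> Y) = (Id D (OMap F X) \<star>\<^bsub>D\<^esub> \<rho> Y) \<cdot>\<^bsub>D\<^esub> (\<rho> X \<star>\<^bsub>D\<^esub> Id D (OMap F Y)))"

definition braided_maps ::
  "('c, 'f, 'k, 'x) tensor_cat_scheme \<Rightarrow> ('d, 'g, 'k, 'y) tensor_cat_scheme
     \<Rightarrow> ('c, 'f, 'd, 'g) funct \<Rightarrow> 'd \<times> ('c \<Rightarrow> 'g) \<Rightarrow> 'd \<times> ('c \<Rightarrow> 'g) \<Rightarrow> 'g set" where
  "braided_maps C D F = (\<lambda>(V, \<rho>) (W, \<sigma>). {f \<in> Hom D V W.
     \<forall>X \<in> Obj C. (Id D (OMap F X) \<star>\<^bsub>D\<^esub> f) \<cdot>\<^bsub>D\<^esub> \<rho> X = \<sigma> X \<cdot>\<^bsub>D\<^esub> (f \<star>\<^bsub>D\<^esub> Id D (OMap F X))})"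

text \<open>As for modules, a morphism is a triple of source, underlying morphism of \<open>D\<close>, and target.\<close>

definition centralizer ::
  "('c, 'f, 'k, 'x) tensor_cat_scheme \<Rightarrow> ('d, 'g, 'k, 'y) tensor_cat_scheme
     \<Rightarrow> ('c, 'f, 'd, 'g) funct
     \<Rightarrow> ('d \<times> ('c \<Rightarrow> 'g), ('d \<times> ('c \<Rightarrow> 'g)) \<times> 'g \<times> ('d \<times> ('c \<Rightarrow> 'g)), 'k) tensor_cat" where
  "centralizer C D F =
    (let tens = (\<lambda>(V, \<rho>) (W, \<sigma>). (V \<boxtimes>\<^bsub>D\<^esub> W,
           \<lambda>X \<in> Obj C. (\<rho> X \<star>\<^bsub>D\<^esub> Id D W) \<cdot>\<^bsub>D\<^esub> (Id D V \<star>\<^bsub>D\<^esub> \<sigma> X)))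
     in \<lparr>
       Obj = {(V, \<rho>). half_braiding C D F V \<rho>},
       Hom = (\<lambda>P Q. {(P, f, Q) | f. half_braiding C D F (fst P) (snd P) \<and>
                       half_braiding C D F (fst Q) (snd Q) \<and> f \<in> braided_maps C D F P Q}),
       Id = (\<lambda>P. (P, Id D (fst P), P)),
       Comp = (\<lambda>(Q, g, R) (P, f, Q'). (P, g \<cdot>\<^bsub>D\<^esub> f, R)),
       Zero = (\<lambda>P Q. (P, Zero D (fst P) (fst Q), Q)),
       Add = (\<lambda>(P, f, Q) (P', g, Q'). (P, Add D f g, Q)),
       Scale = (\<lambda>c (P, f, Q). (P, Scale D c f, Q)),
       Unit = (Unit D, \<lambda>X \<in> Obj C. Id D (OMap F X)),
       TObj = tens,
       TMor = (\<lambda>(P, f, Q) (P', g, Q'). (tens P P', f \<star>\<^bsub>D\<^esub> g, tens Q Q'))\<rparr>)"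

section \<open>Davydov--Yetter cohomology with trivial coefficients\<close>

definition tensor_objs :: "('o, 'm, 'k, 'x) tensor_cat_scheme \<Rightarrow> 'o list \<Rightarrow> 'o" where
  "tensor_objs D Xs = foldr (TObj D) Xs (Unit D)"

definition tensor_mors :: "('o, 'm, 'k, 'x) tensor_cat_scheme \<Rightarrow> 'm list \<Rightarrow> 'm" where
  "tensor_mors D fs = foldr (TMor D) fs (Id D (Unit D))"

definition obj_lists :: "('o, 'm, 'x) cat_scheme \<Rightarrow> nat \<Rightarrow> 'o list set" where
  "obj_lists C n = {Xs. length Xs = n \<and> set Xs \<subseteq> Obj C}"

definition F_tensor ::
  "('d, 'g, 'k, 'y) tensor_cat_scheme \<Rightarrow> ('c, 'f, 'd, 'g) funct \<Rightarrow> 'c list \<Rightarrow> 'd" where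
  "F_tensor D F Xs = tensor_objs D (map (OMap F) Xs)"

definition DY_cochains ::
  "('c, 'f, 'k, 'x) tensor_cat_scheme \<Rightarrow> ('d, 'g, 'k, 'y) tensor_cat_scheme
     \<Rightarrow> ('c, 'f, 'd, 'g) funct \<Rightarrow> nat \<Rightarrow> ('k, 'c list \<Rightarrow> 'g) module" where
  "DY_cochains C D F n = \<lparr>
     carrier = {\<phi> \<in> extensional (obj_lists C n).
       (\<forall>Xs \<in> obj_lists C n. \<phi> Xs \<in> Hom D (F_tensor D F Xs) (F_tensor D F Xs)) \<and>
       (\<forall>Xs \<in> obj_lists C n. \<forall>Ys \<in> obj_lists C n. \<forall>fs.
          length fs = n \<and> (\<forall>i<n. fs ! i \<in> Hom C (Xs ! i) (Ys ! i)) \<longrightarrow>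
          tensor_mors D (map (MMap F) fs) \<cdot>\<^bsub>D\<^esub> \<phi> Xs = \<phi> Ys \<cdot>\<^bsub>D\<^esub> tensor_mors D (map (MMap F) fs))},
     mult = undefined,
     one = undefined,
     zero = (\<lambda>Xs \<in> obj_lists C n. Zero D (F_tensor D F Xs) (F_tensor D F Xs)),
     add = (\<lambda>\<phi> \<psi>. \<lambda>Xs \<in> obj_lists C n. Add D (\<phi> Xs) (\<psi> Xs)),
     smult = (\<lambda>c \<phi>. \<lambda>Xs \<in> obj_lists C n. Scale D c (\<phi> Xs))\<rparr>"

text \<open>For \<open>Xs = [X\<^sub>0, \<dots>, X\<^sub>n]\<close> and \<open>1 \<le> i \<le> n\<close> this is
  \<open>[X\<^sub>0, \<dots>, X\<^sub>i\<^sub>-\<^sub>1 \<boxtimes> X\<^sub>i, \<dots>, X\<^sub>n]\<close>.\<close>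

definition merge_at :: "('c, 'f, 'k, 'x) tensor_cat_scheme \<Rightarrow> nat \<Rightarrow> 'c list \<Rightarrow> 'c list" where
  "merge_at C i Xs = take (i - 1) Xs @ [(Xs ! (i - 1)) \<boxtimes>\<^bsub>C\<^esub> (Xs ! i)] @ drop (Suc i) Xs"

definition DY_diff ::
  "('c, 'f, 'k::field, 'x) tensor_cat_scheme \<Rightarrow> ('d, 'g, 'k, 'y) tensor_cat_scheme
     \<Rightarrow> ('c, 'f, 'd, 'g) funct \<Rightarrow> nat \<Rightarrow> ('c list \<Rightarrow> 'g) \<Rightarrow> ('c list \<Rightarrow> 'g)" where
  "DY_diff C D F n \<phi> = (\<lambda>Xs \<in> obj_lists C (Suc n).
     let E = hom_space D (F_tensor D F Xs) (F_tensor D F Xs) in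
       (Id D (OMap F (hd Xs)) \<star>\<^bsub>D\<^esub> \<phi> (tl Xs))
       \<oplus>\<^bsub>E\<^esub> (\<Oplus>\<^bsub>E\<^esub>i \<in> {1..n}. (- 1) ^ i \<odot>\<^bsub>E\<^esub> \<phi> (merge_at C i Xs))
       \<oplus>\<^bsub>E\<^esub> (- 1) ^ (n + 1) \<odot>\<^bsub>E\<^esub> (\<phi> (butlast Xs) \<star>\<^bsub>D\<^esub> Id D (OMap F (last Xs))))"

definition DY_cocycles ::
  "('c, 'f, 'k::field, 'x) tensor_cat_scheme \<Rightarrow> ('d, 'g, 'k, 'y) tensor_cat_scheme
     \<Rightarrow> ('c, 'f, 'd, 'g) funct \<Rightarrow> nat \<Rightarrow> ('c list \<Rightarrow> 'g) set" where
  "DY_cocycles C D F n =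
     a_kernel (DY_cochains C D F n) (DY_cochains C D F (Suc n)) (DY_diff C D F n)"

definition DY_coboundaries ::
  "('c, 'f, 'k::field, 'x) tensor_cat_scheme \<Rightarrow> ('d, 'g, 'k, 'y) tensor_cat_scheme
     \<Rightarrow> ('c, 'f, 'd, 'g) funct \<Rightarrow> nat \<Rightarrow> ('c list \<Rightarrow> 'g) set" where
  "DY_coboundaries C D F n = (case n of
       0 \<Rightarrow> {\<zero>\<^bsub>DY_cochains C D F 0\<^esub>}
     | Suc m \<Rightarrow> DY_diff C D F m ` carrier (DY_cochains C D F m))"

definition DY_cohomology ::
  "('c, 'f, 'k::field, 'x) tensor_cat_scheme \<Rightarrow> ('d, 'g, 'k, 'y) tensor_cat_scheme
     \<Rightarrow> ('c, 'f, 'd, 'g) funct \<Rightarrow> nat \<Rightarrow> ('c list \<Rightarrow> 'g) set monoid" where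
  "DY_cohomology C D F n =
     (DY_cochains C D F n)\<lparr>carrier := DY_cocycles C D F n\<rparr> A_Mod DY_coboundaries C D F n"

end

theory Submission
  imports Defs
begin

text \<open>
  A \<open>1\<close>-cocycle is a natural endomorphism \<open>f\<close> of \<open>F\<close> with
  \<open>f\<^bsub>X \<otimes> Y\<^esub> = id \<otimes> f\<^bsub>Y\<^esub> + f\<^bsub>X\<^esub> \<otimes> id\<close>, that is, a derivation of the tensor functor. The only
  \<open>1\<close>-coboundary is zero, because \<open>End(1)\<close> consists of scalars, and scalars commute with everything.
  Both halves of the theorem therefore say that a derivation vanishes
  (\<open>DY_cohomology_1_trivial\<close>).

  \<^emph>\<open>Vanishing from Ext.\<close> On \<open>S = 1 \<oplus> 1\<close> the matrices with rows \<open>(id, f\<^bsub>X\<^esub>)\<close> and \<open>(0, id)\<close> are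
  isomorphisms \<open>S \<otimes> F(X) \<rightarrow> F(X) \<otimes> S\<close>. The product of two such unipotent matrices adds the
  off-diagonal entries, so that the derivation rule is exactly the hexagon: \<open>S\<close> becomes an object of the
  centralizer, and an extension of \<open>1\<close> by \<open>1\<close> there. A section has the form \<open>(c, id)\<close> with a scalar
  \<open>c\<close>, and it is compatible with the half-braidings only if \<open>c = c + f\<^bsub>X\<^esub>\<close>. Hence a split extension
  forces \<open>f = 0\<close> (\<open>split_imp_zero\<close>).

  \<^emph>\<open>Characteristic zero.\<close> A derivation is a primitive element of the bialgebra-like object \<open>End(F)\<close>, and a
  finite-dimensional bialgebra in characteristic zero has no nonzero primitive elements. The argument
  is carried out directly on \<open>f\<close>, without the centralizer.

  \<^item> \<^emph>\<open>Boundedness.\<close> One product of linear factors \<open>(t - c\<^sub>1) \<cdots> (t - c\<^sub>n)\<close> annihilates every \<open>f\<^bsub>X\<^esub>\<close>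
  (\<open>ex_uniform_annihilator\<close>): it exists for the image of a projective generator \<open>P\<close> of \<open>C\<close>, because
  \<open>End(F(P))\<close> is finite-dimensional and \<open>k\<close> is algebraically closed; and it passes to direct sums and
  quotients, as \<open>F\<close> is exact and \<open>f\<close> natural.

  \<^item> \<^emph>\<open>No zero divisors.\<close> The tensor product of nonzero morphisms of \<open>D\<close> is nonzero
  (\<open>TMor_eq_Zero\<close>), by rigidity and the simplicity of \<open>1\<close>.

  \<^item> \<^emph>\<open>Eigenvalues.\<close> If \<open>f\<^bsub>X\<^esub> u = a u\<close> and \<open>f\<^bsub>Y\<^esub> v = b v\<close>, then \<open>f\<^bsub>X \<otimes> Y\<^esub>\<close> has the eigenvector \<open>u \<otimes> v\<close> for
  \<open>a + b\<close>. The eigenvalues form a finite set closed under addition, so that in characteristic zero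
  only \<open>0\<close> is left, and all \<open>f\<^bsub>X\<^esub>\<close> are nilpotent of bounded order.

  \<^item> \<^emph>\<open>Nilpotency.\<close> Let \<open>m\<close> be the least common order. If \<open>m \<ge> 2\<close>, then by the binomial formula
  \<open>0 = f\<^bsub>X \<otimes> X\<^esub>\<^sup>m (f\<^bsub>X\<^esub>\<^bsup>m-2\<^esup> \<otimes> id) = m f\<^bsub>X\<^esub>\<^bsup>m-1\<^esup> \<otimes> f\<^bsub>X\<^esub>\<^bsup>m-1\<^esup>\<close>, whence \<open>f\<^bsub>X\<^esub>\<^bsup>m-1\<^esup> = 0\<close> for all \<open>X\<close>,
  against the choice of \<open>m\<close> (\<open>zero_if_annihilated\<close>).
\<close>

section \<open>Products of linear factors in an endomorphism\<close>

text \<open>The vector \<open>(T - c\<^sub>1) \<cdots> (T - c\<^sub>n) v\<close>. Over an algebraically closed field, annihilation by a nonzero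
  polynomial amounts to annihilation by such a product, and a list of scalars is easier to transport between vector
  spaces, to concatenate and to cancel factors from than a polynomial.\<close>

definition lin_factors ::
  "('k::field, 'v, 'x) module_scheme \<Rightarrow> ('v \<Rightarrow> 'v) \<Rightarrow> 'k list \<Rightarrow> 'v \<Rightarrow> 'v" where
  "lin_factors V T ls = foldr (\<lambda>c w. T w \<oplus>\<^bsub>V\<^esub> (- c) \<odot>\<^bsub>V\<^esub> w) ls"

lemma lin_factors_simps [simp]:
  "lin_factors V T [] v = v"
  "lin_factors V T (c # ls) v =
     T (lin_factors V T ls v) \<oplus>\<^bsub>V\<^esub> (- c) \<odot>\<^bsub>V\<^esub> lin_factors V T ls v"
  by (simp_all add: lin_factors_def)

lemma lin_factors_append:
  "lin_factors V T (ls @ ls') v = lin_factors V T ls (lin_factors V T ls' v)"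
  by (simp add: lin_factors_def)

locale k_space = vectorspace "class_ring :: 'k ring" V
  for V :: "('k::field, 'v, 'x) module_scheme" (structure)
begin

lemma scale_closed [simp, intro]: "v \<in> carrier V \<Longrightarrow> c \<odot> v \<in> carrier V"
  by (rule smult_closed) simp_all

lemma scale_add: "v \<in> carrier V \<Longrightarrow> w \<in> carrier V \<Longrightarrow> c \<odot> (v \<oplus> w) = c \<odot> v \<oplus> c \<odot> w"
  by (rule smult_r_distr) simp_all

lemma add_scale: "v \<in> carrier V \<Longrightarrow> (c + d) \<odot> v = c \<odot> v \<oplus> d \<odot> v"
  using smult_l_distr[of c d v] by simp

lemma scale_scale: "v \<in> carrier V \<Longrightarrow> c \<odot> (d \<odot> v) = (c * d) \<odot> v"
  using smult_assoc1[of c d v] by simp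

lemma one_scale [simp]: "v \<in> carrier V \<Longrightarrow> 1 \<odot> v = v"
  using smult_one[of v] by simp

lemma zero_scale [simp]: "v \<in> carrier V \<Longrightarrow> 0 \<odot> v = \<zero>"
  using smult_l_null[of v] by simp

lemma scale_zero [simp]: "c \<odot> \<zero> = \<zero>"
  using smult_r_null[of c] by simp

lemma scale_eq_zero_iff: "v \<in> carrier V \<Longrightarrow> c \<odot> v = \<zero> \<longleftrightarrow> c = 0 \<or> v = \<zero>"
proof
  assume v: "v \<in> carrier V" and z: "c \<odot> v = \<zero>"
  show "c = 0 \<or> v = \<zero>"
  proof (rule disjCI)
    assume "v \<noteq> \<zero>"
    show "c = 0"
    proof (rule ccontr)
      assume "c \<noteq> 0"
      then have "v = inverse c \<odot> (c \<odot> v)"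
        using v by (simp add: scale_scale)
      with z \<open>v \<noteq> \<zero>\<close> show False by simp
    qed
  qed
qed auto

lemma finsum_single: "f x \<in> carrier V \<Longrightarrow> (\<Oplus>i\<in>{x}. f i) = f x"
  by (subst finsum_insert) auto

text \<open>The span of \<open>B\<close> is the least subspace containing \<open>B\<close>; \<open>S\<close> is typically the kernel of a linear map or
  the set where two of them agree.\<close>

lemma span_subset_closed:
  assumes B: "B \<subseteq> carrier V" "B \<subseteq> S"
    and "\<zero> \<in> S" and "\<And>u w. u \<in> S \<Longrightarrow> w \<in> S \<Longrightarrow> u \<oplus> w \<in> S" and "\<And>c u. u \<in> S \<Longrightarrow> c \<odot> u \<in> S"
  shows "span B \<subseteq> S"
proof -
  have "lincomb a A \<in> S" if "finite A" "A \<subseteq> B" for a A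
    using that
  proof (induction A rule: finite_induct)
    case (insert x A)
    then have "lincomb a (insert x A) = a x \<odot> x \<oplus> lincomb a A"
      unfolding lincomb_def using B by (subst finsum_insert) (auto simp: Pi_def)
    then show ?case using insert assms by auto
  qed (use assms in \<open>simp add: lincomb_def\<close>)
  then show ?thesis unfolding span_def by blast
qed

lemma minus_one_scale: "v \<in> carrier V \<Longrightarrow> v \<oplus> (-1) \<odot> v = \<zero>"
  using add_scale[of v 1 "-1"] by simp

end

locale k_endo = k_space V
  for V :: "('k::field, 'v, 'x) module_scheme" (structure) +
  fixes T :: "'v \<Rightarrow> 'v"
  assumes T_closed [simp, intro]: "v \<in> carrier V \<Longrightarrow> T v \<in> carrier V"
    and T_add: "v \<in> carrier V \<Longrightarrow> w \<in> carrier V \<Longrightarrow> T (v \<oplus> w) = T v \<oplus> T w"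
    and T_scale: "v \<in> carrier V \<Longrightarrow> T (c \<odot> v) = c \<odot> T v"
begin

lemma T_zero [simp]: "T \<zero> = \<zero>"
  using T_scale[of \<zero> 0] by simp

lemma lin_factors_closed [simp, intro]:
  "v \<in> carrier V \<Longrightarrow> lin_factors V T ls v \<in> carrier V"
  by (induction ls) auto

lemma lin_factors_add: "v \<in> carrier V \<Longrightarrow> w \<in> carrier V \<Longrightarrow>
    lin_factors V T ls (v \<oplus> w) = lin_factors V T ls v \<oplus> lin_factors V T ls w"
  by (induction ls) (simp_all add: T_add scale_add a_ac)

lemma lin_factors_scale: "v \<in> carrier V \<Longrightarrow>
    lin_factors V T ls (c \<odot> v) = c \<odot> lin_factors V T ls v"
  by (induction ls) (simp_all add: T_scale scale_add scale_scale mult.commute)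

lemma lin_factors_zero [simp]: "lin_factors V T ls \<zero> = \<zero>"
  by (induction ls) simp_all

lemma lin_factors_T: "v \<in> carrier V \<Longrightarrow> lin_factors V T ls (T v) = T (lin_factors V T ls v)"
  by (induction ls) (simp_all add: T_add T_scale)

lemma lin_factors_commute: "v \<in> carrier V \<Longrightarrow>
    lin_factors V T ls (lin_factors V T ls' v) = lin_factors V T ls' (lin_factors V T ls v)"
  by (induction ls) (simp_all add: lin_factors_add lin_factors_scale lin_factors_T)

lemma lin_factors_eigenvector:
  "v \<in> carrier V \<Longrightarrow> T v = c \<odot> v \<Longrightarrow>
    lin_factors V T ls v = (\<Prod>d\<leftarrow>ls. c - d) \<odot> v"
proof (induction ls)
  case (Cons d ls)
  then show ?case
    by (simp add: T_scale scale_scale add_scale[symmetric] algebra_simps)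
qed simp

text \<open>A factor \<open>T - c\<close> with \<open>c\<close> not an eigenvalue can be cancelled; if \<open>0\<close> is the only
  eigenvalue, only powers of \<open>T\<close> remain.\<close>

lemma nilpotent_if_no_nonzero_eigenvalue:
  assumes "\<And>c w. w \<in> carrier V \<Longrightarrow> T w = c \<odot> w \<Longrightarrow> c = 0 \<or> w = \<zero>"
    and "v \<in> carrier V" and "lin_factors V T ls v = \<zero>"
  shows "(T ^^ length ls) v = \<zero>"
  using assms(2,3)
proof (induction ls arbitrary: v)
  case (Cons c ls)
  let ?w = "lin_factors V T ls v"
  have w: "?w \<in> carrier V" using Cons.prems by simp
  have eig: "T ?w = c \<odot> ?w"
  proof -
    have "c \<odot> ?w = (T ?w \<oplus> (- c) \<odot> ?w) \<oplus> c \<odot> ?w" using Cons.prems w by simp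
    also have "\<dots> = T ?w \<oplus> (- c + c) \<odot> ?w" unfolding add_scale[OF w] using w by (simp add: a_assoc del: lin_factors_closed)
    finally show ?thesis using w by simp
  qed
  show ?case
  proof (cases "c = 0")
    case True
    then have "lin_factors V T ls (T v) = \<zero>"
      using eig w Cons.prems by (simp add: lin_factors_T)
    then show ?thesis using Cons.IH[of "T v"] Cons.prems by (simp add: funpow_swap1)
  next
    case False
    then have "?w = \<zero>" using assms(1)[OF w eig] by simp
    then show ?thesis using Cons.IH[of v] Cons.prems by simp
  qed
qed simp

end

text \<open>Annihilation is transported in this way between endomorphism spaces, other hom-spaces and modules:
  composition with a fixed morphism and evaluation at a fixed vector are intertwining maps.\<close>

lemma lin_factors_intertwine:
  assumes "k_endo V T" and "v \<in> carrier V"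
    and "\<And>v w. v \<in> carrier V \<Longrightarrow> w \<in> carrier V \<Longrightarrow> \<phi> (v \<oplus>\<^bsub>V\<^esub> w) = \<phi> v \<oplus>\<^bsub>W\<^esub> \<phi> w"
    and "\<And>c v. v \<in> carrier V \<Longrightarrow> \<phi> (c \<odot>\<^bsub>V\<^esub> v) = c \<odot>\<^bsub>W\<^esub> \<phi> v"
    and "\<And>v. v \<in> carrier V \<Longrightarrow> \<phi> (T v) = S (\<phi> v)"
  shows "\<phi> (lin_factors V T ls v) = lin_factors W S ls (\<phi> v)"
proof -
  interpret k_endo V T by fact
  show ?thesis
    by (induction ls) (simp_all add: assms)
qed

context k_endo
begin

text \<open>This is \<open>p(T) v\<close>, in Horner form. The linearity of \<open>p \<mapsto> p(T) v\<close> turns a linear dependence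
  between \<open>v, T v, T\<^sup>2 v, \<dots>\<close> into an annihilating polynomial.\<close>

definition poly_act :: "'k poly \<Rightarrow> 'v \<Rightarrow> 'v" where
  "poly_act p v = fold_coeffs (\<lambda>a w. a \<odot> v \<oplus> T w) p \<zero>"

context
  fixes v assumes v: "v \<in> carrier V"
begin

lemma poly_act_0 [simp]: "poly_act 0 v = \<zero>"
  by (simp add: poly_act_def)

lemma poly_act_pCons: "poly_act (pCons a p) v = a \<odot> v \<oplus> T (poly_act p v)"
  using v by (cases "p = 0 \<and> a = 0")
    (auto simp: poly_act_def)

lemma poly_act_closed [simp, intro]: "poly_act p v \<in> carrier V"
  using v by (induction p) (simp_all add: poly_act_pCons)

lemma poly_act_add: "poly_act (p + q) v = poly_act p v \<oplus> poly_act q v"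
proof (induction p q rule: poly_induct2)
  case (pCons a p b q)
  then show ?case using v
    by (simp add: poly_act_pCons T_add add_scale a_ac)
qed simp

lemma poly_act_smult: "poly_act (Polynomial.smult c p) v = c \<odot> poly_act p v"
proof (induction p)
  case (pCons a p)
  then show ?case using v
    by (simp add: poly_act_pCons T_scale scale_add scale_scale)
qed simp

lemma poly_act_root_factor:
  "poly_act ([:- c, 1:] * p) v = T (poly_act p v) \<oplus> (- c) \<odot> poly_act p v"
proof -
  have "[:- c, 1:] * p = pCons 0 p + Polynomial.smult (- c) p" by (simp add: mult_pCons_left)
  then have "poly_act ([:- c, 1:] * p) v = poly_act (pCons 0 p) v \<oplus> poly_act (Polynomial.smult (- c) p) v"
    by (simp only: poly_act_add)
  also have "\<dots> = T (poly_act p v) \<oplus> (- c) \<odot> poly_act p v"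
    unfolding poly_act_smult using v by (simp add: poly_act_pCons)
  finally show ?thesis .
qed

lemma poly_act_splits:
  assumes alg_closed: "\<And>p :: 'k poly. degree p > 0 \<Longrightarrow> \<exists>x. poly p x = 0"
  shows "p \<noteq> 0 \<Longrightarrow> \<exists>c ls. c \<noteq> 0 \<and> poly_act p v = lin_factors V T ls (c \<odot> v)"
proof (induction "degree p" arbitrary: p)
  case 0
  then obtain c where "p = [:c:]" by (metis degree_eq_zeroE)
  then have "c \<noteq> 0 \<and> poly_act p v = lin_factors V T [] (c \<odot> v)"
    using 0 v by (simp add: poly_act_pCons)
  then show ?case by blast
next
  case (Suc n)
  then obtain x where "poly p x = 0" using alg_closed[of p] by auto
  then obtain q where q: "p = [:- x, 1:] * q" by (metis poly_eq_0_iff_dvd dvdE)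
  then have "q \<noteq> 0" using Suc by auto
  then have "degree p = Suc (degree q)" unfolding q by (subst degree_mult_eq) auto
  then obtain c ls where "c \<noteq> 0" "poly_act q v = lin_factors V T ls (c \<odot> v)"
    using Suc.hyps \<open>q \<noteq> 0\<close> by (metis nat.inject)
  then have "c \<noteq> 0 \<and> poly_act p v = lin_factors V T (x # ls) (c \<odot> v)"
    unfolding q poly_act_root_factor by simp
  then show ?case by blast
qed

lemma poly_act_sum:
  "finite I \<Longrightarrow> poly_act (\<Sum>i\<in>I. p i) v = (\<Oplus>i\<in>I. poly_act (p i) v)"
  by (induction I rule: finite_induct) (simp_all add: poly_act_add)

text \<open>The \<open>dim + 1\<close> vectors \<open>v, T v, \<dots>\<close> either repeat, in which case a difference of two monomials does it, or
  they are too many to be linearly independent.\<close>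

lemma ex_annihilating_poly:
  assumes "fin_dim"
  shows "\<exists>p. p \<noteq> 0 \<and> poly_act p v = \<zero>"
proof -
  let ?f = "\<lambda>i. poly_act (monom 1 i) v"
  show ?thesis
  proof (cases "inj_on ?f {..dim}")
    case False
    then obtain i j where ij: "i \<noteq> j" "?f i = ?f j" by (auto simp: inj_on_def)
    have "poly_act (monom 1 i + Polynomial.smult (-1) (monom 1 j)) v = \<zero>"
      unfolding poly_act_add poly_act_smult ij(2) by (rule minus_one_scale) simp
    moreover have "coeff (monom 1 i + Polynomial.smult (-1) (monom 1 j)) i = (1 :: 'k)"
      using ij(1) by (simp add: coeff_monom)
    then have "monom 1 i + Polynomial.smult (-1) (monom 1 j) \<noteq> (0 :: 'k poly)"
      by (metis coeff_0 zero_neq_one)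
    ultimately show ?thesis by blast
  next
    case True
    then have card: "card (?f ` {..dim}) = Suc dim" by (simp add: card_image)
    have "?f ` {..dim} \<subseteq> carrier V" by auto
    then have "lin_dep (?f ` {..dim})"
      using li_le_dim(2)[OF assms, of "?f ` {..dim}"] card by auto
    then obtain A a w where A: "finite A" "A \<subseteq> ?f ` {..dim}" "lincomb a A = \<zero>" "w \<in> A" "a w \<noteq> 0"
      unfolding lin_dep_def by auto
    define I where "I = {i \<in> {..dim}. ?f i \<in> A}"
    have I: "finite I" "?f ` I = A" "inj_on ?f I"
      using A(2) True by (auto simp: I_def inj_on_def)
    define p where "p = (\<Sum>i\<in>I. Polynomial.smult (a (?f i)) (monom 1 i))"
    have "poly_act p v = (\<Oplus>i\<in>I. a (?f i) \<odot> ?f i)"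
      unfolding p_def by (simp only: poly_act_sum[OF I(1)] poly_act_smult)
    also have "\<dots> = (\<Oplus>u\<in>?f ` I. a u \<odot> u)"
      by (rule finsum_reindex[symmetric]) (use I(3) in auto)
    finally have "poly_act p v = \<zero>"
      using A(3) by (simp add: I(2) lincomb_def)
    moreover obtain i where i: "i \<in> I" "?f i = w" using A(4) I(2) by auto
    have "coeff p i = (\<Sum>j\<in>I. if i = j then a (?f j) else 0)"
      unfolding p_def coeff_sum by (rule sum.cong) (auto simp: coeff_monom)
    then have "coeff p i \<noteq> 0" using i I(1) A(5) by simp
    then have "p \<noteq> 0" by auto
    ultimately show ?thesis by blast
  qed
qed

lemma ex_lin_factors_vector:
  assumes "fin_dim" and "\<And>p :: 'k poly. degree p > 0 \<Longrightarrow> \<exists>x. poly p x = 0"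
  shows "\<exists>ls. lin_factors V T ls v = \<zero>"
proof -
  obtain p where p: "p \<noteq> 0" "poly_act p v = \<zero>" using ex_annihilating_poly[OF assms(1)] by blast
  obtain c ls where "c \<noteq> 0" "poly_act p v = lin_factors V T ls (c \<odot> v)"
    using poly_act_splits[OF assms(2) p(1)] by blast
  then have "lin_factors V T ls v = \<zero>"
    using p(2) v by (metis lin_factors_closed lin_factors_scale scale_eq_zero_iff)
  then show ?thesis by blast
qed

end

text \<open>The lists for the vectors of a finite spanning set are concatenated; the factors commute, so each
  of these vectors is still killed, and the kernel is a subspace.\<close>

lemma ex_lin_factors:
  assumes fd: "fin_dim" and alg_closed: "\<And>p :: 'k poly. degree p > 0 \<Longrightarrow> \<exists>x. poly p x = 0"
  shows "\<exists>ls. \<forall>v \<in> carrier V. lin_factors V T ls v = \<zero>"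
proof -
  obtain B where B: "finite B" "B \<subseteq> carrier V" "span B = carrier V"
    using fd unfolding fin_dim_def by auto
  have "\<exists>ls. \<forall>v \<in> B. lin_factors V T ls v = \<zero>" using B(1,2)
  proof (induction B rule: finite_induct)
    case (insert b B)
    then obtain ls where ls: "\<forall>v \<in> B. lin_factors V T ls v = \<zero>" by auto
    obtain ls' where ls': "lin_factors V T ls' b = \<zero>"
      using ex_lin_factors_vector[OF _ fd alg_closed, of b] insert.prems by blast
    have "\<forall>v \<in> insert b B. lin_factors V T (ls' @ ls) v = \<zero>"
      using ls ls' insert by (auto simp: lin_factors_append lin_factors_commute[of _ ls'])
    then show ?case by blast
  qed auto
  then obtain ls where ls: "\<forall>v \<in> B. lin_factors V T ls v = \<zero>" by blast
  let ?S = "{v \<in> carrier V. lin_factors V T ls v = \<zero>}"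
  have "span B \<subseteq> ?S"
    by (rule span_subset_closed) (use B(2) ls in \<open>auto simp: lin_factors_add lin_factors_scale\<close>)
  then have "\<forall>v \<in> carrier V. lin_factors V T ls v = \<zero>" unfolding B(3) by blast
  then show ?thesis by blast
qed

end

section \<open>Linear categories\<close>

lemma hom_space_simps [simp]:
  "carrier (hom_space C X Y) = Hom C X Y"
  "zero (hom_space C X Y) = Zero C X Y"
  "add (hom_space C X Y) = Add C"
  "module.smult (hom_space C X Y) = Scale C"
  by (simp_all add: hom_space_def)

context linear_category
begin

lemma Hom_k_space:
  assumes "X \<in> Obj C" and "Y \<in> Obj C" shows "k_space (hom_space C X Y)"
  unfolding k_space_def by (rule Hom_vectorspace[OF assms])

lemma Zero_Hom [intro]: "X \<in> Obj C \<Longrightarrow> Y \<in> Obj C \<Longrightarrow> Zero C X Y \<in> Hom C X Y"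
  using abelian_groupE(2)[OF module.axioms(2)[OF vectorspace.axioms(1)[OF Hom_vectorspace]]] by simp

context
  fixes X Y f assumes f: "f \<in> Hom C X Y"
begin

interpretation H: k_space "hom_space C X Y"
  by (rule Hom_k_space) (use Hom_Obj[OF f] in auto)

lemma Scale_Hom: "Scale C c f \<in> Hom C X Y" using H.scale_closed f by simp
lemma Scale_one: "Scale C 1 f = f" using H.one_scale f by simp
lemma Scale_zero: "Scale C 0 f = Zero C X Y" using H.zero_scale f by simp
lemma Add_Scale: "Scale C (c + d) f = Add C (Scale C c f) (Scale C d f)"
  using H.add_scale f by simp
lemma Scale_Zero: "Scale C c (Zero C X Y) = Zero C X Y" using H.scale_zero by simp
lemma Scale_eq_Zero_iff: "Scale C c f = Zero C X Y \<longleftrightarrow> c = 0 \<or> f = Zero C X Y"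
  using H.scale_eq_zero_iff f by simp
lemma Add_Zero: "Add C f (Zero C X Y) = f" using H.r_zero f by simp
lemma Zero_Add: "Add C (Zero C X Y) f = f" using H.l_zero f by simp
lemma Add_uminus: "Add C f (Scale C (-1) f) = Zero C X Y" using H.minus_one_scale f by simp
lemma uminus_Add: "Add C (Scale C (-1) f) f = Zero C X Y"
  using H.minus_one_scale f H.a_comm[of f "Scale C (-1) f"] Scale_Hom by simp

lemma Add_Hom: "g \<in> Hom C X Y \<Longrightarrow> Add C f g \<in> Hom C X Y"
  using H.a_closed f by simp
lemma Add_commute: "g \<in> Hom C X Y \<Longrightarrow> Add C f g = Add C g f"
  using H.a_comm f by simp
lemma Add_assoc: "g \<in> Hom C X Y \<Longrightarrow> h \<in> Hom C X Y \<Longrightarrow>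
    Add C (Add C f g) h = Add C f (Add C g h)"
  using H.a_assoc f by simp
lemma Add_left_cancel: "g \<in> Hom C X Y \<Longrightarrow> h \<in> Hom C X Y \<Longrightarrow> Add C f g = Add C f h \<longleftrightarrow> g = h"
  using H.module.M.add.right_cancel[of f g h] H.a_comm[of f] f by simp
lemma Add_right_eq_self: "g \<in> Hom C X Y \<Longrightarrow> Add C f g = f \<Longrightarrow> g = Zero C X Y"
  using Add_left_cancel[of g "Zero C X Y"] Add_Zero Zero_Hom[of X Y] Hom_Obj[OF f] by metis

end

lemma Comp_Zero:
  assumes f: "f \<in> Hom C Y Z" and X: "X \<in> Obj C" shows "f \<cdot> Zero C X Y = Zero C X Z"
proof -
  have z: "Zero C X Y \<in> Hom C X Y" using X Hom_Obj[OF f] by auto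
  show ?thesis
    using Comp_Scale_right[OF z f, of 0] Scale_zero[OF z] Scale_zero[OF Comp_Hom[OF z f]] by simp
qed

lemma Zero_Comp:
  assumes f: "f \<in> Hom C X Y" and Z: "Z \<in> Obj C" shows "Zero C Y Z \<cdot> f = Zero C X Z"
proof -
  have z: "Zero C Y Z \<in> Hom C Y Z" using Z Hom_Obj[OF f] by auto
  show ?thesis
    using Comp_Scale_left[OF f z, of 0] Scale_zero[OF z] Scale_zero[OF Comp_Hom[OF f z]] by simp
qed

lemma eq_if_diff_Zero:
  assumes f: "f \<in> Hom C X Y" and g: "g \<in> Hom C X Y" and z: "Add C f (Scale C (-1) g) = Zero C X Y"
  shows "f = g"
proof -
  have "f = Add C f (Add C (Scale C (-1) g) g)"
    unfolding uminus_Add[OF g] by (rule Add_Zero[OF f, symmetric])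
  also have "\<dots> = Add C (Add C f (Scale C (-1) g)) g"
    by (rule Add_assoc[OF f Scale_Hom[OF g] g, symmetric])
  also have "\<dots> = g" unfolding z by (rule Zero_Add[OF g])
  finally show ?thesis .
qed

lemma Comp_endo:
  assumes "f \<in> Hom C Y Y" and "X \<in> Obj C"
  shows "k_endo (hom_space C X Y) (\<lambda>g. f \<cdot> g)"
proof -
  interpret k_space "hom_space C X Y" using assms Hom_Obj by (intro Hom_k_space) auto
  show ?thesis
    by unfold_locales (use assms in \<open>auto intro: Comp_Hom simp: Comp_Add_right Comp_Scale_right\<close>)
qed

text \<open>A morphism into a biproduct is determined by its components, because \<open>j\<^sub>1 q\<^sub>1 + j\<^sub>2 q\<^sub>2 = id\<close>. Almost all equations
  between matrices below are checked in this way, or by the dual rule that follows.\<close>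

lemma biproduct_ext_into:
  assumes S: "is_biproduct C X Y S j1 j2 q1 q2" and f: "f \<in> Hom C W S" and g: "g \<in> Hom C W S"
    and 1: "q1 \<cdot> f = q1 \<cdot> g" and 2: "q2 \<cdot> f = q2 \<cdot> g"
  shows "f = g"
proof -
  have j: "j1 \<in> Hom C X S" "j2 \<in> Hom C Y S" "q1 \<in> Hom C S X" "q2 \<in> Hom C S Y"
    and id: "Add C (j1 \<cdot> q1) (j2 \<cdot> q2) = Id C S"
    using S by (auto simp: is_biproduct_def)
  have *: "h = Add C (j1 \<cdot> (q1 \<cdot> h)) (j2 \<cdot> (q2 \<cdot> h))" if h: "h \<in> Hom C W S" for h
  proof -
    have "h = Add C (j1 \<cdot> q1) (j2 \<cdot> q2) \<cdot> h" using id Id_Comp[OF h] by simp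
    then show ?thesis
      using Comp_Add_left[OF h Comp_Hom[OF j(3,1)] Comp_Hom[OF j(4,2)]]
        Comp_assoc[OF h j(3,1)] Comp_assoc[OF h j(4,2)] by simp
  qed
  show ?thesis using *[OF f] *[OF g] 1 2 by simp
qed

lemma biproduct_ext_from:
  assumes S: "is_biproduct C X Y S j1 j2 q1 q2" and f: "f \<in> Hom C S W" and g: "g \<in> Hom C S W"
    and 1: "f \<cdot> j1 = g \<cdot> j1" and 2: "f \<cdot> j2 = g \<cdot> j2"
  shows "f = g"
proof -
  have j: "j1 \<in> Hom C X S" "j2 \<in> Hom C Y S" "q1 \<in> Hom C S X" "q2 \<in> Hom C S Y"
    and id: "Add C (j1 \<cdot> q1) (j2 \<cdot> q2) = Id C S"
    using S by (auto simp: is_biproduct_def)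
  have *: "h = Add C ((h \<cdot> j1) \<cdot> q1) ((h \<cdot> j2) \<cdot> q2)" if h: "h \<in> Hom C S W" for h
  proof -
    have "h = h \<cdot> Add C (j1 \<cdot> q1) (j2 \<cdot> q2)" using id Comp_Id[OF h] by simp
    then show ?thesis
      using Comp_Add_right[OF Comp_Hom[OF j(3,1)] Comp_Hom[OF j(4,2)] h]
        Comp_assoc[OF j(3,1) h] Comp_assoc[OF j(4,2) h] by simp
  qed
  show ?thesis using *[OF f] *[OF g] 1 2 by simp
qed

lemma kernel_monomorphism:
  assumes "is_kernel C X Y f K i" shows "monomorphism C K X i"
  unfolding monomorphism_def
proof (intro conjI allI ballI impI)
  show i: "i \<in> Hom C K X" using assms by (simp add: is_kernel_def)
  fix W g h assume g: "g \<in> Hom C W K" and h: "h \<in> Hom C W K" and eq: "i \<cdot> g = i \<cdot> h"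
  have f: "f \<in> Hom C X Y" and fi: "f \<cdot> i = Zero C K Y" using assms by (auto simp: is_kernel_def)
  have "f \<cdot> (i \<cdot> g) = Zero C W Y"
    using Comp_assoc[OF g i f] fi Zero_Comp[OF g] Hom_Obj[OF f] by simp
  then have "\<exists>!t. t \<in> Hom C W K \<and> i \<cdot> t = i \<cdot> g"
    using assms Comp_Hom[OF g i] unfolding is_kernel_def by blast
  then show "g = h" using g h eq by metis
qed

end

section \<open>Tensor products of nonzero morphisms\<close>

context finite_strict_tensor_category
begin

lemma TMor_left_right:
  assumes f: "f \<in> Hom C X Y" and g: "g \<in> Hom C X' Y'"
  shows "f \<star> g = (f \<star> Id C Y') \<cdot> (Id C X \<star> g)"
  using TMor_Comp[OF Id_Hom f g Id_Hom] f g Hom_Obj[OF f] Hom_Obj[OF g]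
  by (simp add: Comp_Id Id_Comp)

lemma TMor_right_left:
  assumes f: "f \<in> Hom C X Y" and g: "g \<in> Hom C X' Y'"
  shows "f \<star> g = (Id C Y \<star> g) \<cdot> (f \<star> Id C X')"
  using TMor_Comp[OF f Id_Hom Id_Hom g] f g Hom_Obj[OF f] Hom_Obj[OF g]
  by (simp add: Comp_Id Id_Comp)

lemma Id_TMor_Comp:
  assumes f: "f \<in> Hom C X Y" and g: "g \<in> Hom C Y Z" and V: "V \<in> Obj C"
  shows "Id C V \<star> (g \<cdot> f) = (Id C V \<star> g) \<cdot> (Id C V \<star> f)"
  using TMor_Comp[OF Id_Hom[OF V] Id_Hom[OF V] f g] by (simp add: Comp_Id[OF Id_Hom[OF V]])

lemma TMor_Id_Comp:
  assumes f: "f \<in> Hom C X Y" and g: "g \<in> Hom C Y Z" and V: "V \<in> Obj C"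
  shows "(g \<cdot> f) \<star> Id C V = (g \<star> Id C V) \<cdot> (f \<star> Id C V)"
  using TMor_Comp[OF f g Id_Hom[OF V] Id_Hom[OF V]] by (simp add: Comp_Id[OF Id_Hom[OF V]])

lemma TMor_Zero:
  assumes f: "f \<in> Hom C X Y" and Z: "X' \<in> Obj C" "Y' \<in> Obj C"
  shows "f \<star> Zero C X' Y' = Zero C (X \<boxtimes> X') (Y \<boxtimes> Y')"
proof -
  have z: "Zero C X' Y' \<in> Hom C X' Y'" using Z by auto
  show ?thesis
    using TMor_Scale_right[OF f z, of 0] Scale_zero[OF z] Scale_zero[OF TMor_Hom[OF f z]] by simp
qed

lemma Zero_TMor:
  assumes f: "f \<in> Hom C X Y" and Z: "X' \<in> Obj C" "Y' \<in> Obj C"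
  shows "Zero C X' Y' \<star> f = Zero C (X' \<boxtimes> X) (Y' \<boxtimes> Y)"
proof -
  have z: "Zero C X' Y' \<in> Hom C X' Y'" using Z by auto
  show ?thesis
    using TMor_Scale_left[OF z f, of 0] Scale_zero[OF z] Scale_zero[OF TMor_Hom[OF z f]] by simp
qed

text \<open>The unit is simple: the kernel of \<open>h\<close> is all of \<open>1\<close> or zero.\<close>

lemma Comp_through_Unit_eq_Zero:
  assumes g: "g \<in> Hom C A (Unit C)" and h: "h \<in> Hom C (Unit C) B" and hg: "h \<cdot> g = Zero C A B"
  shows "g = Zero C A (Unit C) \<or> h = Zero C (Unit C) B"
proof -
  obtain K i where K: "is_kernel C (Unit C) B h K i" using ex_kernel[OF h] by blast
  then have i: "i \<in> Hom C K (Unit C)" and hi: "h \<cdot> i = Zero C K B" by (auto simp: is_kernel_def)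
  have A: "A \<in> Obj C" "B \<in> Obj C" "K \<in> Obj C" "Unit C \<in> Obj C"
    using Hom_Obj[OF g] Hom_Obj[OF h] Hom_Obj[OF i] by auto
  from kernel_monomorphism[OF K] consider "zero_object C K" | "isomorphism C K (Unit C) i"
    using Unit_simple unfolding simple_object_def by blast
  then show ?thesis
  proof cases
    case 1
    obtain t where t: "t \<in> Hom C A K" "i \<cdot> t = g"
      using K g hg unfolding is_kernel_def by blast
    have "Zero C K (Unit C) = i"
      using 1 i A Zero_Hom unfolding zero_object_def by blast
    then show ?thesis using t Zero_Comp[OF t(1) A(4)] by simp
  next
    case 2
    then obtain r where r: "r \<in> Hom C (Unit C) K" "i \<cdot> r = Id C (Unit C)"
      unfolding isomorphism_def by blast
    have "h = (h \<cdot> i) \<cdot> r" using Comp_assoc[OF r(1) i h] r Comp_Id[OF h] by simp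
    then show ?thesis using hi Zero_Comp[OF r(1) A(2)] by simp
  qed
qed

text \<open>Move \<open>V'\<close> and \<open>W\<close> across by duality: \<open>g\<close> becomes a map to \<open>1\<close> and \<open>h\<close> one from \<open>1\<close>, and
  \<open>g \<star> h\<close> becomes their composite through \<open>1\<close>.\<close>

lemma TMor_eq_Zero:
  assumes g: "g \<in> Hom C V V'" and h: "h \<in> Hom C W W'"
    and gh: "g \<star> h = Zero C (V \<boxtimes> W) (V' \<boxtimes> W')"
  shows "g = Zero C V V' \<or> h = Zero C W W'"
proof -
  let ?I = "Unit C"
  note O = Hom_Obj[OF g] Hom_Obj[OF h] Unit_Obj
  obtain Y ev coev where Y: "Y \<in> Obj C" and ev: "ev \<in> Hom C (Y \<boxtimes> V') ?I"
    and coev: "coev \<in> Hom C ?I (V' \<boxtimes> Y)"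
    and zz: "(Id C V' \<star> ev) \<cdot> (coev \<star> Id C V') = Id C V'"
    using ex_left_dual[of V'] O unfolding left_dual_def by blast
  obtain U ev' coev' where U: "U \<in> Obj C" and ev': "ev' \<in> Hom C (U \<boxtimes> W) ?I"
    and coev': "coev' \<in> Hom C ?I (W \<boxtimes> U)"
    and zz': "(Id C W \<star> ev') \<cdot> (coev' \<star> Id C W) = Id C W"
    using ex_left_dual[of W] O unfolding left_dual_def by blast
  have I: "Id C V \<in> Hom C V V" "Id C V' \<in> Hom C V' V'" "Id C W \<in> Hom C W W"
    "Id C W' \<in> Hom C W' W'" "Id C Y \<in> Hom C Y Y" "Id C U \<in> Hom C U U" "Id C ?I \<in> Hom C ?I ?I"
    using O Y U Id_Hom by auto
  have a: "Id C Y \<star> g \<in> Hom C (Y \<boxtimes> V) (Y \<boxtimes> V')" by (rule TMor_Hom[OF I(5) g])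
  have b: "h \<star> Id C U \<in> Hom C (W \<boxtimes> U) (W' \<boxtimes> U)" by (rule TMor_Hom[OF h I(6)])
  define g' where "g' = ev \<cdot> (Id C Y \<star> g)"
  define h' where "h' = (h \<star> Id C U) \<cdot> coev'"
  have g': "g' \<in> Hom C (Y \<boxtimes> V) ?I" unfolding g'_def by (rule Comp_Hom[OF a ev])
  have h': "h' \<in> Hom C ?I (W' \<boxtimes> U)" unfolding h'_def by (rule Comp_Hom[OF coev' b])
  have YV: "Y \<boxtimes> V \<in> Obj C" "W' \<boxtimes> U \<in> Obj C" "V' \<boxtimes> Y \<in> Obj C" "U \<boxtimes> W \<in> Obj C"
    using O Y U TObj_Obj by auto
  have g_g': "g = (Id C V' \<star> g') \<cdot> (coev \<star> Id C V)"
  proof -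
    have V: "V' \<boxtimes> (Y \<boxtimes> V) = (V' \<boxtimes> Y) \<boxtimes> V" "V' \<boxtimes> (Y \<boxtimes> V') = (V' \<boxtimes> Y) \<boxtimes> V'"
        "?I \<boxtimes> V = V" "?I \<boxtimes> V' = V'" "V' \<boxtimes> ?I = V'"
      using O Y by (simp_all add: TObj_assoc TObj_Unit Unit_TObj)
    have c: "coev \<star> Id C V \<in> Hom C V ((V' \<boxtimes> Y) \<boxtimes> V)" "coev \<star> Id C V' \<in> Hom C V' ((V' \<boxtimes> Y) \<boxtimes> V')"
      "Id C V' \<star> ev \<in> Hom C ((V' \<boxtimes> Y) \<boxtimes> V') V'"
      "Id C V' \<star> (Id C Y \<star> g) \<in> Hom C ((V' \<boxtimes> Y) \<boxtimes> V) ((V' \<boxtimes> Y) \<boxtimes> V')"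
      using TMor_Hom[OF coev I(1)] TMor_Hom[OF coev I(2)] TMor_Hom[OF I(2) ev] TMor_Hom[OF I(2) a]
      by (simp_all only: V)
    have e: "Id C V' \<star> (Id C Y \<star> g) = Id C (V' \<boxtimes> Y) \<star> g"
      using TMor_assoc[OF I(2) I(5) g] O Y by (simp add: TMor_Id)
    have "(Id C V' \<star> g') \<cdot> (coev \<star> Id C V)
        = ((Id C V' \<star> ev) \<cdot> (Id C V' \<star> (Id C Y \<star> g))) \<cdot> (coev \<star> Id C V)"
      unfolding g'_def using Id_TMor_Comp[OF a ev] O by simp
    also have "\<dots> = (Id C V' \<star> ev) \<cdot> ((Id C V' \<star> (Id C Y \<star> g)) \<cdot> (coev \<star> Id C V))"
      by (rule Comp_assoc[OF c(1) c(4) c(3)])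
    also have "(Id C V' \<star> (Id C Y \<star> g)) \<cdot> (coev \<star> Id C V) = coev \<star> g"
      unfolding e by (rule TMor_right_left[OF coev g, symmetric])
    also have "coev \<star> g = (coev \<star> Id C V') \<cdot> g"
      using TMor_left_right[OF coev g] by (simp add: Unit_TMor[OF g])
    also have "(Id C V' \<star> ev) \<cdot> ((coev \<star> Id C V') \<cdot> g) = g"
      using Comp_assoc[OF g c(2) c(3)] zz Id_Comp[OF g] by simp
    finally show ?thesis by simp
  qed
  have h_h': "h = (Id C W' \<star> ev') \<cdot> (h' \<star> Id C W)"
  proof -
    have V: "(W \<boxtimes> U) \<boxtimes> W = W \<boxtimes> (U \<boxtimes> W)" "(W' \<boxtimes> U) \<boxtimes> W = W' \<boxtimes> (U \<boxtimes> W)"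
        "?I \<boxtimes> W = W" "W' \<boxtimes> ?I = W'" "W \<boxtimes> ?I = W"
      using O U by (simp_all add: TObj_assoc TObj_Unit Unit_TObj)
    have c: "coev' \<star> Id C W \<in> Hom C W (W \<boxtimes> (U \<boxtimes> W))"
      "(h \<star> Id C U) \<star> Id C W \<in> Hom C (W \<boxtimes> (U \<boxtimes> W)) (W' \<boxtimes> (U \<boxtimes> W))"
      "Id C W' \<star> ev' \<in> Hom C (W' \<boxtimes> (U \<boxtimes> W)) W'" "Id C W \<star> ev' \<in> Hom C (W \<boxtimes> (U \<boxtimes> W)) W"
      using TMor_Hom[OF coev' I(3)] TMor_Hom[OF b I(3)] TMor_Hom[OF I(4) ev'] TMor_Hom[OF I(3) ev']
      by (simp_all only: V)
    have e: "(h \<star> Id C U) \<star> Id C W = h \<star> Id C (U \<boxtimes> W)"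
      using TMor_assoc[OF h I(6) I(3)] O U by (simp add: TMor_Id)
    have "(Id C W' \<star> ev') \<cdot> (h' \<star> Id C W)
        = (Id C W' \<star> ev') \<cdot> (((h \<star> Id C U) \<star> Id C W) \<cdot> (coev' \<star> Id C W))"
      unfolding h'_def using TMor_Id_Comp[OF coev' b] O by simp
    also have "\<dots> = ((Id C W' \<star> ev') \<cdot> ((h \<star> Id C U) \<star> Id C W)) \<cdot> (coev' \<star> Id C W)"
      by (rule Comp_assoc[OF c(1) c(2) c(3), symmetric])
    also have "(Id C W' \<star> ev') \<cdot> ((h \<star> Id C U) \<star> Id C W) = h \<star> ev'"
      unfolding e by (rule TMor_right_left[OF h ev', symmetric])
    also have "h \<star> ev' = h \<cdot> (Id C W \<star> ev')"
      using TMor_left_right[OF h ev'] by (simp add: TMor_Unit[OF h])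
    also have "(h \<cdot> (Id C W \<star> ev')) \<cdot> (coev' \<star> Id C W) = h"
      using Comp_assoc[OF c(1) c(4) h] zz' Comp_Id[OF h] by simp
    finally show ?thesis by simp
  qed
  have "h' \<cdot> g' = g' \<star> h'"
    using TMor_right_left[OF g' h'] by (simp add: TMor_Unit[OF g'] Unit_TMor[OF h'])
  also have "\<dots> = (ev \<star> Id C (W' \<boxtimes> U)) \<cdot> ((Id C Y \<star> g) \<star> h')"
    unfolding g'_def using TMor_Comp[OF a ev h' Id_Hom[OF YV(2)]] by (simp add: Id_Comp[OF h'])
  also have "(Id C Y \<star> g) \<star> h' = ((Id C Y \<star> g) \<star> (h \<star> Id C U)) \<cdot> (Id C (Y \<boxtimes> V) \<star> coev')"
    unfolding h'_def using TMor_Comp[OF Id_Hom[OF YV(1)] a coev' b] by (simp add: Comp_Id[OF a])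
  also have "(Id C Y \<star> g) \<star> (h \<star> Id C U) = Id C Y \<star> ((g \<star> h) \<star> Id C U)"
    using TMor_assoc[OF I(5) g b] TMor_assoc[OF g h I(6)] by simp
  also have "\<dots> = Zero C (Y \<boxtimes> ((V \<boxtimes> W) \<boxtimes> U)) (Y \<boxtimes> ((V' \<boxtimes> W') \<boxtimes> U))"
    unfolding gh using O Y U by (simp add: Zero_TMor[OF I(6)] TMor_Zero[OF I(5)] TObj_Obj)
  also have "Y \<boxtimes> ((V \<boxtimes> W) \<boxtimes> U) = (Y \<boxtimes> V) \<boxtimes> (W \<boxtimes> U)"
    using O Y U by (simp add: TObj_assoc TObj_Obj)
  also have "Y \<boxtimes> ((V' \<boxtimes> W') \<boxtimes> U) = (Y \<boxtimes> V') \<boxtimes> (W' \<boxtimes> U)"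
    using O Y U by (simp add: TObj_assoc TObj_Obj)
  also have "Zero C ((Y \<boxtimes> V) \<boxtimes> (W \<boxtimes> U)) ((Y \<boxtimes> V') \<boxtimes> (W' \<boxtimes> U)) \<cdot> (Id C (Y \<boxtimes> V) \<star> coev')
      = Zero C ((Y \<boxtimes> V) \<boxtimes> ?I) ((Y \<boxtimes> V') \<boxtimes> (W' \<boxtimes> U))"
    by (rule Zero_Comp[OF TMor_Hom[OF Id_Hom[OF YV(1)] coev']]) (use O Y U in \<open>simp add: TObj_Obj\<close>)
  also have "(ev \<star> Id C (W' \<boxtimes> U)) \<cdot> \<dots> = Zero C ((Y \<boxtimes> V) \<boxtimes> ?I) (?I \<boxtimes> (W' \<boxtimes> U))"
    by (rule Comp_Zero[OF TMor_Hom[OF ev Id_Hom[OF YV(2)]]]) (use YV O in \<open>simp add: TObj_Obj\<close>)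
  finally have "h' \<cdot> g' = Zero C (Y \<boxtimes> V) (W' \<boxtimes> U)"
    using YV by (simp add: TObj_Unit Unit_TObj)
  then consider "g' = Zero C (Y \<boxtimes> V) ?I" | "h' = Zero C ?I (W' \<boxtimes> U)"
    using Comp_through_Unit_eq_Zero[OF g' h'] by blast
  then show ?thesis
  proof cases
    case 1
    have "g = Zero C (V' \<boxtimes> (Y \<boxtimes> V)) (V' \<boxtimes> ?I) \<cdot> (coev \<star> Id C V)"
      using g_g' 1 TMor_Zero[OF I(2) YV(1), of ?I] O by simp
    also have "\<dots> = Zero C (?I \<boxtimes> V) (V' \<boxtimes> ?I)"
      using Zero_Comp[OF TMor_Hom[OF coev I(1)], of "V' \<boxtimes> ?I"] O Y by (simp add: TObj_assoc TObj_Obj)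
    finally show ?thesis using O by (simp add: TObj_Unit Unit_TObj)
  next
    case 2
    have "h = (Id C W' \<star> ev') \<cdot> Zero C (?I \<boxtimes> W) ((W' \<boxtimes> U) \<boxtimes> W)"
      using h_h' 2 Zero_TMor[OF I(3) _ YV(2), of ?I] O by simp
    also have "\<dots> = Zero C (?I \<boxtimes> W) (W' \<boxtimes> ?I)"
      using Comp_Zero[OF TMor_Hom[OF I(4) ev'], of "?I \<boxtimes> W"] O U by (simp add: TObj_assoc TObj_Obj)
    finally show ?thesis using O by (simp add: TObj_Unit Unit_TObj)
  qed
qed

end

section \<open>Derivations of a tensor functor: eigenvalues and nilpotency\<close>

text \<open>Composition with \<open>u\<close> intertwines composition with \<open>f\<close> on \<open>End(B)\<close> and on \<open>Hom(A, B)\<close>, so that a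
  product of linear factors in \<open>f\<close> may be formed in either space.\<close>

lemma (in linear_category) lin_factors_Comp:
  assumes f: "f \<in> Hom C B B" and u: "u \<in> Hom C A B"
  shows "lin_factors (hom_space C B B) (\<lambda>g. f \<cdot> g) ls (Id C B) \<cdot> u
    = lin_factors (hom_space C A B) (\<lambda>g. f \<cdot> g) ls u"
proof -
  have O: "A \<in> Obj C" "B \<in> Obj C" using Hom_Obj[OF u] by auto
  have "lin_factors (hom_space C B B) (\<lambda>g. f \<cdot> g) ls (Id C B) \<cdot> u
      = lin_factors (hom_space C A B) (\<lambda>g. f \<cdot> g) ls (Id C B \<cdot> u)"
    by (rule lin_factors_intertwine[where \<phi> = "\<lambda>g. g \<cdot> u", OF Comp_endo[OF f O(2)]])
      (use u f O in \<open>auto intro: Id_Hom simp: Comp_Add_left Comp_Scale_left Comp_assoc\<close>)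
  then show ?thesis by (simp add: Id_Comp[OF u])
qed

locale tensor_functor =
  C: finite_strict_tensor_category C + D: finite_strict_tensor_category D + linear_functor C D F
  for C :: "('c, 'f, 'k::field, 'x) tensor_cat_scheme"
    and D :: "('d, 'g, 'k, 'y) tensor_cat_scheme"
    and F :: "('c, 'f, 'd, 'g) funct" +
  assumes monoidal: "strict_monoidal_functor C D F"
begin

abbreviation FO where "FO \<equiv> OMap F"
abbreviation FM where "FM \<equiv> MMap F"

lemma F_TObj: "X \<in> Obj C \<Longrightarrow> Y \<in> Obj C \<Longrightarrow> FO (X \<boxtimes>\<^bsub>C\<^esub> Y) = FO X \<boxtimes>\<^bsub>D\<^esub> FO Y"
  using monoidal unfolding strict_monoidal_functor_def by blast

end

text \<open>The \<open>1\<close>-cocycles, freed from their encoding as functions on lists. In terms of the comultiplication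
  \<open>f \<mapsto> f\<^bsub>X \<otimes> Y\<^esub>\<close> on natural endomorphisms, these are the primitive elements.\<close>

locale tensor_derivation = tensor_functor C D F
  for C :: "('c, 'f, 'k::field, 'x) tensor_cat_scheme"
    and D :: "('d, 'g, 'k, 'y) tensor_cat_scheme"
    and F :: "('c, 'f, 'd, 'g) funct" +
  fixes f :: "'c \<Rightarrow> 'g"
  assumes f_Hom: "X \<in> Obj C \<Longrightarrow> f X \<in> Hom D (OMap F X) (OMap F X)"
    and f_natural: "u \<in> Hom C X Y \<Longrightarrow> MMap F u \<cdot>\<^bsub>D\<^esub> f X = f Y \<cdot>\<^bsub>D\<^esub> MMap F u"
    and f_TObj: "X \<in> Obj C \<Longrightarrow> Y \<in> Obj C \<Longrightarrow>
      f (X \<boxtimes>\<^bsub>C\<^esub> Y) = Add D (Id D (OMap F X) \<star>\<^bsub>D\<^esub> f Y) (f X \<star>\<^bsub>D\<^esub> Id D (OMap F Y))"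
begin

abbreviation End_F where "End_F X \<equiv> hom_space D (FO X) (FO X)"
abbreviation f_act where "f_act X \<equiv> \<lambda>g. f X \<cdot>\<^bsub>D\<^esub> g"

definition annihilates :: "'k list \<Rightarrow> 'c \<Rightarrow> bool" where
  "annihilates ls X \<longleftrightarrow>
    lin_factors (End_F X) (f_act X) ls (Id D (FO X)) = Zero D (FO X) (FO X)"

lemma f_endo: "X \<in> Obj C \<Longrightarrow> k_endo (End_F X) (f_act X)"
  by (intro D.Comp_endo f_Hom OMap_Obj)

lemma Leibniz:
  assumes X: "X \<in> Obj C" and Y: "Y \<in> Obj C"
    and u: "u \<in> Hom D A (FO X)" and v: "v \<in> Hom D B (FO Y)"
  shows "f (X \<boxtimes>\<^bsub>C\<^esub> Y) \<cdot>\<^bsub>D\<^esub> (u \<star>\<^bsub>D\<^esub> v)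
    = Add D (u \<star>\<^bsub>D\<^esub> (f Y \<cdot>\<^bsub>D\<^esub> v)) ((f X \<cdot>\<^bsub>D\<^esub> u) \<star>\<^bsub>D\<^esub> v)"
proof -
  have I: "Id D (FO X) \<in> Hom D (FO X) (FO X)" "Id D (FO Y) \<in> Hom D (FO Y) (FO Y)"
    using X Y by (auto intro: D.Id_Hom OMap_Obj)
  note fX = f_Hom[OF X] and fY = f_Hom[OF Y]
  show ?thesis
    unfolding f_TObj[OF X Y]
    using D.Comp_Add_left[OF D.TMor_Hom[OF u v] D.TMor_Hom[OF I(1) fY] D.TMor_Hom[OF fX I(2)]]
      D.TMor_Comp[OF u I(1) v fY] D.TMor_Comp[OF u fX v I(2)] D.Id_Comp[OF u] D.Id_Comp[OF v]
    by simp
qed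

lemma eigenvalue_add:
  assumes X: "X \<in> Obj C" and Y: "Y \<in> Obj C"
    and u: "u \<in> Hom D A (FO X)" and v: "v \<in> Hom D B (FO Y)"
    and fu: "f X \<cdot>\<^bsub>D\<^esub> u = Scale D a u" and fv: "f Y \<cdot>\<^bsub>D\<^esub> v = Scale D b v"
  shows "f (X \<boxtimes>\<^bsub>C\<^esub> Y) \<cdot>\<^bsub>D\<^esub> (u \<star>\<^bsub>D\<^esub> v) = Scale D (a + b) (u \<star>\<^bsub>D\<^esub> v)"
proof -
  note uv = D.TMor_Hom[OF u v]
  have "f (X \<boxtimes>\<^bsub>C\<^esub> Y) \<cdot>\<^bsub>D\<^esub> (u \<star>\<^bsub>D\<^esub> v) = Add D (Scale D b (u \<star>\<^bsub>D\<^esub> v)) (Scale D a (u \<star>\<^bsub>D\<^esub> v))"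
    unfolding Leibniz[OF X Y u v] fu fv
    by (simp add: D.TMor_Scale_left[OF u v] D.TMor_Scale_right[OF u v])
  also have "\<dots> = Scale D (a + b) (u \<star>\<^bsub>D\<^esub> v)"
    using D.Add_Scale[OF uv, of b a] by (simp add: add.commute)
  finally show ?thesis .
qed

text \<open>An eigenvector turns the product \<open>(f\<^bsub>X\<^esub> - c\<^sub>1) \<cdots> (f\<^bsub>X\<^esub> - c\<^sub>n)\<close> into the scalar \<open>(a - c\<^sub>1) \<cdots> (a - c\<^sub>n)\<close>. Eigenvectors are
  endomorphisms \<open>u\<close> of \<open>F(X)\<close> rather than subobjects; this avoids kernels altogether.\<close>

lemma eigenvalue_in_annihilator:
  assumes X: "X \<in> Obj C" and ls: "annihilates ls X"
    and u: "u \<in> Hom D (FO X) (FO X)" and u0: "u \<noteq> Zero D (FO X) (FO X)"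
    and fu: "f X \<cdot>\<^bsub>D\<^esub> u = Scale D a u"
  shows "a \<in> set ls"
proof -
  have "Zero D (FO X) (FO X) = lin_factors (End_F X) (f_act X) ls u"
    using D.lin_factors_Comp[OF f_Hom[OF X] u, of ls] ls D.Zero_Comp[OF u OMap_Obj[OF X]]
    unfolding annihilates_def by simp
  also have "\<dots> = Scale D (\<Prod>d\<leftarrow>ls. a - d) u"
    using k_endo.lin_factors_eigenvector[OF f_endo[OF X], of u a ls] u fu by simp
  finally have "(\<Prod>d\<leftarrow>ls. a - d) = 0"
    using u0 D.Scale_eq_Zero_iff[OF u] by metis
  then show ?thesis by (auto simp: prod_list_zero_iff)
qed

text \<open>Tensor powers of an eigenvector for \<open>a\<close> are eigenvectors for \<open>a, 2a, 3a, \<dots>\<close>, but only the finitely many entries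
  of \<open>ls\<close> can be eigenvalues.\<close>

lemma eigenvalue_eq_0:
  assumes ann: "\<And>X. X \<in> Obj C \<Longrightarrow> annihilates ls X" and char: "CHAR('k) = 0"
    and X: "X \<in> Obj C" and u: "u \<in> Hom D (FO X) (FO X)" and u0: "u \<noteq> Zero D (FO X) (FO X)"
    and fu: "f X \<cdot>\<^bsub>D\<^esub> u = Scale D a u"
  shows "a = 0"
proof (rule ccontr)
  assume a: "a \<noteq> 0"
  have "\<exists>Y \<in> Obj C. \<exists>v \<in> Hom D (FO Y) (FO Y). v \<noteq> Zero D (FO Y) (FO Y) \<and>
      f Y \<cdot>\<^bsub>D\<^esub> v = Scale D (of_nat (Suc n) * a) v" for n
  proof (induction n)
    case 0
    then show ?case using X u u0 fu by (intro bexI[of _ X] bexI[of _ u]) auto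
  next
    case (Suc n)
    then obtain Y v where Y: "Y \<in> Obj C" and v: "v \<in> Hom D (FO Y) (FO Y)"
      "v \<noteq> Zero D (FO Y) (FO Y)" "f Y \<cdot>\<^bsub>D\<^esub> v = Scale D (of_nat (Suc n) * a) v" by blast
    have XY: "X \<boxtimes>\<^bsub>C\<^esub> Y \<in> Obj C" by (rule C.TObj_Obj[OF X Y])
    have "u \<star>\<^bsub>D\<^esub> v \<in> Hom D (FO (X \<boxtimes>\<^bsub>C\<^esub> Y)) (FO (X \<boxtimes>\<^bsub>C\<^esub> Y))"
      using D.TMor_Hom[OF u v(1)] F_TObj[OF X Y] by simp
    moreover have "u \<star>\<^bsub>D\<^esub> v \<noteq> Zero D (FO (X \<boxtimes>\<^bsub>C\<^esub> Y)) (FO (X \<boxtimes>\<^bsub>C\<^esub> Y))"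
      using D.TMor_eq_Zero[OF u v(1)] u0 v(2) F_TObj[OF X Y] by auto
    moreover have "f (X \<boxtimes>\<^bsub>C\<^esub> Y) \<cdot>\<^bsub>D\<^esub> (u \<star>\<^bsub>D\<^esub> v) = Scale D (of_nat (Suc (Suc n)) * a) (u \<star>\<^bsub>D\<^esub> v)"
      using eigenvalue_add[OF X Y u v(1) fu v(3)] by (simp add: algebra_simps)
    ultimately show ?case using XY by blast
  qed
  then have "of_nat (Suc n) * a \<in> set ls" for n
    using eigenvalue_in_annihilator ann by metis
  then have "range (\<lambda>n. of_nat (Suc n) * a) \<subseteq> set ls" by blast
  moreover have "inj (\<lambda>n. of_nat (Suc n) * a)"
  proof (rule injI)
    fix x y :: nat assume "of_nat (Suc x) * a = of_nat (Suc y) * a"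
    then have "(of_nat x :: 'k) = of_nat y" using a by simp
    then have "of_nat (x - y) = (0 :: 'k) \<and> of_nat (y - x) = (0 :: 'k)"
      by (metis cancel_comm_monoid_add_class.diff_cancel diff_is_0_eq' nat_le_linear of_nat_0 of_nat_diff)
    then show "x = y" using char by (simp add: of_nat_eq_0_iff_char_dvd)
  qed
  ultimately show False
    using finite_subset[OF _ finite_set] finite_imageD infinite_UNIV_nat by metis
qed

definition f_pow :: "'c \<Rightarrow> nat \<Rightarrow> 'g" where
  "f_pow X n = ((f_act X) ^^ n) (Id D (FO X))"

lemma f_pow_0 [simp]: "f_pow X 0 = Id D (FO X)"
  and f_pow_Suc [simp]: "f_pow X (Suc n) = f X \<cdot>\<^bsub>D\<^esub> f_pow X n"
  by (simp_all add: f_pow_def)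

lemma f_pow_Hom: "X \<in> Obj C \<Longrightarrow> f_pow X n \<in> Hom D (FO X) (FO X)"
  by (induction n) (auto intro: D.Id_Hom OMap_Obj D.Comp_Hom f_Hom)

lemma f_pow_Zero_mono:
  assumes X: "X \<in> Obj C" and z: "f_pow X m = Zero D (FO X) (FO X)"
  shows "f_pow X (m + n) = Zero D (FO X) (FO X)"
  by (induction n) (simp_all add: z D.Comp_Zero[OF f_Hom[OF X] OMap_Obj[OF X]])

text \<open>Write \<open>f\<^bsub>X \<otimes> X\<^esub> = a + b\<close> with the commuting morphisms \<open>a = f\<^bsub>X\<^esub> \<otimes> 1\<close> and \<open>b = 1 \<otimes> f\<^bsub>X\<^esub>\<close>. As \<open>a\<^bsup>m+2\<^esup> = 0\<close>,
  only two terms of the binomial expansion of \<open>(a + b)\<^bsup>n+1\<^esup> a\<^bsup>m\<^esup>\<close> survive.\<close>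

lemma f_pow_square:
  assumes X: "X \<in> Obj C" and z: "f_pow X (Suc (Suc m)) = Zero D (FO X) (FO X)"
  shows "f_pow (X \<boxtimes>\<^bsub>C\<^esub> X) (Suc n) \<cdot>\<^bsub>D\<^esub> (f_pow X m \<star>\<^bsub>D\<^esub> Id D (FO X))
    = Add D (f_pow X m \<star>\<^bsub>D\<^esub> f_pow X (Suc n))
        (Scale D (of_nat (Suc n)) (f_pow X (Suc m) \<star>\<^bsub>D\<^esub> f_pow X n))"
proof (induction n)
  note P = f_pow_Hom[OF X]
  note XX = C.TObj_Obj[OF X X]
  have F: "FO (X \<boxtimes>\<^bsub>C\<^esub> X) = FO X \<boxtimes>\<^bsub>D\<^esub> FO X" by (rule F_TObj[OF X X])
  have IX: "Id D (FO X) \<in> Hom D (FO X) (FO X)" using P[of 0] by simp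
  have fXX: "f (X \<boxtimes>\<^bsub>C\<^esub> X) \<in> Hom D (FO X \<boxtimes>\<^bsub>D\<^esub> FO X) (FO X \<boxtimes>\<^bsub>D\<^esub> FO X)"
    using f_Hom[OF XX] F by simp
  have PP: "f_pow (X \<boxtimes>\<^bsub>C\<^esub> X) n \<in> Hom D (FO X \<boxtimes>\<^bsub>D\<^esub> FO X) (FO X \<boxtimes>\<^bsub>D\<^esub> FO X)" for n
    using f_pow_Hom[OF XX] F by simp
  {
    case 0
    have "f_pow (X \<boxtimes>\<^bsub>C\<^esub> X) (Suc 0) \<cdot>\<^bsub>D\<^esub> (f_pow X m \<star>\<^bsub>D\<^esub> Id D (FO X))
        = f (X \<boxtimes>\<^bsub>C\<^esub> X) \<cdot>\<^bsub>D\<^esub> (f_pow X m \<star>\<^bsub>D\<^esub> Id D (FO X))"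
      using D.Comp_Id[OF fXX] F by simp
    also have "\<dots> = Add D (f_pow X m \<star>\<^bsub>D\<^esub> f_pow X (Suc 0)) (f_pow X (Suc m) \<star>\<^bsub>D\<^esub> f_pow X 0)"
      using Leibniz[OF X X P[of m] IX] by simp
    finally show ?case
      using D.Scale_one[OF D.TMor_Hom[OF P[of "Suc m"] IX]] by simp
  next
    case (Suc n)
    let ?e = "\<lambda>i. f_pow X m \<star>\<^bsub>D\<^esub> f_pow X i" and ?d = "\<lambda>i. f_pow X (Suc m) \<star>\<^bsub>D\<^esub> f_pow X i"
    let ?c = "of_nat (Suc n) :: 'k"
    have e: "?e i \<in> Hom D (FO X \<boxtimes>\<^bsub>D\<^esub> FO X) (FO X \<boxtimes>\<^bsub>D\<^esub> FO X)"
      and d: "?d i \<in> Hom D (FO X \<boxtimes>\<^bsub>D\<^esub> FO X) (FO X \<boxtimes>\<^bsub>D\<^esub> FO X)" for i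
      by (rule D.TMor_Hom[OF P P])+
    have fd: "f (X \<boxtimes>\<^bsub>C\<^esub> X) \<cdot>\<^bsub>D\<^esub> ?d n = ?d (Suc n)"
      using Leibniz[OF X X P[of "Suc m"] P[of n]] z D.Add_Zero[OF d[of "Suc n"]]
        D.Zero_TMor[OF P[of n] OMap_Obj[OF X] OMap_Obj[OF X]] by simp
    have fe: "f (X \<boxtimes>\<^bsub>C\<^esub> X) \<cdot>\<^bsub>D\<^esub> ?e (Suc n) = Add D (?e (Suc (Suc n))) (?d (Suc n))"
      using Leibniz[OF X X P[of m] P[of "Suc n"]] by simp
    have "f_pow (X \<boxtimes>\<^bsub>C\<^esub> X) (Suc (Suc n)) \<cdot>\<^bsub>D\<^esub> (f_pow X m \<star>\<^bsub>D\<^esub> Id D (FO X))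
        = f (X \<boxtimes>\<^bsub>C\<^esub> X) \<cdot>\<^bsub>D\<^esub> (f_pow (X \<boxtimes>\<^bsub>C\<^esub> X) (Suc n) \<cdot>\<^bsub>D\<^esub> (f_pow X m \<star>\<^bsub>D\<^esub> Id D (FO X)))"
      using D.Comp_assoc[OF D.TMor_Hom[OF P[of m] IX] PP[of "Suc n"] fXX] by simp
    also have "\<dots> = Add D (f (X \<boxtimes>\<^bsub>C\<^esub> X) \<cdot>\<^bsub>D\<^esub> ?e (Suc n)) (Scale D ?c (f (X \<boxtimes>\<^bsub>C\<^esub> X) \<cdot>\<^bsub>D\<^esub> ?d n))"
      unfolding Suc.IH
      using D.Comp_Add_right[OF e[of "Suc n"] D.Scale_Hom[OF d[of n]] fXX]
        D.Comp_Scale_right[OF d[of n] fXX] by simp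
    also have "\<dots> = Add D (?e (Suc (Suc n))) (Add D (?d (Suc n)) (Scale D ?c (?d (Suc n))))"
      unfolding fd fe by (rule D.Add_assoc[OF e d D.Scale_Hom[OF d]])
    also have "Add D (?d (Suc n)) (Scale D ?c (?d (Suc n))) = Scale D (1 + ?c) (?d (Suc n))"
      using D.Add_Scale[OF d[of "Suc n"], of 1 ?c] D.Scale_one[OF d[of "Suc n"]] by simp
    finally show ?case by simp
  }
qed

text \<open>All \<open>f\<^bsub>X\<^esub>\<close> are nilpotent, with a common bound on the order. The least common order cannot exceed \<open>1\<close>:
  otherwise \<open>f_pow_square\<close> shows that a nonzero multiple of \<open>f\<^bsub>X\<^esub>\<^bsup>k+1\<^esup> \<otimes> f\<^bsub>X\<^esub>\<^bsup>k+1\<^esup>\<close> vanishes, and the order drops.\<close>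

lemma zero_if_annihilated:
  assumes ann: "\<And>X. X \<in> Obj C \<Longrightarrow> annihilates ls X" and char: "CHAR('k) = 0"
    and X: "X \<in> Obj C"
  shows "f X = Zero D (FO X) (FO X)"
proof -
  define nil where "nil m \<longleftrightarrow> (\<forall>X \<in> Obj C. f_pow X m = Zero D (FO X) (FO X))" for m
  have "nil (length ls)"
    unfolding nil_def f_pow_def
  proof
    fix X assume X: "X \<in> Obj C"
    interpret k_endo "End_F X" "f_act X" by (rule f_endo[OF X])
    show "(f_act X ^^ length ls) (Id D (FO X)) = Zero D (FO X) (FO X)"
      using nilpotent_if_no_nonzero_eigenvalue[of "Id D (FO X)" ls]
        eigenvalue_eq_0[OF ann char X] ann[OF X] D.Id_Hom[OF OMap_Obj[OF X]]
      unfolding annihilates_def by (simp add: disj_commute) blast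
  qed
  then have least: "nil (LEAST m. nil m)" by (rule LeastI)
  have "nil 1"
  proof (cases "LEAST m. nil m")
    case 0
    then show ?thesis using least f_pow_Zero_mono[of _ 0 1] unfolding nil_def by simp
  next
    case (Suc m)
    show ?thesis
    proof (cases m)
      case 0
      then show ?thesis using least Suc by simp
    next
      case (Suc k)
      have "\<not> nil (Suc k)" using not_less_Least[of "Suc k" nil] Suc \<open>_ = Suc m\<close> by simp
      then obtain Y where Y: "Y \<in> Obj C" "f_pow Y (Suc k) \<noteq> Zero D (FO Y) (FO Y)"
        unfolding nil_def by blast
      have nilp: "nil (Suc (Suc k))" using least Suc \<open>_ = Suc m\<close> by simp
      note P = f_pow_Hom[OF Y(1)]
      note YY = C.TObj_Obj[OF Y(1) Y(1)]
      note FY = OMap_Obj[OF Y(1)]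
      have z: "f_pow Y (Suc (Suc k)) = Zero D (FO Y) (FO Y)" using nilp Y unfolding nil_def by blast
      have zz: "f_pow (Y \<boxtimes>\<^bsub>C\<^esub> Y) (Suc (Suc k)) = Zero D (FO Y \<boxtimes>\<^bsub>D\<^esub> FO Y) (FO Y \<boxtimes>\<^bsub>D\<^esub> FO Y)"
        using nilp YY F_TObj[OF Y(1) Y(1)] unfolding nil_def by simp
      let ?d = "f_pow Y (Suc k) \<star>\<^bsub>D\<^esub> f_pow Y (Suc k)"
      let ?O = "FO Y \<boxtimes>\<^bsub>D\<^esub> FO Y"
      \<comment> \<open>the surviving binomial term, with coefficient \<open>k + 2\<close>; the other one contains \<open>f\<^bsub>Y\<^esub>\<^bsup>k+2\<^esup> = 0\<close>\<close>
      have d: "?d \<in> Hom D ?O ?O" by (rule D.TMor_Hom[OF P P])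
      have i: "f_pow Y k \<star>\<^bsub>D\<^esub> Id D (FO Y) \<in> Hom D ?O ?O"
        using D.TMor_Hom[OF P[of k] P[of 0]] by simp
      have "Zero D ?O ?O
          = Add D (f_pow Y k \<star>\<^bsub>D\<^esub> f_pow Y (Suc (Suc k))) (Scale D (of_nat (Suc (Suc k))) ?d)"
        using f_pow_square[OF Y(1) z, of "Suc k"] zz D.Zero_Comp[OF i] D.TObj_Obj[OF FY FY] by metis
      also have "\<dots> = Scale D (of_nat (Suc (Suc k))) ?d"
        unfolding z D.TMor_Zero[OF P FY FY] by (rule D.Zero_Add[OF D.Scale_Hom[OF d]])
      finally have "?d = Zero D ?O ?O"
        using D.Scale_eq_Zero_iff[OF d, of "of_nat (Suc (Suc k))"] char
        by (metis Zero_neq_Suc dvd_0_left_iff of_nat_eq_0_iff_char_dvd)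
      then show ?thesis using D.TMor_eq_Zero[OF P P] Y(2) by blast
    qed
  qed
  then show ?thesis
    using X D.Comp_Id[OF f_Hom[OF X]] unfolding nil_def by simp
qed

end

section \<open>Finite-dimensional modules and finite linear categories\<close>

text \<open>The map of modules inside a morphism, which also records its source and target.\<close>

definition fd_apply :: "'p \<times> ('v \<Rightarrow> 'w) \<times> 'q \<Rightarrow> 'v \<Rightarrow> 'w" where
  "fd_apply u = fst (snd u)"

lemma fd_modules_Obj [simp]: "M \<in> Obj (fd_modules A) \<longleftrightarrow> is_fin_dim_module A M"
  by (simp add: fd_modules_def)

lemma fd_HomD:
  assumes "u \<in> Hom (fd_modules A) M N"
  shows "u = (M, fd_apply u, N)" and "fd_apply u \<in> module_maps A M N"
    and "is_fin_dim_module A M" and "is_fin_dim_module A N"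
  using assms by (auto simp: fd_modules_def fd_apply_def)

lemma fd_apply_closed:
  "u \<in> Hom (fd_modules A) M N \<Longrightarrow> m \<in> carrier M \<Longrightarrow> fd_apply u m \<in> carrier N"
  using fd_HomD(2)[of u A M N] by (auto simp: module_maps_def)

lemma fd_apply_linear:
  assumes "u \<in> Hom (fd_modules A) M N" and "m \<in> carrier M" and "n \<in> carrier M"
  shows "fd_apply u (m \<oplus>\<^bsub>M\<^esub> n) = fd_apply u m \<oplus>\<^bsub>N\<^esub> fd_apply u n"
    and "fd_apply u (c \<odot>\<^bsub>M\<^esub> m) = c \<odot>\<^bsub>N\<^esub> fd_apply u m"
  using fd_HomD(2)[OF assms(1)] assms(2,3) by (auto simp: module_maps_def)

lemma fd_Hom_eqI:
  assumes u: "u \<in> Hom (fd_modules A) M N" and v: "v \<in> Hom (fd_modules A) M N"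
    and "\<And>m. m \<in> carrier M \<Longrightarrow> fd_apply u m = fd_apply v m"
  shows "u = v"
proof -
  have "fd_apply u = fd_apply v"
    by (rule extensionalityI[where A = "carrier M"])
      (use fd_HomD(2)[OF u] fd_HomD(2)[OF v] assms(3) in \<open>auto simp: module_maps_def PiE_def\<close>)
  then show ?thesis using fd_HomD(1)[OF u] fd_HomD(1)[OF v] by simp
qed

lemma fd_apply_Comp:
  assumes "u \<in> Hom (fd_modules A) M N" and "v \<in> Hom (fd_modules A) N P" and "m \<in> carrier M"
  shows "fd_apply (v \<cdot>\<^bsub>fd_modules A\<^esub> u) m = fd_apply v (fd_apply u m)"
  using fd_HomD(1)[OF assms(1)] fd_HomD(1)[OF assms(2)] assms(3)
  by (cases u; cases v) (simp add: fd_modules_def fd_apply_def compose_def)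

lemma fd_apply_Id: "m \<in> carrier M \<Longrightarrow> fd_apply (Id (fd_modules A) M) m = m"
  by (simp add: fd_modules_def fd_apply_def)

lemma fd_apply_Add:
  assumes "u \<in> Hom (fd_modules A) M N" and "v \<in> Hom (fd_modules A) M N" and "m \<in> carrier M"
  shows "fd_apply (Add (fd_modules A) u v) m = fd_apply u m \<oplus>\<^bsub>N\<^esub> fd_apply v m"
  using fd_HomD(1)[OF assms(1)] fd_HomD(1)[OF assms(2)] assms(3)
  by (cases u; cases v) (simp add: fd_modules_def fd_apply_def)

lemma fd_apply_Scale:
  assumes "u \<in> Hom (fd_modules A) M N" and "m \<in> carrier M"
  shows "fd_apply (Scale (fd_modules A) c u) m = c \<odot>\<^bsub>N\<^esub> fd_apply u m"
  using fd_HomD(1)[OF assms(1)] assms(2)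
  by (cases u) (simp add: fd_modules_def fd_apply_def)

lemma fd_module_k_space: "is_fin_dim_module A M \<Longrightarrow> k_space M"
  by (simp add: is_fin_dim_module_def fin_dim_space_def k_space_def)

lemma fd_module_fin_dim:
  fixes M :: "('k::field, 'a, 'v) alg_module"
  shows "is_fin_dim_module A M \<Longrightarrow> vectorspace.fin_dim (class_ring :: 'k ring) M"
  by (simp add: is_fin_dim_module_def fin_dim_space_def)

lemma fd_apply_endo:
  assumes "u \<in> Hom (fd_modules A) M M"
  shows "k_endo M (fd_apply u)"
proof -
  interpret k_space M by (rule fd_module_k_space[OF fd_HomD(3)[OF assms]])
  show ?thesis
    by unfold_locales (use assms in \<open>auto simp: fd_apply_linear fd_apply_closed\<close>)
qed

lemma functor_faithful:
  assumes C: "category C" and \<eta>: "natural_isomorphism C C id_funct (comp_funct G F) \<eta>"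
    and a: "a \<in> Hom C X Y" and b: "b \<in> Hom C X Y" and eq: "MMap F a = MMap F b"
  shows "a = b"
proof -
  interpret category C by fact
  obtain r where r: "r \<in> Hom C (OMap (comp_funct G F) Y) Y" "r \<cdot>\<^bsub>C\<^esub> \<eta> Y = Id C Y"
    and \<eta>Y: "\<eta> Y \<in> Hom C Y (OMap (comp_funct G F) Y)"
    using \<eta> Hom_Obj[OF a] unfolding natural_isomorphism_def isomorphism_def id_funct_def by auto
  have *: "c = r \<cdot>\<^bsub>C\<^esub> (MMap G (MMap F c) \<cdot>\<^bsub>C\<^esub> \<eta> X)" if c: "c \<in> Hom C X Y" for c
  proof -
    have "MMap (comp_funct G F) c \<cdot>\<^bsub>C\<^esub> \<eta> X = \<eta> Y \<cdot>\<^bsub>C\<^esub> c"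
      using \<eta> c unfolding natural_isomorphism_def id_funct_def by auto
    then show ?thesis
      using Comp_assoc[OF c \<eta>Y r(1)] r(2) Id_Comp[OF c] by (simp add: comp_funct_def)
  qed
  show ?thesis using *[OF a] *[OF b] eq by simp
qed

text \<open>Every endomorphism is annihilated by a product of linear factors, because \<open>C\<close> embeds faithfully
  into finite-dimensional vector spaces.\<close>

lemma (in finite_strict_tensor_category) ex_lin_factors_End:
  assumes g: "g \<in> Hom C V V" and alg_closed: "\<And>p :: 'k poly. degree p > 0 \<Longrightarrow> \<exists>x. poly p x = 0"
  shows "\<exists>ls. lin_factors (hom_space C V V) (\<lambda>a. g \<cdot> a) ls (Id C V) = Zero C V V"
proof -
  have V: "V \<in> Obj C" using Hom_Obj[OF g] by simp
  obtain A :: "('k, nat \<Rightarrow> 'k) module"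
    and H :: "('o, 'm, ('k, nat \<Rightarrow> 'k, nat \<Rightarrow> 'k) alg_module, _) funct" and G \<eta>
    where H: "linear_functor C (fd_modules A) H"
      and \<eta>: "natural_isomorphism C C id_funct (comp_funct G H) \<eta>"
    using finite_linear unfolding finite_linear_category_def linearly_equivalent_def by blast
  interpret H: linear_functor C "fd_modules A" H by fact
  define N where "N = OMap H V"
  have HH: "MMap H a \<in> Hom (fd_modules A) N N" if "a \<in> Hom C V V" for a
    unfolding N_def by (rule H.MMap_Hom[OF that])
  have N: "is_fin_dim_module A N" by (rule fd_HomD(3)[OF HH[OF g]])
  interpret N: k_endo N "fd_apply (MMap H g)" by (rule fd_apply_endo[OF HH[OF g]])
  obtain ls where ls: "\<forall>n \<in> carrier N. lin_factors N (fd_apply (MMap H g)) ls n = \<zero>\<^bsub>N\<^esub>"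
    using N.ex_lin_factors[OF fd_module_fin_dim[OF N] alg_closed] by blast
  interpret E: k_endo "hom_space C V V" "\<lambda>a. g \<cdot> a" by (rule Comp_endo[OF g V])
  define L where "L = lin_factors (hom_space C V V) (\<lambda>a. g \<cdot> a) ls (Id C V)"
  have L: "L \<in> Hom C V V"
    unfolding L_def using E.lin_factors_closed[of "Id C V" ls] Id_Hom[OF V] by simp
  have "fd_apply (MMap H L) n = \<zero>\<^bsub>N\<^esub>" if n: "n \<in> carrier N" for n
  proof -
    have "fd_apply (MMap H L) n = lin_factors N (fd_apply (MMap H g)) ls (fd_apply (MMap H (Id C V)) n)"
      unfolding L_def
      by (rule lin_factors_intertwine[where \<phi> = "\<lambda>a. fd_apply (MMap H a) n", OF E.k_endo_axioms])
        (use n g in \<open>auto simp: Id_Hom[OF V] H.MMap_Add H.MMap_Scale H.MMap_Comp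
          fd_apply_Add[OF HH HH] fd_apply_Scale[OF HH] fd_apply_Comp[OF HH HH]\<close>)
    also have "fd_apply (MMap H (Id C V)) n = n"
      using H.MMap_Id[OF V] n by (simp add: fd_apply_Id N_def)
    finally show ?thesis using ls n by simp
  qed
  then have "MMap H L = MMap H (Scale C 0 L)"
    by (intro fd_Hom_eqI[OF HH[OF L] HH[OF Scale_Hom[OF L]]])
      (simp add: H.MMap_Scale[OF L] fd_apply_Scale[OF HH[OF L]])
  then have "L = Scale C 0 L"
    by (rule functor_faithful[OF category_axioms \<eta> L Scale_Hom[OF L]])
  then have "L = Zero C V V" by (simp add: Scale_zero[OF L])
  then show ?thesis unfolding L_def by blast
qed

definition regular_module :: "('k::field, 'a) module \<Rightarrow> ('k, 'a, 'a) alg_module" where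
  "regular_module A = \<lparr>carrier = carrier A, mult = mult A, one = one A, zero = zero A,
     add = add A, smult = module.smult A, act = mult A\<rparr>"

lemma regular_module_simps [simp]:
  "carrier (regular_module A) = carrier A" "zero (regular_module A) = zero A"
  "add (regular_module A) = add A" "module.smult (regular_module A) = module.smult A"
  "act (regular_module A) = mult A"
  by (simp_all add: regular_module_def)

lemma regular_module_fin_dim:
  fixes A :: "('k::field, 'a) module"
  assumes A: "fin_dim_algebra A"
  shows "is_fin_dim_module A (regular_module A)"
proof -
  interpret ring A using A by (simp add: fin_dim_algebra_def)
  have ag: "abelian_group (regular_module A)"
    by (rule abelian_groupI) (auto simp: a_ac intro!: bexI[of _ "\<ominus>\<^bsub>A\<^esub> x" for x] l_neg)
  interpret A: k_space A
    using A by (simp add: fin_dim_algebra_def fin_dim_space_def k_space_def)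
  have fd: "A.fin_dim" using A by (simp add: fin_dim_algebra_def fin_dim_space_def)
  have mod: "module (class_ring :: 'k ring) (regular_module A)"
  proof (rule moduleI[OF _ ag])
    show "cring (class_ring :: 'k ring)"
      by (rule Module.module.axioms(1)[OF vectorspace.axioms(1)[OF A.vectorspace_axioms]])
  qed (auto simp: A.add_scale A.scale_add A.scale_scale[symmetric])
  interpret R: vectorspace "class_ring :: 'k ring" "regular_module A"
    by (intro vectorspace.intro mod class_field)
  have lc: "R.lincomb a B = A.lincomb a B" if "finite B" "B \<subseteq> carrier A" for a B
    using that
  proof (induction B rule: finite_induct)
    case (insert x B)
    have "R.lincomb a (insert x B) = a x \<odot>\<^bsub>A\<^esub> x \<oplus>\<^bsub>A\<^esub> R.lincomb a B"
      unfolding R.lincomb_def using insert by (subst R.finsum_insert) (auto simp: Pi_def)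
    moreover have "A.lincomb a (insert x B) = a x \<odot>\<^bsub>A\<^esub> x \<oplus>\<^bsub>A\<^esub> A.lincomb a B"
      unfolding A.lincomb_def using insert by (subst finsum_insert) (auto simp: Pi_def)
    ultimately show ?case using insert by simp
  qed (simp add: R.lincomb_def A.lincomb_def)
  have "R.span B = A.span B" if "B \<subseteq> carrier A" for B
    unfolding R.span_def A.span_def using lc that by (metis (no_types, lifting) subset_trans)
  then have "R.fin_dim"
    using fd unfolding R.fin_dim_def A.fin_dim_def by auto
  then show ?thesis
    using A R.vectorspace_axioms
    unfolding is_fin_dim_module_def fin_dim_space_def fin_dim_algebra_def
    by (auto simp: l_distr r_distr m_assoc)
qed

text \<open>The object \<open>P\<close> corresponds to the regular module \<open>A\<close>. Every element \<open>m\<close> of a module is the image of \<open>1\<close>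
  under a module map from \<open>A\<close>, so that the maps for a finite spanning set are jointly epimorphic. A finite family is
  obtained, rather than a single epimorphism from a sum of copies of \<open>P\<close>, because elements are then
  enough to detect equality.\<close>

lemma (in finite_strict_tensor_category) ex_generator:
  "\<exists>P \<in> Obj C. \<forall>X \<in> Obj C. \<exists>E. finite E \<and> E \<subseteq> Hom C P X \<and>
    (\<forall>Z. \<forall>g \<in> Hom C X Z. \<forall>h \<in> Hom C X Z. (\<forall>e \<in> E. g \<cdot> e = h \<cdot> e) \<longrightarrow> g = h)"
proof -
  obtain A :: "('k, nat \<Rightarrow> 'k) module"
    and H :: "('o, 'm, ('k, nat \<Rightarrow> 'k, nat \<Rightarrow> 'k) alg_module, _) funct" and G \<eta> \<epsilon>
    where A: "fin_dim_algebra A"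
      and H: "linear_functor C (fd_modules A) H"
      and G: "linear_functor (fd_modules A) C G"
      and \<eta>: "natural_isomorphism C C id_funct (comp_funct G H) \<eta>"
      and \<epsilon>: "natural_isomorphism (fd_modules A) (fd_modules A) (comp_funct H G) id_funct \<epsilon>"
    using finite_linear unfolding finite_linear_category_def linearly_equivalent_def by blast
  interpret H: linear_functor C "fd_modules A" H by fact
  interpret G: linear_functor "fd_modules A" C G by fact
  interpret A: ring A using A by (simp add: fin_dim_algebra_def)
  let ?R = "regular_module A"
  define P where "P = OMap G ?R"
  have R: "?R \<in> Obj (fd_modules A)" using regular_module_fin_dim[OF A] by simp
  have P: "P \<in> Obj C" unfolding P_def by (rule G.OMap_Obj[OF R])
  have \<epsilon>_iso: "isomorphism (fd_modules A) (OMap H (OMap G M)) M (\<epsilon> M)" if "M \<in> Obj (fd_modules A)" for M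
    using \<epsilon> that unfolding natural_isomorphism_def comp_funct_def id_funct_def by auto
  show ?thesis
  proof (intro bexI[OF _ P] ballI)
    fix X assume X: "X \<in> Obj C"
    define M where "M = OMap H X"
    have M: "is_fin_dim_module A M" using H.OMap_Obj[OF X] by (simp add: M_def)
    interpret M: k_space M by (rule fd_module_k_space[OF M])
    obtain r where r: "r \<in> Hom C (OMap G M) X" and \<eta>X: "\<eta> X \<in> Hom C X (OMap G M)"
      and r\<eta>: "r \<cdot> \<eta> X = Id C X"
      using \<eta> X unfolding natural_isomorphism_def isomorphism_def id_funct_def comp_funct_def M_def by auto
    have hit: "\<exists>e \<in> Hom C P X. \<exists>x \<in> carrier (OMap H P). fd_apply (MMap H e) x = m"
      if m: "m \<in> carrier M" for m
    proof -
      let ?GM = "OMap H (OMap G M)"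
      have H\<eta>: "MMap H (\<eta> X) \<in> Hom (fd_modules A) M ?GM"
        and Hr: "MMap H r \<in> Hom (fd_modules A) ?GM M"
        unfolding M_def using H.MMap_Hom[OF \<eta>X] H.MMap_Hom[OF r] by (simp_all add: M_def)
      have \<epsilon>M: "\<epsilon> M \<in> Hom (fd_modules A) ?GM M"
        and \<epsilon>R: "\<epsilon> ?R \<in> Hom (fd_modules A) (OMap H P) ?R"
        using \<epsilon>_iso[of M] \<epsilon>_iso[OF R] M unfolding isomorphism_def P_def by auto
      obtain s where s: "s \<in> Hom (fd_modules A) M ?GM"
        "s \<cdot>\<^bsub>fd_modules A\<^esub> \<epsilon> M = Id (fd_modules A) ?GM"
        using \<epsilon>_iso[of M] M unfolding isomorphism_def by auto
      obtain t where t: "t \<in> Hom (fd_modules A) ?R (OMap H P)"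
        "\<epsilon> ?R \<cdot>\<^bsub>fd_modules A\<^esub> t = Id (fd_modules A) ?R"
        using \<epsilon>_iso[OF R] unfolding isomorphism_def P_def by auto
      \<comment> \<open>\<open>u\<close> must be chosen so that \<open>G u\<close>, carried back by \<open>r\<close>, hits \<open>m\<close>; without a triangle identity relating \<open>\<eta>\<close>
         and \<open>\<epsilon>\<close>, the value \<open>u 1\<close> has to be \<open>m\<close> transported along both\<close>
      define m1 where "m1 = fd_apply (MMap H (\<eta> X)) m"
      define m2 where "m2 = fd_apply (\<epsilon> M) m1"
      define x where "x = fd_apply t \<one>\<^bsub>A\<^esub>"
      have m1: "m1 \<in> carrier ?GM" unfolding m1_def by (rule fd_apply_closed[OF H\<eta> m])
      have m2: "m2 \<in> carrier M" unfolding m2_def by (rule fd_apply_closed[OF \<epsilon>M m1])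
      have x: "x \<in> carrier (OMap H P)" unfolding x_def by (rule fd_apply_closed[OF t(1)]) simp
      \<comment> \<open>the module map \<open>A \<rightarrow> M\<close> sending \<open>1\<close> to \<open>m2\<close>\<close>
      define u where "u = (?R, (\<lambda>a \<in> carrier A. act M a m2), M)"
      have u: "u \<in> Hom (fd_modules A) ?R M"
      proof -
        have act: "act M a m2 \<in> carrier M" "act M (a \<oplus>\<^bsub>A\<^esub> b) m2 = act M a m2 \<oplus>\<^bsub>M\<^esub> act M b m2"
          "act M (a \<otimes>\<^bsub>A\<^esub> b) m2 = act M a (act M b m2)"
          "act M (c \<odot>\<^bsub>A\<^esub> a) m2 = c \<odot>\<^bsub>M\<^esub> act M a m2"
          if "a \<in> carrier A" "b \<in> carrier A" for a b c
          using M m2 that unfolding is_fin_dim_module_def by blast+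
        have "c \<odot>\<^bsub>A\<^esub> a \<in> carrier A" if "a \<in> carrier A" for a c
        proof -
          have "k_space A" using A by (simp add: fin_dim_algebra_def fin_dim_space_def k_space_def)
          then show ?thesis using that by (rule k_space.scale_closed)
        qed
        then show ?thesis
          using regular_module_fin_dim[OF A] M act
          unfolding u_def fd_modules_def module_maps_def by simp
      qed
      have HGu: "MMap H (MMap G u) \<in> Hom (fd_modules A) (OMap H P) ?GM"
        using H.MMap_Hom[OF G.MMap_Hom[OF u]] by (simp add: P_def)
      have nat: "u \<cdot>\<^bsub>fd_modules A\<^esub> \<epsilon> ?R = \<epsilon> M \<cdot>\<^bsub>fd_modules A\<^esub> MMap H (MMap G u)"
        using \<epsilon> u unfolding natural_isomorphism_def comp_funct_def id_funct_def by auto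
      have x1: "fd_apply (\<epsilon> ?R) x = \<one>\<^bsub>A\<^esub>"
        using fd_apply_Comp[OF t(1) \<epsilon>R, of "\<one>\<^bsub>A\<^esub>"] t(2) by (simp add: x_def fd_apply_Id)
      have "fd_apply (\<epsilon> M) (fd_apply (MMap H (MMap G u)) x) = fd_apply u (fd_apply (\<epsilon> ?R) x)"
        using fd_apply_Comp[OF HGu \<epsilon>M x] fd_apply_Comp[OF \<epsilon>R u x] nat by simp
      also have "\<dots> = m2"
        using M m2 unfolding x1 by (simp add: u_def fd_apply_def is_fin_dim_module_def)
      finally have eq: "fd_apply (\<epsilon> M) (fd_apply (MMap H (MMap G u)) x) = fd_apply (\<epsilon> M) m1"
        by (simp add: m2_def)
      have s_cancel: "fd_apply s (fd_apply (\<epsilon> M) y) = y" if "y \<in> carrier ?GM" for y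
        using fd_apply_Comp[OF \<epsilon>M s(1) that] s(2) that by (simp add: fd_apply_Id)
      have HGux: "fd_apply (MMap H (MMap G u)) x = m1"
        using s_cancel[OF fd_apply_closed[OF HGu x]] s_cancel[OF m1] unfolding eq by metis
      have Gu: "MMap G u \<in> Hom C P (OMap G M)" using G.MMap_Hom[OF u] by (simp add: P_def)
      have "fd_apply (MMap H (r \<cdot> MMap G u)) x = fd_apply (MMap H r) m1"
        using fd_apply_Comp[OF HGu Hr x] HGux by (simp add: H.MMap_Comp[OF Gu r])
      also have "\<dots> = fd_apply (MMap H (r \<cdot> \<eta> X)) m"
        using fd_apply_Comp[OF H\<eta> Hr m] by (simp add: m1_def H.MMap_Comp[OF \<eta>X r])
      also have "\<dots> = m" using H.MMap_Id[OF X] m by (simp add: r\<eta> fd_apply_Id M_def)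
      finally show ?thesis using Comp_Hom[OF Gu r] x by blast
    qed
    obtain B where B: "finite B" "B \<subseteq> carrier M" "M.span B = carrier M"
      using fd_module_fin_dim[OF M] unfolding M.fin_dim_def by auto
    then have "\<forall>m \<in> B. \<exists>e \<in> Hom C P X. \<exists>x \<in> carrier (OMap H P). fd_apply (MMap H e) x = m"
      using hit by blast
    then obtain e x where e: "\<And>m. m \<in> B \<Longrightarrow> e m \<in> Hom C P X"
      and x: "\<And>m. m \<in> B \<Longrightarrow> x m \<in> carrier (OMap H P)"
      and ex: "\<And>m. m \<in> B \<Longrightarrow> fd_apply (MMap H (e m)) (x m) = m"
      by metis
    have "g = h" if g: "g \<in> Hom C X Z" and h: "h \<in> Hom C X Z" and eq: "\<forall>a \<in> e ` B. g \<cdot> a = h \<cdot> a" for Z g h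
    proof -
      have Hg: "MMap H g \<in> Hom (fd_modules A) M (OMap H Z)"
        and Hh: "MMap H h \<in> Hom (fd_modules A) M (OMap H Z)"
        unfolding M_def by (rule H.MMap_Hom[OF g] H.MMap_Hom[OF h])+
      let ?S = "{m \<in> carrier M. fd_apply (MMap H g) m = fd_apply (MMap H h) m}"
      have "B \<subseteq> ?S"
      proof
        fix m assume m: "m \<in> B"
        have He: "MMap H (e m) \<in> Hom (fd_modules A) (OMap H P) M"
          unfolding M_def by (rule H.MMap_Hom[OF e[OF m]])
        have "fd_apply (MMap H g) m = fd_apply (MMap H (g \<cdot> e m)) (x m)"
          using fd_apply_Comp[OF He Hg x[OF m]] ex[OF m] by (simp add: H.MMap_Comp[OF e[OF m] g])
        also have "\<dots> = fd_apply (MMap H (h \<cdot> e m)) (x m)" using eq m by simp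
        also have "\<dots> = fd_apply (MMap H h) m"
          using fd_apply_Comp[OF He Hh x[OF m]] ex[OF m] by (simp add: H.MMap_Comp[OF e[OF m] h])
        finally show "m \<in> ?S" using m B by auto
      qed
      moreover have "\<zero>\<^bsub>M\<^esub> \<in> ?S"
        using fd_apply_linear(2)[OF Hg, of "\<zero>\<^bsub>M\<^esub>" "\<zero>\<^bsub>M\<^esub>" 0] fd_apply_linear(2)[OF Hh, of "\<zero>\<^bsub>M\<^esub>" "\<zero>\<^bsub>M\<^esub>" 0]
          k_space.zero_scale[OF fd_module_k_space[OF fd_HomD(4)[OF Hg]]]
          fd_apply_closed[OF Hg] fd_apply_closed[OF Hh] by simp
      ultimately have "M.span B \<subseteq> ?S"
        by (intro M.span_subset_closed B(2))
          (auto simp: fd_apply_linear[OF Hg] fd_apply_linear[OF Hh])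
      then have "carrier M \<subseteq> ?S" by (simp only: B(3))
      then have "MMap H g = MMap H h" by (intro fd_Hom_eqI[OF Hg Hh]) auto
      then show ?thesis by (rule functor_faithful[OF category_axioms \<eta> g h])
    qed
    then show "\<exists>E. finite E \<and> E \<subseteq> Hom C P X \<and>
        (\<forall>Z. \<forall>g \<in> Hom C X Z. \<forall>h \<in> Hom C X Z. (\<forall>e \<in> E. g \<cdot> e = h \<cdot> e) \<longrightarrow> g = h)"
      using B(1) e by (intro exI[of _ "e ` B"]) blast
  qed
qed

section \<open>A common annihilator for all components of a derivation\<close>

text \<open>Exact functors are defined by short exact sequences; this makes them applicable to a bare epimorphism. An
  epimorphism is a cokernel of some morphism, hence also of its own kernel.\<close>

lemma (in abelian_linear_category) epimorphism_short_exact: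
  assumes p: "epimorphism C Q X p"
  shows "\<exists>K i. short_exact C K i Q p X"
proof -
  have p_Hom: "p \<in> Hom C Q X" using p by (simp add: epimorphism_def)
  obtain W g where g: "is_cokernel C W Q g X p" using epi_normal[OF p] by blast
  then have g_Hom: "g \<in> Hom C W Q" and pg: "p \<cdot> g = Zero C W X" by (auto simp: is_cokernel_def)
  obtain K i where K: "is_kernel C Q X p K i" using ex_kernel[OF p_Hom] by blast
  then have i: "i \<in> Hom C K Q" and pi: "p \<cdot> i = Zero C K X" by (auto simp: is_kernel_def)
  obtain t where t: "t \<in> Hom C W K" "i \<cdot> t = g"
    using K g_Hom pg unfolding is_kernel_def by blast
  have "is_cokernel C K Q i X p"
    unfolding is_cokernel_def
  proof (intro conjI allI ballI impI i p_Hom pi)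
    fix Z h assume h: "h \<in> Hom C Q Z" and hi: "h \<cdot> i = Zero C K Z"
    have "h \<cdot> g = (h \<cdot> i) \<cdot> t" using Comp_assoc[OF t(1) i h] t(2) by simp
    also have "\<dots> = Zero C W Z" unfolding hi using Zero_Comp[OF t(1)] Hom_Obj[OF h] by simp
    finally show "\<exists>!k. k \<in> Hom C X Z \<and> k \<cdot> p = h" using g h unfolding is_cokernel_def by blast
  qed
  then show ?thesis using K unfolding short_exact_def by blast
qed

lemma (in linear_category) cokernel_epimorphism:
  assumes "is_cokernel C X Y f Q p" shows "epimorphism C Y Q p"
  unfolding epimorphism_def
proof (intro conjI allI ballI impI)
  show p: "p \<in> Hom C Y Q" using assms by (simp add: is_cokernel_def)
  fix Z g h assume g: "g \<in> Hom C Q Z" and h: "h \<in> Hom C Q Z" and eq: "g \<cdot> p = h \<cdot> p"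
  have f: "f \<in> Hom C X Y" and pf: "p \<cdot> f = Zero C X Q" using assms by (auto simp: is_cokernel_def)
  have "(g \<cdot> p) \<cdot> f = Zero C X Z"
    using Comp_assoc[OF f p g] pf Comp_Zero[OF g] Hom_Obj[OF f] by simp
  then have "\<exists>!t. t \<in> Hom C Q Z \<and> t \<cdot> p = g \<cdot> p"
    using assms Comp_Hom[OF p g] unfolding is_cokernel_def by blast
  then show "g = h" using g h eq by metis
qed

context tensor_functor
begin

lemma F_Zero:
  assumes "X \<in> Obj C" and "Y \<in> Obj C"
  shows "FM (Zero C X Y) = Zero D (FO X) (FO Y)"
proof -
  have z: "Zero C X Y \<in> Hom C X Y" using assms by auto
  have "FM (Zero C X Y) = FM (Scale C 0 (Zero C X Y))" by (simp only: C.Scale_zero[OF z])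
  also have "\<dots> = Zero D (FO X) (FO Y)"
    by (simp only: MMap_Scale[OF z] D.Scale_zero[OF MMap_Hom[OF z]])
  finally show ?thesis .
qed

lemma F_epimorphism:
  assumes "exact_functor C D F" and "epimorphism C Q X p"
  shows "epimorphism D (FO Q) (FO X) (FM p)"
proof -
  obtain K i where "short_exact C K i Q p X" using C.epimorphism_short_exact[OF assms(2)] by blast
  then have "is_cokernel D (FO K) (FO Q) (FM i) (FO X) (FM p)"
    using assms(1) unfolding exact_functor_def short_exact_def by blast
  then show ?thesis by (rule D.cokernel_epimorphism)
qed

lemma F_biproduct:
  assumes "is_biproduct C X Y S j1 j2 q1 q2"
  shows "is_biproduct D (FO X) (FO Y) (FO S) (FM j1) (FM j2) (FM q1) (FM q2)"
proof -
  have j: "j1 \<in> Hom C X S" "j2 \<in> Hom C Y S" "q1 \<in> Hom C S X" "q2 \<in> Hom C S Y"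
    and eqs: "q1 \<cdot>\<^bsub>C\<^esub> j1 = Id C X" "q2 \<cdot>\<^bsub>C\<^esub> j2 = Id C Y"
      "q1 \<cdot>\<^bsub>C\<^esub> j2 = Zero C Y X" "q2 \<cdot>\<^bsub>C\<^esub> j1 = Zero C X Y"
      "Add C (j1 \<cdot>\<^bsub>C\<^esub> q1) (j2 \<cdot>\<^bsub>C\<^esub> q2) = Id C S"
    using assms by (auto simp: is_biproduct_def)
  note O = C.Hom_Obj[OF j(1)] C.Hom_Obj[OF j(2)]
  have "FM q1 \<cdot>\<^bsub>D\<^esub> FM j1 = Id D (FO X)" "FM q2 \<cdot>\<^bsub>D\<^esub> FM j2 = Id D (FO Y)"
    "FM q1 \<cdot>\<^bsub>D\<^esub> FM j2 = Zero D (FO Y) (FO X)" "FM q2 \<cdot>\<^bsub>D\<^esub> FM j1 = Zero D (FO X) (FO Y)"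
    "Add D (FM j1 \<cdot>\<^bsub>D\<^esub> FM q1) (FM j2 \<cdot>\<^bsub>D\<^esub> FM q2) = Id D (FO S)"
    using MMap_Comp[OF j(1) j(3)] MMap_Comp[OF j(2) j(4)] MMap_Comp[OF j(2) j(3)]
      MMap_Comp[OF j(1) j(4)] MMap_Comp[OF j(3) j(1)] MMap_Comp[OF j(4) j(2)]
      MMap_Add[OF C.Comp_Hom[OF j(3) j(1)] C.Comp_Hom[OF j(4) j(2)]] O
    by (simp_all add: eqs MMap_Id F_Zero)
  then show ?thesis unfolding is_biproduct_def using j by (auto intro: MMap_Hom)
qed

end

context tensor_derivation
begin

text \<open>By naturality \<open>q(f\<^bsub>X\<^esub>) F(e) = F(e) q(f\<^bsub>Q\<^esub>)\<close> for every polynomial \<open>q\<close>.\<close>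

lemma annihilator_Comp:
  assumes e: "e \<in> Hom C Q X" and ann: "annihilates ls Q"
  shows "lin_factors (End_F X) (f_act X) ls (Id D (FO X)) \<cdot>\<^bsub>D\<^esub> FM e = Zero D (FO Q) (FO X)"
proof -
  have O: "Q \<in> Obj C" "X \<in> Obj C" using C.Hom_Obj[OF e] by auto
  note Fe = MMap_Hom[OF e] and fX = f_Hom[OF O(2)] and fQ = f_Hom[OF O(1)]
  have IQ: "Id D (FO Q) \<in> Hom D (FO Q) (FO Q)" by (rule D.Id_Hom[OF OMap_Obj[OF O(1)]])
  have "FM e \<cdot>\<^bsub>D\<^esub> lin_factors (End_F Q) (f_act Q) ls (Id D (FO Q))
      = lin_factors (hom_space D (FO Q) (FO X)) (f_act X) ls (FM e \<cdot>\<^bsub>D\<^esub> Id D (FO Q))"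
  proof (rule lin_factors_intertwine[where \<phi> = "\<lambda>g. FM e \<cdot>\<^bsub>D\<^esub> g", OF f_endo[OF O(1)]])
    fix v assume "v \<in> carrier (End_F Q)"
    then have v: "v \<in> Hom D (FO Q) (FO Q)" by simp
    show "FM e \<cdot>\<^bsub>D\<^esub> (f Q \<cdot>\<^bsub>D\<^esub> v) = f X \<cdot>\<^bsub>D\<^esub> (FM e \<cdot>\<^bsub>D\<^esub> v)"
      using D.Comp_assoc[OF v fQ Fe] D.Comp_assoc[OF v Fe fX] f_natural[OF e] by simp
  qed (use IQ Fe in \<open>auto simp: D.Comp_Add_right D.Comp_Scale_right\<close>)
  then show ?thesis
    using ann D.lin_factors_Comp[OF fX Fe, of ls] D.Comp_Id[OF Fe] D.Comp_Zero[OF Fe OMap_Obj[OF O(1)]]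
    unfolding annihilates_def by simp
qed

lemma annihilator_Hom: "X \<in> Obj C \<Longrightarrow>
    lin_factors (End_F X) (f_act X) ls (Id D (FO X)) \<in> Hom D (FO X) (FO X)"
  using k_endo.lin_factors_closed[OF f_endo, of X "Id D (FO X)" ls] D.Id_Hom[OF OMap_Obj] by simp

lemma annihilates_biproduct:
  assumes S: "is_biproduct C X Y S j1 j2 q1 q2" and X: "annihilates ls X" and Y: "annihilates ls Y"
  shows "annihilates ls S"
proof -
  have j: "j1 \<in> Hom C X S" "j2 \<in> Hom C Y S" using S by (auto simp: is_biproduct_def)
  have SO: "S \<in> Obj C" using C.Hom_Obj[OF j(1)] by simp
  note z = D.Zero_Comp[OF MMap_Hom[OF j(1)] OMap_Obj[OF SO]] D.Zero_Comp[OF MMap_Hom[OF j(2)] OMap_Obj[OF SO]]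
  show ?thesis
    unfolding annihilates_def
    by (rule D.biproduct_ext_from[OF F_biproduct[OF S] annihilator_Hom[OF SO]])
      (use OMap_Obj[OF SO] in \<open>auto simp: annihilator_Comp[OF j(1) X] annihilator_Comp[OF j(2) Y] z\<close>)
qed

lemma annihilates_quotient:
  assumes "exact_functor C D F" and p: "epimorphism C Q X p" and Q: "annihilates ls Q"
  shows "annihilates ls X"
proof -
  have p_Hom: "p \<in> Hom C Q X" using p by (simp add: epimorphism_def)
  then have X: "X \<in> Obj C" using C.Hom_Obj by blast
  show ?thesis
    unfolding annihilates_def
    using F_epimorphism[OF assms(1) p] annihilator_Comp[OF p_Hom Q] annihilator_Hom[OF X, of ls]
      D.Zero_Comp[OF MMap_Hom[OF p_Hom] OMap_Obj[OF X]] D.Zero_Hom[OF OMap_Obj[OF X] OMap_Obj[OF X]]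
    unfolding epimorphism_def by metis
qed

text \<open>Finitely many maps out of \<open>P\<close> factor through a single map out of a sum of copies of \<open>P\<close>.\<close>

lemma collect_maps:
  assumes P: "annihilates ls P" "P \<in> Obj C" and X: "X \<in> Obj C"
    and E: "finite E" "E \<subseteq> Hom C P X"
  shows "\<exists>Q. \<exists>e \<in> Hom C Q X. annihilates ls Q \<and> (\<forall>u \<in> E. \<exists>j \<in> Hom C P Q. e \<cdot>\<^bsub>C\<^esub> j = u)"
  using E
proof (induction E rule: finite_induct)
  case empty
  then show ?case using P C.Zero_Hom[OF P(2) X] by blast
next
  case (insert u E)
  then obtain Q e where Q: "e \<in> Hom C Q X" "annihilates ls Q" "\<forall>v \<in> E. \<exists>j \<in> Hom C P Q. e \<cdot>\<^bsub>C\<^esub> j = v"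
    by auto
  have u: "u \<in> Hom C P X" using insert.prems by simp
  obtain S j1 j2 q1 q2 where S: "is_biproduct C Q P S j1 j2 q1 q2"
    using C.ex_biproduct C.Hom_Obj[OF Q(1)] P by blast
  then have j: "j1 \<in> Hom C Q S" "j2 \<in> Hom C P S" "q1 \<in> Hom C S Q" "q2 \<in> Hom C S P"
    and eqs: "q1 \<cdot>\<^bsub>C\<^esub> j1 = Id C Q" "q2 \<cdot>\<^bsub>C\<^esub> j2 = Id C P"
      "q1 \<cdot>\<^bsub>C\<^esub> j2 = Zero C P Q" "q2 \<cdot>\<^bsub>C\<^esub> j1 = Zero C Q P"
    by (auto simp: is_biproduct_def)
  let ?e = "Add C (e \<cdot>\<^bsub>C\<^esub> q1) (u \<cdot>\<^bsub>C\<^esub> q2)"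
  note eq1 = C.Comp_Hom[OF j(3) Q(1)] and uq2 = C.Comp_Hom[OF j(4) u]
  have e: "?e \<in> Hom C S X" by (rule C.Add_Hom[OF eq1 uq2])
  have ej1: "?e \<cdot>\<^bsub>C\<^esub> j1 = e"
    using C.Comp_Add_left[OF j(1) eq1 uq2] C.Comp_assoc[OF j(1) j(3) Q(1)] C.Comp_assoc[OF j(1) j(4) u]
      C.Comp_Zero[OF u] C.Hom_Obj[OF Q(1)] C.Comp_Id[OF Q(1)] C.Add_Zero[OF Q(1)] by (simp add: eqs)
  have ej2: "?e \<cdot>\<^bsub>C\<^esub> j2 = u"
    using C.Comp_Add_left[OF j(2) eq1 uq2] C.Comp_assoc[OF j(2) j(3) Q(1)] C.Comp_assoc[OF j(2) j(4) u]
      C.Comp_Zero[OF Q(1) P(2)] C.Comp_Id[OF u] C.Zero_Add[OF u] by (simp add: eqs)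
  have "\<exists>j \<in> Hom C P S. ?e \<cdot>\<^bsub>C\<^esub> j = v" if v: "v \<in> insert u E" for v
  proof (cases "v = u")
    case True
    then show ?thesis using ej2 j by blast
  next
    case False
    then obtain j' where j': "j' \<in> Hom C P Q" "e \<cdot>\<^bsub>C\<^esub> j' = v" using v Q by blast
    then have "?e \<cdot>\<^bsub>C\<^esub> (j1 \<cdot>\<^bsub>C\<^esub> j') = v" using C.Comp_assoc[OF j'(1) j(1) e] ej1 by simp
    then show ?thesis using C.Comp_Hom[OF j'(1) j(1)] by blast
  qed
  then show ?case using annihilates_biproduct[OF S Q(2) P(1)] e by blast
qed

lemma ex_uniform_annihilator:
  assumes ex: "exact_functor C D F"
    and alg_closed: "\<And>p :: 'k poly. degree p > 0 \<Longrightarrow> \<exists>x. poly p x = 0"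
  shows "\<exists>ls. \<forall>X \<in> Obj C. annihilates ls X"
proof -
  obtain P where P: "P \<in> Obj C" and gen: "\<forall>X \<in> Obj C. \<exists>E. finite E \<and> E \<subseteq> Hom C P X \<and>
    (\<forall>Z. \<forall>g \<in> Hom C X Z. \<forall>h \<in> Hom C X Z. (\<forall>e \<in> E. g \<cdot>\<^bsub>C\<^esub> e = h \<cdot>\<^bsub>C\<^esub> e) \<longrightarrow> g = h)"
    using C.ex_generator by (elim bexE)
  obtain ls where ls: "annihilates ls P"
  proof -
    have "\<exists>ls. annihilates ls P"
      unfolding annihilates_def by (rule D.ex_lin_factors_End[OF f_Hom[OF P]]) (erule alg_closed)
    then show ?thesis using that by blast
  qed
  have "annihilates ls X" if X: "X \<in> Obj C" for X
  proof -
    obtain E where E: "finite E" "E \<subseteq> Hom C P X"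
      and joint: "\<forall>Z. \<forall>g \<in> Hom C X Z. \<forall>h \<in> Hom C X Z.
        (\<forall>e \<in> E. g \<cdot>\<^bsub>C\<^esub> e = h \<cdot>\<^bsub>C\<^esub> e) \<longrightarrow> g = h"
      using gen[rule_format, OF X] by (elim exE conjE)
    obtain Q e where e: "e \<in> Hom C Q X" and Q: "annihilates ls Q"
      and fac: "\<forall>u \<in> E. \<exists>j \<in> Hom C P Q. e \<cdot>\<^bsub>C\<^esub> j = u"
      using collect_maps[OF ls P X E] by blast
    have "epimorphism C Q X e"
      unfolding epimorphism_def
    proof (intro conjI e allI ballI impI)
      fix Z g h assume g: "g \<in> Hom C X Z" and h: "h \<in> Hom C X Z" and eq: "g \<cdot>\<^bsub>C\<^esub> e = h \<cdot>\<^bsub>C\<^esub> e"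
      show "g = h"
      proof (rule joint[rule_format, OF g h])
        fix u assume "u \<in> E"
        then obtain j where j: "j \<in> Hom C P Q" "e \<cdot>\<^bsub>C\<^esub> j = u" using fac by blast
        show "g \<cdot>\<^bsub>C\<^esub> u = h \<cdot>\<^bsub>C\<^esub> u"
          using C.Comp_assoc[OF j(1) e g] C.Comp_assoc[OF j(1) e h] eq j(2) by simp
      qed
    qed
    then show ?thesis by (rule annihilates_quotient[OF ex _ Q])
  qed
  then show ?thesis by blast
qed

theorem tensor_derivation_zero:
  assumes "exact_functor C D F" and "CHAR('k) = 0"
    and "\<And>p :: 'k poly. degree p > 0 \<Longrightarrow> \<exists>x. poly p x = 0" and "X \<in> Obj C"
  shows "f X = Zero D (FO X) (FO X)"
proof -
  obtain ls where ls: "\<forall>X \<in> Obj C. annihilates ls X"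
    using ex_uniform_annihilator[OF assms(1,3)] by metis
  show ?thesis
  proof (rule zero_if_annihilated[OF _ assms(2,4)])
    show "annihilates ls X" if "X \<in> Obj C" for X using ls that by simp
  qed
qed

end

section \<open>Unipotent isomorphisms between biproducts\<close>

context linear_category
begin

text \<open>The matrix with rows \<open>(id, f)\<close> and \<open>(0, id)\<close>, from a biproduct \<open>V \<oplus> V\<close> with projections \<open>m\<^sub>1, m\<^sub>2\<close> to one with
  injections \<open>r\<^sub>1, r\<^sub>2\<close>. The two biproducts may be different objects, here \<open>S \<otimes> F(X)\<close> and \<open>F(X) \<otimes> S\<close>.\<close>

definition unipotent :: "'m \<Rightarrow> 'm \<Rightarrow> 'm \<Rightarrow> 'm \<Rightarrow> 'm \<Rightarrow> 'm" where
  "unipotent r1 r2 m1 m2 f = Add C (r1 \<cdot> Add C m1 (f \<cdot> m2)) (r2 \<cdot> m2)"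

context
  fixes V S S' l1 l2 m1 m2 r1 r2 t1 t2
  assumes L: "is_biproduct C V V S l1 l2 m1 m2" and R: "is_biproduct C V V S' r1 r2 t1 t2"
begin

lemma biproduct_Homs:
  "l1 \<in> Hom C V S" "l2 \<in> Hom C V S" "m1 \<in> Hom C S V" "m2 \<in> Hom C S V"
  "r1 \<in> Hom C V S'" "r2 \<in> Hom C V S'" "t1 \<in> Hom C S' V" "t2 \<in> Hom C S' V"
  using L R by (auto simp: is_biproduct_def)

lemma unipotent_Hom: "f \<in> Hom C V V \<Longrightarrow> unipotent r1 r2 m1 m2 f \<in> Hom C S S'"
  unfolding unipotent_def
  by (intro Add_Hom Comp_Hom[where Y = V] biproduct_Homs) auto

lemma unipotent_in:
  assumes f: "f \<in> Hom C V V"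
  shows "unipotent r1 r2 m1 m2 f \<cdot> l1 = r1"
    and "unipotent r1 r2 m1 m2 f \<cdot> l2 = Add C (r1 \<cdot> f) r2"
proof -
  note H = biproduct_Homs
  have V: "V \<in> Obj C" using Hom_Obj[OF f] by simp
  have eqs: "m1 \<cdot> l1 = Id C V" "m2 \<cdot> l2 = Id C V" "m1 \<cdot> l2 = Zero C V V" "m2 \<cdot> l1 = Zero C V V"
    using L by (auto simp: is_biproduct_def)
  note fm = Comp_Hom[OF H(4) f]
  note a = Add_Hom[OF H(3) fm]
  note ra = Comp_Hom[OF a H(5)] and rm = Comp_Hom[OF H(4) H(6)]
  have 1: "Add C m1 (f \<cdot> m2) \<cdot> l1 = Id C V"
    using Comp_Add_left[OF H(1) H(3) fm] Comp_assoc[OF H(1) H(4) f] Comp_Zero[OF f V]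
      Add_Zero[OF Id_Hom[OF V]] by (simp add: eqs)
  have 2: "Add C m1 (f \<cdot> m2) \<cdot> l2 = f"
    using Comp_Add_left[OF H(2) H(3) fm] Comp_assoc[OF H(2) H(4) f] Comp_Id[OF f]
      Zero_Add[OF f] by (simp add: eqs)
  show "unipotent r1 r2 m1 m2 f \<cdot> l1 = r1"
    unfolding unipotent_def
    using Comp_Add_left[OF H(1) ra rm] Comp_assoc[OF H(1) a H(5)] Comp_assoc[OF H(1) H(4) H(6)]
      Comp_Zero[OF H(6) V] Comp_Id[OF H(5)] Add_Zero[OF H(5)] by (simp add: eqs 1)
  show "unipotent r1 r2 m1 m2 f \<cdot> l2 = Add C (r1 \<cdot> f) r2"
    unfolding unipotent_def
    using Comp_Add_left[OF H(2) ra rm] Comp_assoc[OF H(2) a H(5)] Comp_assoc[OF H(2) H(4) H(6)]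
      Comp_Id[OF H(6)] by (simp add: eqs 2)
qed

lemma unipotent_out:
  assumes f: "f \<in> Hom C V V"
  shows "t1 \<cdot> unipotent r1 r2 m1 m2 f = Add C m1 (f \<cdot> m2)"
    and "t2 \<cdot> unipotent r1 r2 m1 m2 f = m2"
proof -
  note H = biproduct_Homs
  have V: "V \<in> Obj C" "S \<in> Obj C" using Hom_Obj[OF f] Hom_Obj[OF H(1)] by auto
  have eqs: "t1 \<cdot> r1 = Id C V" "t2 \<cdot> r2 = Id C V" "t1 \<cdot> r2 = Zero C V V" "t2 \<cdot> r1 = Zero C V V"
    using R by (auto simp: is_biproduct_def)
  note fm = Comp_Hom[OF H(4) f]
  note a = Add_Hom[OF H(3) fm]
  note ra = Comp_Hom[OF a H(5)] and rm = Comp_Hom[OF H(4) H(6)]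
  show "t1 \<cdot> unipotent r1 r2 m1 m2 f = Add C m1 (f \<cdot> m2)"
    unfolding unipotent_def
    using Comp_Add_right[OF ra rm H(7)] Comp_assoc[OF a H(5) H(7)] Comp_assoc[OF H(4) H(6) H(7)]
      Id_Comp[OF a] Zero_Comp[OF H(4) V(1)] Add_Zero[OF a] by (simp add: eqs)
  show "t2 \<cdot> unipotent r1 r2 m1 m2 f = m2"
    unfolding unipotent_def
    using Comp_Add_right[OF ra rm H(8)] Comp_assoc[OF a H(5) H(8)] Comp_assoc[OF H(4) H(6) H(8)]
      Id_Comp[OF H(4)] Zero_Comp[OF a V(1)] Zero_Add[OF H(4)] by (simp add: eqs)
qed

end

text \<open>Unipotent matrices multiply by adding the off-diagonal entries; \<open>g = - f\<close> gives the inverse.\<close>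

lemma unipotent_inverse:
  assumes L: "is_biproduct C V V S l1 l2 m1 m2" and R: "is_biproduct C V V S' r1 r2 t1 t2"
    and f: "f \<in> Hom C V V" and g: "g \<in> Hom C V V" and gf: "Add C f g = Zero C V V"
  shows "unipotent l1 l2 t1 t2 g \<cdot> unipotent r1 r2 m1 m2 f = Id C S"
proof -
  let ?u = "unipotent r1 r2 m1 m2 f" and ?u' = "unipotent l1 l2 t1 t2 g"
  note H = biproduct_Homs[OF L R]
  have O: "V \<in> Obj C" "S \<in> Obj C" using Hom_Obj[OF H(1)] by auto
  note u = unipotent_Hom[OF L R f] and u' = unipotent_Hom[OF R L g]
  show ?thesis
  proof (rule biproduct_ext_from[OF L Comp_Hom[OF u u'] Id_Hom[OF O(2)]])
    show "(?u' \<cdot> ?u) \<cdot> l1 = Id C S \<cdot> l1"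
      using Comp_assoc[OF H(1) u u'] unipotent_in[OF L R f] unipotent_in[OF R L g] Id_Comp[OF H(1)]
      by simp
    have "(?u' \<cdot> ?u) \<cdot> l2 = ?u' \<cdot> Add C (r1 \<cdot> f) r2"
      using Comp_assoc[OF H(2) u u'] unipotent_in[OF L R f] by simp
    also have "\<dots> = Add C (l1 \<cdot> f) (Add C (l1 \<cdot> g) l2)"
      using Comp_Add_right[OF Comp_Hom[OF f H(5)] H(6) u'] Comp_assoc[OF f H(5) u']
        unipotent_in[OF R L g] by simp
    also have "\<dots> = Add C (l1 \<cdot> Add C f g) l2"
      using Add_assoc[OF Comp_Hom[OF f H(1)] Comp_Hom[OF g H(1)] H(2)] Comp_Add_right[OF f g H(1)] by simp
    also have "\<dots> = l2"
      unfolding gf using Comp_Zero[OF H(1) O(1)] Zero_Add[OF H(2)] by simp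
    finally show "(?u' \<cdot> ?u) \<cdot> l2 = Id C S \<cdot> l2" by (simp add: Id_Comp[OF H(2)])
  qed
qed

lemma unipotent_isomorphism:
  assumes L: "is_biproduct C V V S l1 l2 m1 m2" and R: "is_biproduct C V V S' r1 r2 t1 t2"
    and f: "f \<in> Hom C V V"
  shows "isomorphism C S S' (unipotent r1 r2 m1 m2 f)"
  unfolding isomorphism_def
  using unipotent_Hom[OF L R f] unipotent_Hom[OF R L Scale_Hom[OF f]]
    unipotent_inverse[OF L R f Scale_Hom[OF f] Add_uminus[OF f]]
    unipotent_inverse[OF R L Scale_Hom[OF f] f uminus_Add[OF f]]
  by blast

lemma isomorphism_Id: "X \<in> Obj C \<Longrightarrow> isomorphism C X X (Id C X)"
  unfolding isomorphism_def using Id_Hom Comp_Id[OF Id_Hom] by blast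

end

context finite_strict_tensor_category
begin

lemma biproduct_TMor_Id:
  assumes B: "is_biproduct C X Y S j1 j2 q1 q2" and V: "V \<in> Obj C"
  shows "is_biproduct C (X \<boxtimes> V) (Y \<boxtimes> V) (S \<boxtimes> V)
    (j1 \<star> Id C V) (j2 \<star> Id C V) (q1 \<star> Id C V) (q2 \<star> Id C V)"
proof -
  have j: "j1 \<in> Hom C X S" "j2 \<in> Hom C Y S" "q1 \<in> Hom C S X" "q2 \<in> Hom C S Y"
    and eqs: "q1 \<cdot> j1 = Id C X" "q2 \<cdot> j2 = Id C Y" "q1 \<cdot> j2 = Zero C Y X" "q2 \<cdot> j1 = Zero C X Y"
      "Add C (j1 \<cdot> q1) (j2 \<cdot> q2) = Id C S"
    using B by (auto simp: is_biproduct_def)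
  note I = Id_Hom[OF V]
  note O = Hom_Obj[OF j(1)] Hom_Obj[OF j(2)]
  have "Add C ((j1 \<star> Id C V) \<cdot> (q1 \<star> Id C V)) ((j2 \<star> Id C V) \<cdot> (q2 \<star> Id C V)) = Id C (S \<boxtimes> V)"
    using TMor_Add_left[OF Comp_Hom[OF j(3,1)] Comp_Hom[OF j(4,2)] I] O V
    by (simp add: TMor_Id_Comp[OF j(3,1) V] TMor_Id_Comp[OF j(4,2) V] TMor_Id eqs)
  then show ?thesis
    unfolding is_biproduct_def using j O V I
    by (auto simp: TMor_Hom eqs TMor_Id Zero_TMor[OF I] TMor_Id_Comp[OF j(1,3) V, symmetric]
      TMor_Id_Comp[OF j(2,3) V, symmetric] TMor_Id_Comp[OF j(1,4) V, symmetric]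
      TMor_Id_Comp[OF j(2,4) V, symmetric])
qed

lemma biproduct_Id_TMor:
  assumes B: "is_biproduct C X Y S j1 j2 q1 q2" and V: "V \<in> Obj C"
  shows "is_biproduct C (V \<boxtimes> X) (V \<boxtimes> Y) (V \<boxtimes> S)
    (Id C V \<star> j1) (Id C V \<star> j2) (Id C V \<star> q1) (Id C V \<star> q2)"
proof -
  have j: "j1 \<in> Hom C X S" "j2 \<in> Hom C Y S" "q1 \<in> Hom C S X" "q2 \<in> Hom C S Y"
    and eqs: "q1 \<cdot> j1 = Id C X" "q2 \<cdot> j2 = Id C Y" "q1 \<cdot> j2 = Zero C Y X" "q2 \<cdot> j1 = Zero C X Y"
      "Add C (j1 \<cdot> q1) (j2 \<cdot> q2) = Id C S"
    using B by (auto simp: is_biproduct_def)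
  note I = Id_Hom[OF V]
  note O = Hom_Obj[OF j(1)] Hom_Obj[OF j(2)]
  have "Add C ((Id C V \<star> j1) \<cdot> (Id C V \<star> q1)) ((Id C V \<star> j2) \<cdot> (Id C V \<star> q2)) = Id C (V \<boxtimes> S)"
    using TMor_Add_right[OF I Comp_Hom[OF j(3,1)] Comp_Hom[OF j(4,2)]] O V
    by (simp add: Id_TMor_Comp[OF j(3,1) V] Id_TMor_Comp[OF j(4,2) V] TMor_Id eqs)
  then show ?thesis
    unfolding is_biproduct_def using j O V I
    by (auto simp: TMor_Hom eqs TMor_Id TMor_Zero[OF I] Id_TMor_Comp[OF j(1,3) V, symmetric]
      Id_TMor_Comp[OF j(2,3) V, symmetric] Id_TMor_Comp[OF j(1,4) V, symmetric]
      Id_TMor_Comp[OF j(2,4) V, symmetric])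
qed

end

section \<open>The self-extension of the unit defined by a derivation\<close>

context tensor_functor
begin

abbreviation Z where "Z \<equiv> centralizer C D F"

abbreviation one_braiding where "one_braiding \<equiv> \<lambda>X \<in> Obj C. Id D (FO X)"

lemma centralizer_Unit: "Unit Z = (Unit D, one_braiding)"
  by (simp add: centralizer_def Let_def)

lemma centralizer_Hom: "u \<in> Hom Z P Q \<longleftrightarrow> (\<exists>a. u = (P, a, Q) \<and> half_braiding C D F (fst P) (snd P) \<and>
    half_braiding C D F (fst Q) (snd Q) \<and> a \<in> braided_maps C D F P Q)"
  by (auto simp: centralizer_def Let_def)

lemma centralizer_simps:
  "(Q, b, R) \<cdot>\<^bsub>Z\<^esub> (P, a, Q) = (P, b \<cdot>\<^bsub>D\<^esub> a, R)"
  "Id Z P = (P, Id D (fst P), P)"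
  "Zero Z P Q = (P, Zero D (fst P) (fst Q), Q)"
  by (simp_all add: centralizer_def Let_def)

lemma braided_maps_iff: "a \<in> braided_maps C D F (V, \<rho>) (W, \<sigma>) \<longleftrightarrow> a \<in> Hom D V W \<and>
    (\<forall>X \<in> Obj C. (Id D (FO X) \<star>\<^bsub>D\<^esub> a) \<cdot>\<^bsub>D\<^esub> \<rho> X = \<sigma> X \<cdot>\<^bsub>D\<^esub> (a \<star>\<^bsub>D\<^esub> Id D (FO X)))"
  by (simp add: braided_maps_def)

lemma half_braiding_one: "half_braiding C D F (Unit D) one_braiding"
  unfolding half_braiding_def
proof (intro conjI ballI allI)
  fix X assume X: "X \<in> Obj C"
  show "isomorphism D (Unit D \<boxtimes>\<^bsub>D\<^esub> FO X) (FO X \<boxtimes>\<^bsub>D\<^esub> Unit D) (one_braiding X)"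
    using X D.isomorphism_Id[OF OMap_Obj[OF X]]
    by (simp add: D.TObj_Unit D.Unit_TObj OMap_Obj)
  fix Y assume Y: "Y \<in> Obj C"
  show "one_braiding (X \<boxtimes>\<^bsub>C\<^esub> Y) = (Id D (FO X) \<star>\<^bsub>D\<^esub> one_braiding Y) \<cdot>\<^bsub>D\<^esub> (one_braiding X \<star>\<^bsub>D\<^esub> Id D (FO Y))"
    using X Y D.Comp_Id[OF D.Id_Hom[OF D.TObj_Obj[OF OMap_Obj[OF X] OMap_Obj[OF Y]]]]
    by (simp add: C.TObj_Obj F_TObj D.TMor_Id OMap_Obj)
next
  fix X Y u assume u: "u \<in> Hom C X Y"
  note Fu = MMap_Hom[OF u]
  show "(FM u \<star>\<^bsub>D\<^esub> Id D (Unit D)) \<cdot>\<^bsub>D\<^esub> one_braiding X = one_braiding Y \<cdot>\<^bsub>D\<^esub> (Id D (Unit D) \<star>\<^bsub>D\<^esub> FM u)"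
    using C.Hom_Obj[OF u] by (simp add: D.TMor_Unit[OF Fu] D.Unit_TMor[OF Fu] D.Comp_Id[OF Fu] D.Id_Comp[OF Fu])
qed (auto intro: D.Unit_Obj)

end

text \<open>For strict categories \<open>1 \<otimes> F(X) = F(X) = F(X) \<otimes> 1\<close>, so that both \<open>S \<otimes> F(X)\<close> and \<open>F(X) \<otimes> S\<close> are biproducts of
  two copies of \<open>F(X)\<close>.\<close>

locale derivation_extension = tensor_derivation C D F f
  for C :: "('c, 'f, 'k::field, 'x) tensor_cat_scheme"
    and D :: "('d, 'g, 'k, 'y) tensor_cat_scheme"
    and F :: "('c, 'f, 'd, 'g) funct" and f :: "'c \<Rightarrow> 'g" +
  fixes S j1 j2 q1 q2
  assumes S_biproduct: "is_biproduct D (Unit D) (Unit D) S j1 j2 q1 q2"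
begin

lemma j1: "j1 \<in> Hom D (Unit D) S" and j2: "j2 \<in> Hom D (Unit D) S"
  and q1: "q1 \<in> Hom D S (Unit D)" and q2: "q2 \<in> Hom D S (Unit D)"
  and q1_j1: "q1 \<cdot>\<^bsub>D\<^esub> j1 = Id D (Unit D)" and q2_j2: "q2 \<cdot>\<^bsub>D\<^esub> j2 = Id D (Unit D)"
  and q2_j1: "q2 \<cdot>\<^bsub>D\<^esub> j1 = Zero D (Unit D) (Unit D)"
  using S_biproduct by (auto simp: is_biproduct_def)

lemma S_Obj: "S \<in> Obj D"
  using D.Hom_Obj[OF j1] by simp

definition \<rho> where
  "\<rho> = (\<lambda>X \<in> Obj C. D.unipotent (Id D (FO X) \<star>\<^bsub>D\<^esub> j1) (Id D (FO X) \<star>\<^bsub>D\<^esub> j2)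
     (q1 \<star>\<^bsub>D\<^esub> Id D (FO X)) (q2 \<star>\<^bsub>D\<^esub> Id D (FO X)) (f X))"

context
  fixes X assumes X: "X \<in> Obj C"
begin

lemma S_FX: "is_biproduct D (FO X) (FO X) (S \<boxtimes>\<^bsub>D\<^esub> FO X) (j1 \<star>\<^bsub>D\<^esub> Id D (FO X)) (j2 \<star>\<^bsub>D\<^esub> Id D (FO X))
    (q1 \<star>\<^bsub>D\<^esub> Id D (FO X)) (q2 \<star>\<^bsub>D\<^esub> Id D (FO X))"
  using D.biproduct_TMor_Id[OF S_biproduct OMap_Obj[OF X]] D.Unit_TObj[OF OMap_Obj[OF X]] by simp

lemma FX_S: "is_biproduct D (FO X) (FO X) (FO X \<boxtimes>\<^bsub>D\<^esub> S) (Id D (FO X) \<star>\<^bsub>D\<^esub> j1) (Id D (FO X) \<star>\<^bsub>D\<^esub> j2)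
    (Id D (FO X) \<star>\<^bsub>D\<^esub> q1) (Id D (FO X) \<star>\<^bsub>D\<^esub> q2)"
  using D.biproduct_Id_TMor[OF S_biproduct OMap_Obj[OF X]] D.TObj_Unit[OF OMap_Obj[OF X]] by simp

lemmas FX_Homs = D.biproduct_Homs[OF S_FX FX_S]

lemma \<rho>_isomorphism: "isomorphism D (S \<boxtimes>\<^bsub>D\<^esub> FO X) (FO X \<boxtimes>\<^bsub>D\<^esub> S) (\<rho> X)"
  using D.unipotent_isomorphism[OF S_FX FX_S f_Hom[OF X]] X by (simp add: \<rho>_def)

lemma \<rho>_Hom: "\<rho> X \<in> Hom D (S \<boxtimes>\<^bsub>D\<^esub> FO X) (FO X \<boxtimes>\<^bsub>D\<^esub> S)"
  using \<rho>_isomorphism by (simp add: isomorphism_def)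

lemma \<rho>_in:
  "\<rho> X \<cdot>\<^bsub>D\<^esub> (j1 \<star>\<^bsub>D\<^esub> Id D (FO X)) = Id D (FO X) \<star>\<^bsub>D\<^esub> j1"
  "\<rho> X \<cdot>\<^bsub>D\<^esub> (j2 \<star>\<^bsub>D\<^esub> Id D (FO X))
    = Add D ((Id D (FO X) \<star>\<^bsub>D\<^esub> j1) \<cdot>\<^bsub>D\<^esub> f X) (Id D (FO X) \<star>\<^bsub>D\<^esub> j2)"
  using D.unipotent_in[OF S_FX FX_S f_Hom[OF X]] X by (simp_all add: \<rho>_def)

lemma \<rho>_out:
  "(Id D (FO X) \<star>\<^bsub>D\<^esub> q1) \<cdot>\<^bsub>D\<^esub> \<rho> X
    = Add D (q1 \<star>\<^bsub>D\<^esub> Id D (FO X)) (f X \<cdot>\<^bsub>D\<^esub> (q2 \<star>\<^bsub>D\<^esub> Id D (FO X)))"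
  "(Id D (FO X) \<star>\<^bsub>D\<^esub> q2) \<cdot>\<^bsub>D\<^esub> \<rho> X = q2 \<star>\<^bsub>D\<^esub> Id D (FO X)"
  using D.unipotent_out[OF S_FX FX_S f_Hom[OF X]] X by (simp_all add: \<rho>_def)

end

lemma slide_left:
  assumes u: "u \<in> Hom C X Y" and j: "j \<in> Hom D (Unit D) T"
  shows "(Id D T \<star>\<^bsub>D\<^esub> FM u) \<cdot>\<^bsub>D\<^esub> (j \<star>\<^bsub>D\<^esub> Id D (FO X)) = (j \<star>\<^bsub>D\<^esub> Id D (FO Y)) \<cdot>\<^bsub>D\<^esub> FM u"
  using D.TMor_right_left[OF j MMap_Hom[OF u]] D.TMor_left_right[OF j MMap_Hom[OF u]]
    D.Unit_TMor[OF MMap_Hom[OF u]] by simp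

lemma slide_right:
  assumes u: "u \<in> Hom C X Y" and j: "j \<in> Hom D (Unit D) T"
  shows "(FM u \<star>\<^bsub>D\<^esub> Id D T) \<cdot>\<^bsub>D\<^esub> (Id D (FO X) \<star>\<^bsub>D\<^esub> j) = (Id D (FO Y) \<star>\<^bsub>D\<^esub> j) \<cdot>\<^bsub>D\<^esub> FM u"
  using D.TMor_right_left[OF MMap_Hom[OF u] j] D.TMor_left_right[OF MMap_Hom[OF u] j]
    D.TMor_Unit[OF MMap_Hom[OF u]] by simp

text \<open>Restricted to the first summand this is the interchange law; on the second summand the additional term is
  the naturality of \<open>f\<close>.\<close>

lemma \<rho>_natural:
  assumes u: "u \<in> Hom C X Y"
  shows "(FM u \<star>\<^bsub>D\<^esub> Id D S) \<cdot>\<^bsub>D\<^esub> \<rho> X = \<rho> Y \<cdot>\<^bsub>D\<^esub> (Id D S \<star>\<^bsub>D\<^esub> FM u)"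
proof -
  have X: "X \<in> Obj C" and Y: "Y \<in> Obj C" using C.Hom_Obj[OF u] by auto
  note Fu = MMap_Hom[OF u] and IS = D.Id_Hom[OF S_Obj]
  note HX = FX_Homs[OF X] and HY = FX_Homs[OF Y]
  note uS = D.TMor_Hom[OF Fu IS] and Su = D.TMor_Hom[OF IS Fu]
  note rX = \<rho>_Hom[OF X] and rY = \<rho>_Hom[OF Y]
  note fX = f_Hom[OF X] and fY = f_Hom[OF Y]
  show ?thesis
  proof (rule D.biproduct_ext_from[OF S_FX[OF X] D.Comp_Hom[OF rX uS] D.Comp_Hom[OF Su rY]])
    show "((FM u \<star>\<^bsub>D\<^esub> Id D S) \<cdot>\<^bsub>D\<^esub> \<rho> X) \<cdot>\<^bsub>D\<^esub> (j1 \<star>\<^bsub>D\<^esub> Id D (FO X))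
      = (\<rho> Y \<cdot>\<^bsub>D\<^esub> (Id D S \<star>\<^bsub>D\<^esub> FM u)) \<cdot>\<^bsub>D\<^esub> (j1 \<star>\<^bsub>D\<^esub> Id D (FO X))"
      using D.Comp_assoc[OF HX(1) rX uS] D.Comp_assoc[OF HX(1) Su rY] D.Comp_assoc[OF Fu HY(1) rY]
      by (simp add: \<rho>_in[OF X] \<rho>_in[OF Y] slide_left[OF u j1] slide_right[OF u j1])
    have "((FM u \<star>\<^bsub>D\<^esub> Id D S) \<cdot>\<^bsub>D\<^esub> \<rho> X) \<cdot>\<^bsub>D\<^esub> (j2 \<star>\<^bsub>D\<^esub> Id D (FO X))
      = (FM u \<star>\<^bsub>D\<^esub> Id D S) \<cdot>\<^bsub>D\<^esub> Add D ((Id D (FO X) \<star>\<^bsub>D\<^esub> j1) \<cdot>\<^bsub>D\<^esub> f X) (Id D (FO X) \<star>\<^bsub>D\<^esub> j2)"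
      using D.Comp_assoc[OF HX(2) rX uS] by (simp add: \<rho>_in[OF X])
    also have "\<dots> = Add D (((Id D (FO Y) \<star>\<^bsub>D\<^esub> j1) \<cdot>\<^bsub>D\<^esub> FM u) \<cdot>\<^bsub>D\<^esub> f X) ((Id D (FO Y) \<star>\<^bsub>D\<^esub> j2) \<cdot>\<^bsub>D\<^esub> FM u)"
      using D.Comp_Add_right[OF D.Comp_Hom[OF fX HX(5)] HX(6) uS] D.Comp_assoc[OF fX HX(5) uS]
      by (simp add: slide_right[OF u j1] slide_right[OF u j2])
    also have "((Id D (FO Y) \<star>\<^bsub>D\<^esub> j1) \<cdot>\<^bsub>D\<^esub> FM u) \<cdot>\<^bsub>D\<^esub> f X = ((Id D (FO Y) \<star>\<^bsub>D\<^esub> j1) \<cdot>\<^bsub>D\<^esub> f Y) \<cdot>\<^bsub>D\<^esub> FM u"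
      using D.Comp_assoc[OF fX Fu HY(5)] D.Comp_assoc[OF Fu fY HY(5)] f_natural[OF u] by simp
    also have "Add D (((Id D (FO Y) \<star>\<^bsub>D\<^esub> j1) \<cdot>\<^bsub>D\<^esub> f Y) \<cdot>\<^bsub>D\<^esub> FM u) ((Id D (FO Y) \<star>\<^bsub>D\<^esub> j2) \<cdot>\<^bsub>D\<^esub> FM u)
      = (\<rho> Y \<cdot>\<^bsub>D\<^esub> (j2 \<star>\<^bsub>D\<^esub> Id D (FO Y))) \<cdot>\<^bsub>D\<^esub> FM u"
      using D.Comp_Add_left[OF Fu D.Comp_Hom[OF fY HY(5)] HY(6)] by (simp add: \<rho>_in[OF Y])
    also have "\<dots> = (\<rho> Y \<cdot>\<^bsub>D\<^esub> (Id D S \<star>\<^bsub>D\<^esub> FM u)) \<cdot>\<^bsub>D\<^esub> (j2 \<star>\<^bsub>D\<^esub> Id D (FO X))"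
      using D.Comp_assoc[OF Fu HY(2) rY] D.Comp_assoc[OF HX(2) Su rY] by (simp add: slide_left[OF u j2])
    finally show "((FM u \<star>\<^bsub>D\<^esub> Id D S) \<cdot>\<^bsub>D\<^esub> \<rho> X) \<cdot>\<^bsub>D\<^esub> (j2 \<star>\<^bsub>D\<^esub> Id D (FO X))
      = (\<rho> Y \<cdot>\<^bsub>D\<^esub> (Id D S \<star>\<^bsub>D\<^esub> FM u)) \<cdot>\<^bsub>D\<^esub> (j2 \<star>\<^bsub>D\<^esub> Id D (FO X))" .
  qed
qed

text \<open>On the second summand the right-hand side collects \<open>f\<^bsub>X\<^esub> \<otimes> id\<close> from the first factor and \<open>id \<otimes> f\<^bsub>Y\<^esub>\<close> from
  the second; their sum is \<open>f\<^bsub>X \<otimes> Y\<^esub>\<close> by the derivation rule.\<close>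

lemma \<rho>_TObj:
  assumes X: "X \<in> Obj C" and Y: "Y \<in> Obj C"
  shows "\<rho> (X \<boxtimes>\<^bsub>C\<^esub> Y) = (Id D (FO X) \<star>\<^bsub>D\<^esub> \<rho> Y) \<cdot>\<^bsub>D\<^esub> (\<rho> X \<star>\<^bsub>D\<^esub> Id D (FO Y))"
proof -
  let ?IX = "Id D (FO X)" and ?IY = "Id D (FO Y)" and ?IXY = "Id D (FO X \<boxtimes>\<^bsub>D\<^esub> FO Y)"
  note XY = C.TObj_Obj[OF X Y]
  note FX = OMap_Obj[OF X] and FY = OMap_Obj[OF Y]
  note IX = D.Id_Hom[OF FX] and IY = D.Id_Hom[OF FY]
  note HX = FX_Homs[OF X] and HY = FX_Homs[OF Y]
  note rX = \<rho>_Hom[OF X] and rY = \<rho>_Hom[OF Y]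
  note fX = f_Hom[OF X] and fY = f_Hom[OF Y]
  have F: "FO (X \<boxtimes>\<^bsub>C\<^esub> Y) = FO X \<boxtimes>\<^bsub>D\<^esub> FO Y" by (rule F_TObj[OF X Y])
  have O: "FO X \<boxtimes>\<^bsub>D\<^esub> (FO Y \<boxtimes>\<^bsub>D\<^esub> S) = (FO X \<boxtimes>\<^bsub>D\<^esub> FO Y) \<boxtimes>\<^bsub>D\<^esub> S"
    "(S \<boxtimes>\<^bsub>D\<^esub> FO X) \<boxtimes>\<^bsub>D\<^esub> FO Y = S \<boxtimes>\<^bsub>D\<^esub> (FO X \<boxtimes>\<^bsub>D\<^esub> FO Y)"
    "(FO X \<boxtimes>\<^bsub>D\<^esub> S) \<boxtimes>\<^bsub>D\<^esub> FO Y = FO X \<boxtimes>\<^bsub>D\<^esub> (S \<boxtimes>\<^bsub>D\<^esub> FO Y)"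
    using FX FY S_Obj by (simp_all add: D.TObj_assoc)
  have II: "?IX \<star>\<^bsub>D\<^esub> ?IY = ?IXY" by (rule D.TMor_Id[OF FX FY])
  have a: "?IX \<star>\<^bsub>D\<^esub> \<rho> Y \<in> Hom D (FO X \<boxtimes>\<^bsub>D\<^esub> (S \<boxtimes>\<^bsub>D\<^esub> FO Y)) ((FO X \<boxtimes>\<^bsub>D\<^esub> FO Y) \<boxtimes>\<^bsub>D\<^esub> S)"
    using D.TMor_Hom[OF IX rY] O by simp
  have b: "\<rho> X \<star>\<^bsub>D\<^esub> ?IY \<in> Hom D (S \<boxtimes>\<^bsub>D\<^esub> (FO X \<boxtimes>\<^bsub>D\<^esub> FO Y)) (FO X \<boxtimes>\<^bsub>D\<^esub> (S \<boxtimes>\<^bsub>D\<^esub> FO Y))"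
    using D.TMor_Hom[OF rX IY] O by simp
  have jIXY: "j \<star>\<^bsub>D\<^esub> ?IXY = (j \<star>\<^bsub>D\<^esub> ?IX) \<star>\<^bsub>D\<^esub> ?IY" "(?IX \<star>\<^bsub>D\<^esub> j) \<star>\<^bsub>D\<^esub> ?IY = ?IX \<star>\<^bsub>D\<^esub> (j \<star>\<^bsub>D\<^esub> ?IY)"
    "?IX \<star>\<^bsub>D\<^esub> (?IY \<star>\<^bsub>D\<^esub> j) = ?IXY \<star>\<^bsub>D\<^esub> j" if "j \<in> Hom D (Unit D) S" for j
    using D.TMor_assoc[OF that IX IY] D.TMor_assoc[OF IX that IY] D.TMor_assoc[OF IX IY that] II by simp_all
  note sXY = S_FX[OF XY, unfolded F] and HXY = FX_Homs[OF XY, unfolded F]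
  have rXY: "\<rho> (X \<boxtimes>\<^bsub>C\<^esub> Y) \<in> Hom D (S \<boxtimes>\<^bsub>D\<^esub> (FO X \<boxtimes>\<^bsub>D\<^esub> FO Y)) ((FO X \<boxtimes>\<^bsub>D\<^esub> FO Y) \<boxtimes>\<^bsub>D\<^esub> S)"
    using \<rho>_Hom[OF XY] F by simp
  show ?thesis
  proof (rule D.biproduct_ext_from[OF sXY rXY D.Comp_Hom[OF b a]])
    have "((?IX \<star>\<^bsub>D\<^esub> \<rho> Y) \<cdot>\<^bsub>D\<^esub> (\<rho> X \<star>\<^bsub>D\<^esub> ?IY)) \<cdot>\<^bsub>D\<^esub> (j1 \<star>\<^bsub>D\<^esub> ?IXY)
        = (?IX \<star>\<^bsub>D\<^esub> \<rho> Y) \<cdot>\<^bsub>D\<^esub> ((\<rho> X \<star>\<^bsub>D\<^esub> ?IY) \<cdot>\<^bsub>D\<^esub> ((j1 \<star>\<^bsub>D\<^esub> ?IX) \<star>\<^bsub>D\<^esub> ?IY))"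
      using D.Comp_assoc[OF HXY(1) b a] jIXY[OF j1] by simp
    also have "(\<rho> X \<star>\<^bsub>D\<^esub> ?IY) \<cdot>\<^bsub>D\<^esub> ((j1 \<star>\<^bsub>D\<^esub> ?IX) \<star>\<^bsub>D\<^esub> ?IY) = ?IX \<star>\<^bsub>D\<^esub> (j1 \<star>\<^bsub>D\<^esub> ?IY)"
      using D.TMor_Id_Comp[OF HX(1) rX FY] \<rho>_in[OF X] jIXY[OF j1] by simp
    also have "(?IX \<star>\<^bsub>D\<^esub> \<rho> Y) \<cdot>\<^bsub>D\<^esub> (?IX \<star>\<^bsub>D\<^esub> (j1 \<star>\<^bsub>D\<^esub> ?IY)) = ?IXY \<star>\<^bsub>D\<^esub> j1"
      using D.Id_TMor_Comp[OF HY(1) rY FX] \<rho>_in[OF Y] jIXY[OF j1] by simp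
    finally show "\<rho> (X \<boxtimes>\<^bsub>C\<^esub> Y) \<cdot>\<^bsub>D\<^esub> (j1 \<star>\<^bsub>D\<^esub> ?IXY)
        = ((?IX \<star>\<^bsub>D\<^esub> \<rho> Y) \<cdot>\<^bsub>D\<^esub> (\<rho> X \<star>\<^bsub>D\<^esub> ?IY)) \<cdot>\<^bsub>D\<^esub> (j1 \<star>\<^bsub>D\<^esub> ?IXY)"
      using \<rho>_in[OF XY] F by simp
    have fXI: "f X \<star>\<^bsub>D\<^esub> ?IY \<in> Hom D (FO X \<boxtimes>\<^bsub>D\<^esub> FO Y) (FO X \<boxtimes>\<^bsub>D\<^esub> FO Y)"
      and IfY: "?IX \<star>\<^bsub>D\<^esub> f Y \<in> Hom D (FO X \<boxtimes>\<^bsub>D\<^esub> FO Y) (FO X \<boxtimes>\<^bsub>D\<^esub> FO Y)"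
      by (rule D.TMor_Hom[OF fX IY] D.TMor_Hom[OF IX fY])+
    have k: "?IX \<star>\<^bsub>D\<^esub> (j1 \<star>\<^bsub>D\<^esub> ?IY) \<in> Hom D (FO X \<boxtimes>\<^bsub>D\<^esub> FO Y) (FO X \<boxtimes>\<^bsub>D\<^esub> (S \<boxtimes>\<^bsub>D\<^esub> FO Y))"
      "?IX \<star>\<^bsub>D\<^esub> (j2 \<star>\<^bsub>D\<^esub> ?IY) \<in> Hom D (FO X \<boxtimes>\<^bsub>D\<^esub> FO Y) (FO X \<boxtimes>\<^bsub>D\<^esub> (S \<boxtimes>\<^bsub>D\<^esub> FO Y))"
      by (rule D.TMor_Hom[OF IX HY(1)] D.TMor_Hom[OF IX HY(2)])+
    have "((?IX \<star>\<^bsub>D\<^esub> \<rho> Y) \<cdot>\<^bsub>D\<^esub> (\<rho> X \<star>\<^bsub>D\<^esub> ?IY)) \<cdot>\<^bsub>D\<^esub> (j2 \<star>\<^bsub>D\<^esub> ?IXY)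
        = (?IX \<star>\<^bsub>D\<^esub> \<rho> Y) \<cdot>\<^bsub>D\<^esub> ((\<rho> X \<star>\<^bsub>D\<^esub> ?IY) \<cdot>\<^bsub>D\<^esub> ((j2 \<star>\<^bsub>D\<^esub> ?IX) \<star>\<^bsub>D\<^esub> ?IY))"
      using D.Comp_assoc[OF HXY(2) b a] jIXY[OF j2] by simp
    also have "(\<rho> X \<star>\<^bsub>D\<^esub> ?IY) \<cdot>\<^bsub>D\<^esub> ((j2 \<star>\<^bsub>D\<^esub> ?IX) \<star>\<^bsub>D\<^esub> ?IY)
        = Add D ((?IX \<star>\<^bsub>D\<^esub> j1) \<cdot>\<^bsub>D\<^esub> f X) (?IX \<star>\<^bsub>D\<^esub> j2) \<star>\<^bsub>D\<^esub> ?IY"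
      using D.TMor_Id_Comp[OF HX(2) rX FY] \<rho>_in[OF X] by simp
    also have "\<dots> = Add D ((?IX \<star>\<^bsub>D\<^esub> (j1 \<star>\<^bsub>D\<^esub> ?IY)) \<cdot>\<^bsub>D\<^esub> (f X \<star>\<^bsub>D\<^esub> ?IY)) (?IX \<star>\<^bsub>D\<^esub> (j2 \<star>\<^bsub>D\<^esub> ?IY))"
      using D.TMor_Add_left[OF D.Comp_Hom[OF fX HX(5)] HX(6) IY] D.TMor_Id_Comp[OF fX HX(5) FY]
        jIXY[OF j1] jIXY[OF j2] by simp
    also have "(?IX \<star>\<^bsub>D\<^esub> \<rho> Y) \<cdot>\<^bsub>D\<^esub> \<dots>
        = Add D ((?IXY \<star>\<^bsub>D\<^esub> j1) \<cdot>\<^bsub>D\<^esub> (f X \<star>\<^bsub>D\<^esub> ?IY)) ((?IX \<star>\<^bsub>D\<^esub> \<rho> Y) \<cdot>\<^bsub>D\<^esub> (?IX \<star>\<^bsub>D\<^esub> (j2 \<star>\<^bsub>D\<^esub> ?IY)))"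
      using D.Comp_Add_right[OF D.Comp_Hom[OF fXI k(1)] k(2) a] D.Comp_assoc[OF fXI k(1) a]
        D.Id_TMor_Comp[OF HY(1) rY FX] \<rho>_in[OF Y] jIXY[OF j1] by simp
    also have "(?IX \<star>\<^bsub>D\<^esub> \<rho> Y) \<cdot>\<^bsub>D\<^esub> (?IX \<star>\<^bsub>D\<^esub> (j2 \<star>\<^bsub>D\<^esub> ?IY))
        = ?IX \<star>\<^bsub>D\<^esub> Add D ((?IY \<star>\<^bsub>D\<^esub> j1) \<cdot>\<^bsub>D\<^esub> f Y) (?IY \<star>\<^bsub>D\<^esub> j2)"
      using D.Id_TMor_Comp[OF HY(2) rY FX] \<rho>_in[OF Y] by simp
    also have "\<dots> = Add D ((?IXY \<star>\<^bsub>D\<^esub> j1) \<cdot>\<^bsub>D\<^esub> (?IX \<star>\<^bsub>D\<^esub> f Y)) (?IXY \<star>\<^bsub>D\<^esub> j2)"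
      using D.TMor_Add_right[OF IX D.Comp_Hom[OF fY HY(5)] HY(6)] D.Id_TMor_Comp[OF fY HY(5) FX]
        jIXY[OF j1] jIXY[OF j2] by simp
    also have "Add D ((?IXY \<star>\<^bsub>D\<^esub> j1) \<cdot>\<^bsub>D\<^esub> (f X \<star>\<^bsub>D\<^esub> ?IY)) \<dots>
        = Add D ((?IXY \<star>\<^bsub>D\<^esub> j1) \<cdot>\<^bsub>D\<^esub> f (X \<boxtimes>\<^bsub>C\<^esub> Y)) (?IXY \<star>\<^bsub>D\<^esub> j2)"
      unfolding f_TObj[OF X Y] D.Comp_Add_right[OF IfY fXI HXY(5)]
      using D.Add_assoc[OF D.Comp_Hom[OF fXI HXY(5)] D.Comp_Hom[OF IfY HXY(5)] HXY(6)]
        D.Add_commute[OF D.Comp_Hom[OF fXI HXY(5)] D.Comp_Hom[OF IfY HXY(5)]] by simp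
    finally show "\<rho> (X \<boxtimes>\<^bsub>C\<^esub> Y) \<cdot>\<^bsub>D\<^esub> (j2 \<star>\<^bsub>D\<^esub> ?IXY)
        = ((?IX \<star>\<^bsub>D\<^esub> \<rho> Y) \<cdot>\<^bsub>D\<^esub> (\<rho> X \<star>\<^bsub>D\<^esub> ?IY)) \<cdot>\<^bsub>D\<^esub> (j2 \<star>\<^bsub>D\<^esub> ?IXY)"
      using \<rho>_in[OF XY] F by simp
  qed
qed

lemma half_braiding_\<rho>: "half_braiding C D F S \<rho>"
  unfolding half_braiding_def
  using S_Obj \<rho>_isomorphism \<rho>_natural \<rho>_TObj by (auto simp: \<rho>_def)

abbreviation incl where "incl \<equiv> (Unit Z, j1, (S, \<rho>))"
abbreviation proj where "proj \<equiv> ((S, \<rho>), q2, Unit Z)"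

lemma incl_Hom: "incl \<in> Hom Z (Unit Z) (S, \<rho>)"
  using half_braiding_one half_braiding_\<rho> j1 D.Comp_Id[OF FX_Homs(5)] \<rho>_in(1)
  by (auto simp: centralizer_Hom centralizer_Unit braided_maps_iff)

lemma proj_Hom: "proj \<in> Hom Z (S, \<rho>) (Unit Z)"
  using half_braiding_one half_braiding_\<rho> q2 D.Id_Comp[OF FX_Homs(4)] \<rho>_out(2)
  by (auto simp: centralizer_Hom centralizer_Unit braided_maps_iff)

lemma proj_incl: "proj \<cdot>\<^bsub>Z\<^esub> incl = Zero Z (Unit Z) (Unit Z)"
  by (simp add: centralizer_simps centralizer_Unit q2_j1)

text \<open>A morphism \<open>g\<close> to \<open>S\<close> killed by \<open>q\<^sub>2\<close> factors in \<open>D\<close> through \<open>h = q\<^sub>1 g\<close>. This \<open>h\<close> is a morphism of the centralizer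
  because the off-diagonal entry \<open>f\<^bsub>X\<^esub>\<close> of the half-braiding only acts on the component \<open>q\<^sub>2 g = 0\<close>.\<close>

lemma incl_kernel: "is_kernel Z (S, \<rho>) (Unit Z) proj (Unit Z) incl"
  unfolding is_kernel_def
proof (intro conjI proj_Hom incl_Hom proj_incl allI ballI impI)
  fix W g assume g: "g \<in> Hom Z W (S, \<rho>)" and pg: "proj \<cdot>\<^bsub>Z\<^esub> g = Zero Z W (Unit Z)"
  obtain T \<tau> where W: "W = (T, \<tau>)" by force
  obtain g0 where g_eq: "g = ((T, \<tau>), g0, (S, \<rho>))" and \<tau>: "half_braiding C D F T \<tau>"
    and g0: "g0 \<in> Hom D T S"
    and br: "\<And>X. X \<in> Obj C \<Longrightarrow> (Id D (FO X) \<star>\<^bsub>D\<^esub> g0) \<cdot>\<^bsub>D\<^esub> \<tau> X = \<rho> X \<cdot>\<^bsub>D\<^esub> (g0 \<star>\<^bsub>D\<^esub> Id D (FO X))"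
    using g by (auto simp: W centralizer_Hom braided_maps_iff)
  have q2g: "q2 \<cdot>\<^bsub>D\<^esub> g0 = Zero D T (Unit D)"
    using pg by (simp add: g_eq W centralizer_simps centralizer_Unit)
  define h0 where "h0 = q1 \<cdot>\<^bsub>D\<^esub> g0"
  have h0: "h0 \<in> Hom D T (Unit D)" unfolding h0_def by (rule D.Comp_Hom[OF g0 q1])
  have T: "T \<in> Obj D" using D.Hom_Obj[OF g0] by simp
  have j1h0: "j1 \<cdot>\<^bsub>D\<^esub> h0 = g0"
  proof (rule D.biproduct_ext_into[OF S_biproduct D.Comp_Hom[OF h0 j1] g0])
    show "q1 \<cdot>\<^bsub>D\<^esub> (j1 \<cdot>\<^bsub>D\<^esub> h0) = q1 \<cdot>\<^bsub>D\<^esub> g0"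
      using D.Comp_assoc[OF h0 j1 q1] q1_j1 D.Id_Comp[OF h0] by (simp add: h0_def)
    show "q2 \<cdot>\<^bsub>D\<^esub> (j1 \<cdot>\<^bsub>D\<^esub> h0) = q2 \<cdot>\<^bsub>D\<^esub> g0"
      using D.Comp_assoc[OF h0 j1 q2] q2_j1 D.Zero_Comp[OF h0 D.Unit_Obj] q2g by simp
  qed
  have h0_br: "(Id D (FO X) \<star>\<^bsub>D\<^esub> h0) \<cdot>\<^bsub>D\<^esub> \<tau> X = Id D (FO X) \<cdot>\<^bsub>D\<^esub> (h0 \<star>\<^bsub>D\<^esub> Id D (FO X))"
    if X: "X \<in> Obj C" for X
  proof -
    let ?I = "Id D (FO X)"
    note FX = OMap_Obj[OF X] and fX = f_Hom[OF X] and H = FX_Homs[OF X]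
    note I = D.Id_Hom[OF FX]
    have t: "\<tau> X \<in> Hom D (T \<boxtimes>\<^bsub>D\<^esub> FO X) (FO X \<boxtimes>\<^bsub>D\<^esub> T)"
      using \<tau> X by (auto simp: half_braiding_def isomorphism_def)
    note Ig = D.TMor_Hom[OF I g0] and gI = D.TMor_Hom[OF g0 I]
    have hI: "h0 \<star>\<^bsub>D\<^esub> ?I \<in> Hom D (T \<boxtimes>\<^bsub>D\<^esub> FO X) (FO X)"
      using D.TMor_Hom[OF h0 I] by (simp add: D.Unit_TObj[OF FX])
    have "(?I \<star>\<^bsub>D\<^esub> h0) \<cdot>\<^bsub>D\<^esub> \<tau> X = (?I \<star>\<^bsub>D\<^esub> q1) \<cdot>\<^bsub>D\<^esub> (\<rho> X \<cdot>\<^bsub>D\<^esub> (g0 \<star>\<^bsub>D\<^esub> ?I))"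
      unfolding h0_def br[OF X, symmetric]
      using D.Id_TMor_Comp[OF g0 q1 FX] D.Comp_assoc[OF t Ig H(7)] by simp
    also have "\<dots> = Add D (q1 \<star>\<^bsub>D\<^esub> ?I) (f X \<cdot>\<^bsub>D\<^esub> (q2 \<star>\<^bsub>D\<^esub> ?I)) \<cdot>\<^bsub>D\<^esub> (g0 \<star>\<^bsub>D\<^esub> ?I)"
      using D.Comp_assoc[OF gI \<rho>_Hom[OF X] H(7)] \<rho>_out(1)[OF X] by simp
    also have "\<dots> = Add D ((q1 \<star>\<^bsub>D\<^esub> ?I) \<cdot>\<^bsub>D\<^esub> (g0 \<star>\<^bsub>D\<^esub> ?I)) (f X \<cdot>\<^bsub>D\<^esub> ((q2 \<star>\<^bsub>D\<^esub> ?I) \<cdot>\<^bsub>D\<^esub> (g0 \<star>\<^bsub>D\<^esub> ?I)))"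
      using D.Comp_Add_left[OF gI H(3) D.Comp_Hom[OF H(4) fX]] D.Comp_assoc[OF gI H(4) fX] by simp
    also have "(q1 \<star>\<^bsub>D\<^esub> ?I) \<cdot>\<^bsub>D\<^esub> (g0 \<star>\<^bsub>D\<^esub> ?I) = h0 \<star>\<^bsub>D\<^esub> ?I"
      unfolding h0_def by (rule D.TMor_Id_Comp[OF g0 q1 FX, symmetric])
    also have "(q2 \<star>\<^bsub>D\<^esub> ?I) \<cdot>\<^bsub>D\<^esub> (g0 \<star>\<^bsub>D\<^esub> ?I) = Zero D (T \<boxtimes>\<^bsub>D\<^esub> FO X) (FO X)"
      using D.TMor_Id_Comp[OF g0 q2 FX] q2g D.Zero_TMor[OF I T D.Unit_Obj] D.Unit_TObj[OF FX] by simp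
    also have "f X \<cdot>\<^bsub>D\<^esub> Zero D (T \<boxtimes>\<^bsub>D\<^esub> FO X) (FO X) = Zero D (T \<boxtimes>\<^bsub>D\<^esub> FO X) (FO X)"
      by (rule D.Comp_Zero[OF fX D.TObj_Obj[OF T FX]])
    finally show ?thesis by (simp add: D.Add_Zero[OF hI] D.Id_Comp[OF hI])
  qed
  let ?h = "(W, h0, Unit Z)"
  have h: "?h \<in> Hom Z W (Unit Z)"
    using \<tau> half_braiding_one h0 h0_br by (auto simp: W centralizer_Hom centralizer_Unit braided_maps_iff)
  have "k = ?h" if k_Hom: "k \<in> Hom Z W (Unit Z)" and k_g: "incl \<cdot>\<^bsub>Z\<^esub> k = g" for k
  proof -
    obtain k0 where k: "k = (W, k0, Unit Z)" and k0: "k0 \<in> Hom D T (Unit D)"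
      using k_Hom by (auto simp: W centralizer_Hom centralizer_Unit braided_maps_iff)
    have "j1 \<cdot>\<^bsub>D\<^esub> k0 = g0" using k_g by (simp add: k g_eq W centralizer_simps)
    then have "k0 = h0"
      using D.Comp_assoc[OF k0 j1 q1] q1_j1 D.Id_Comp[OF k0] by (simp add: h0_def)
    then show ?thesis using k by simp
  qed
  moreover have "incl \<cdot>\<^bsub>Z\<^esub> ?h = g" using j1h0 by (simp add: g_eq W centralizer_simps)
  ultimately show "\<exists>!k. k \<in> Hom Z W (Unit Z) \<and> incl \<cdot>\<^bsub>Z\<^esub> k = g" using h by blast
qed

text \<open>Dual to the kernel: \<open>f\<^bsub>X\<^esub>\<close> maps into the summand \<open>j\<^sub>1\<close>, which \<open>g\<close> kills.\<close>

lemma proj_cokernel: "is_cokernel Z (Unit Z) (S, \<rho>) incl (Unit Z) proj"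
  unfolding is_cokernel_def
proof (intro conjI proj_Hom incl_Hom proj_incl allI ballI impI)
  fix W g assume g: "g \<in> Hom Z (S, \<rho>) W" and gi: "g \<cdot>\<^bsub>Z\<^esub> incl = Zero Z (Unit Z) W"
  obtain T \<tau> where W: "W = (T, \<tau>)" by force
  obtain g0 where g_eq: "g = ((S, \<rho>), g0, (T, \<tau>))" and \<tau>: "half_braiding C D F T \<tau>"
    and g0: "g0 \<in> Hom D S T"
    and br: "\<And>X. X \<in> Obj C \<Longrightarrow> (Id D (FO X) \<star>\<^bsub>D\<^esub> g0) \<cdot>\<^bsub>D\<^esub> \<rho> X = \<tau> X \<cdot>\<^bsub>D\<^esub> (g0 \<star>\<^bsub>D\<^esub> Id D (FO X))"
    using g by (auto simp: W centralizer_Hom braided_maps_iff)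
  have gj1: "g0 \<cdot>\<^bsub>D\<^esub> j1 = Zero D (Unit D) T"
    using gi by (simp add: g_eq W centralizer_simps centralizer_Unit)
  define h0 where "h0 = g0 \<cdot>\<^bsub>D\<^esub> j2"
  have h0: "h0 \<in> Hom D (Unit D) T" unfolding h0_def by (rule D.Comp_Hom[OF j2 g0])
  have T: "T \<in> Obj D" using D.Hom_Obj[OF g0] by simp
  have h0q2: "h0 \<cdot>\<^bsub>D\<^esub> q2 = g0"
  proof (rule D.biproduct_ext_from[OF S_biproduct D.Comp_Hom[OF q2 h0] g0])
    show "(h0 \<cdot>\<^bsub>D\<^esub> q2) \<cdot>\<^bsub>D\<^esub> j2 = g0 \<cdot>\<^bsub>D\<^esub> j2"
      using D.Comp_assoc[OF j2 q2 h0] q2_j2 D.Comp_Id[OF h0] by (simp add: h0_def)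
    show "(h0 \<cdot>\<^bsub>D\<^esub> q2) \<cdot>\<^bsub>D\<^esub> j1 = g0 \<cdot>\<^bsub>D\<^esub> j1"
      using D.Comp_assoc[OF j1 q2 h0] q2_j1 D.Comp_Zero[OF h0 D.Unit_Obj] gj1 by simp
  qed
  have h0_br: "(Id D (FO X) \<star>\<^bsub>D\<^esub> h0) \<cdot>\<^bsub>D\<^esub> Id D (FO X) = \<tau> X \<cdot>\<^bsub>D\<^esub> (h0 \<star>\<^bsub>D\<^esub> Id D (FO X))"
    if X: "X \<in> Obj C" for X
  proof -
    let ?I = "Id D (FO X)"
    note FX = OMap_Obj[OF X] and fX = f_Hom[OF X] and H = FX_Homs[OF X]
    note I = D.Id_Hom[OF FX]
    have t: "\<tau> X \<in> Hom D (T \<boxtimes>\<^bsub>D\<^esub> FO X) (FO X \<boxtimes>\<^bsub>D\<^esub> T)"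
      using \<tau> X by (auto simp: half_braiding_def isomorphism_def)
    note Ig = D.TMor_Hom[OF I g0] and gI = D.TMor_Hom[OF g0 I]
    have Ih: "?I \<star>\<^bsub>D\<^esub> h0 \<in> Hom D (FO X) (FO X \<boxtimes>\<^bsub>D\<^esub> T)"
      using D.TMor_Hom[OF I h0] by (simp add: D.TObj_Unit[OF FX])
    have "\<tau> X \<cdot>\<^bsub>D\<^esub> (h0 \<star>\<^bsub>D\<^esub> ?I) = ((?I \<star>\<^bsub>D\<^esub> g0) \<cdot>\<^bsub>D\<^esub> \<rho> X) \<cdot>\<^bsub>D\<^esub> (j2 \<star>\<^bsub>D\<^esub> ?I)"
      unfolding h0_def br[OF X]
      using D.TMor_Id_Comp[OF j2 g0 FX] D.Comp_assoc[OF H(2) gI t] by simp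
    also have "\<dots> = (?I \<star>\<^bsub>D\<^esub> g0) \<cdot>\<^bsub>D\<^esub> Add D ((?I \<star>\<^bsub>D\<^esub> j1) \<cdot>\<^bsub>D\<^esub> f X) (?I \<star>\<^bsub>D\<^esub> j2)"
      using D.Comp_assoc[OF H(2) \<rho>_Hom[OF X] Ig] \<rho>_in(2)[OF X] by simp
    also have "\<dots> = Add D (((?I \<star>\<^bsub>D\<^esub> g0) \<cdot>\<^bsub>D\<^esub> (?I \<star>\<^bsub>D\<^esub> j1)) \<cdot>\<^bsub>D\<^esub> f X) ((?I \<star>\<^bsub>D\<^esub> g0) \<cdot>\<^bsub>D\<^esub> (?I \<star>\<^bsub>D\<^esub> j2))"
      using D.Comp_Add_right[OF D.Comp_Hom[OF fX H(5)] H(6) Ig] D.Comp_assoc[OF fX H(5) Ig] by simp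
    also have "(?I \<star>\<^bsub>D\<^esub> g0) \<cdot>\<^bsub>D\<^esub> (?I \<star>\<^bsub>D\<^esub> j2) = ?I \<star>\<^bsub>D\<^esub> h0"
      unfolding h0_def by (rule D.Id_TMor_Comp[OF j2 g0 FX, symmetric])
    also have "(?I \<star>\<^bsub>D\<^esub> g0) \<cdot>\<^bsub>D\<^esub> (?I \<star>\<^bsub>D\<^esub> j1) = Zero D (FO X) (FO X \<boxtimes>\<^bsub>D\<^esub> T)"
      using D.Id_TMor_Comp[OF j1 g0 FX] gj1 D.TMor_Zero[OF I D.Unit_Obj T] D.TObj_Unit[OF FX] by simp
    also have "Zero D (FO X) (FO X \<boxtimes>\<^bsub>D\<^esub> T) \<cdot>\<^bsub>D\<^esub> f X = Zero D (FO X) (FO X \<boxtimes>\<^bsub>D\<^esub> T)"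
      by (rule D.Zero_Comp[OF fX D.TObj_Obj[OF FX T]])
    finally show ?thesis by (simp add: D.Zero_Add[OF Ih] D.Comp_Id[OF Ih])
  qed
  let ?h = "(Unit Z, h0, W)"
  have h: "?h \<in> Hom Z (Unit Z) W"
    using \<tau> half_braiding_one h0 h0_br by (auto simp: W centralizer_Hom centralizer_Unit braided_maps_iff)
  have "k = ?h" if k_Hom: "k \<in> Hom Z (Unit Z) W" and k_g: "k \<cdot>\<^bsub>Z\<^esub> proj = g" for k
  proof -
    obtain k0 where k: "k = (Unit Z, k0, W)" and k0: "k0 \<in> Hom D (Unit D) T"
      using k_Hom by (auto simp: W centralizer_Hom centralizer_Unit braided_maps_iff)
    have "k0 \<cdot>\<^bsub>D\<^esub> q2 = g0" using k_g by (simp add: k g_eq W centralizer_simps)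
    then have "k0 = h0"
      using D.Comp_assoc[OF j2 q2 k0] q2_j2 D.Comp_Id[OF k0] by (simp add: h0_def)
    then show ?thesis using k by simp
  qed
  moreover have "?h \<cdot>\<^bsub>Z\<^esub> proj = g" using h0q2 by (simp add: g_eq W centralizer_simps)
  ultimately show "\<exists>!k. k \<in> Hom Z (Unit Z) W \<and> k \<cdot>\<^bsub>Z\<^esub> proj = g" using h by blast
qed

text \<open>The first component of a section is a scalar \<open>c\<close> since \<open>End(1) = k\<close>. The \<open>q\<^sub>1\<close>-component of the
  compatibility with the half-braidings then reads \<open>c = c + f\<^bsub>X\<^esub>\<close>.\<close>

lemma split_imp_zero:
  assumes s: "s \<in> Hom Z (Unit Z) (S, \<rho>)" and ps: "proj \<cdot>\<^bsub>Z\<^esub> s = Id Z (Unit Z)" and X: "X \<in> Obj C"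
  shows "f X = Zero D (FO X) (FO X)"
proof -
  let ?I = "Id D (FO X)"
  obtain s0 where s_eq: "s = (Unit Z, s0, (S, \<rho>))" and s0: "s0 \<in> Hom D (Unit D) S"
    and "\<forall>X \<in> Obj C. (Id D (FO X) \<star>\<^bsub>D\<^esub> s0) \<cdot>\<^bsub>D\<^esub> one_braiding X = \<rho> X \<cdot>\<^bsub>D\<^esub> (s0 \<star>\<^bsub>D\<^esub> Id D (FO X))"
    using s by (auto simp: centralizer_Hom centralizer_Unit braided_maps_iff)
  then have br: "(?I \<star>\<^bsub>D\<^esub> s0) \<cdot>\<^bsub>D\<^esub> ?I = \<rho> X \<cdot>\<^bsub>D\<^esub> (s0 \<star>\<^bsub>D\<^esub> ?I)" using X by simp
  have q2s: "q2 \<cdot>\<^bsub>D\<^esub> s0 = Id D (Unit D)"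
    using ps by (simp add: s_eq centralizer_simps centralizer_Unit)
  note FX = OMap_Obj[OF X] and fX = f_Hom[OF X] and H = FX_Homs[OF X]
  note I = D.Id_Hom[OF FX]
  obtain c where "Scale D c (Id D (Unit D)) = q1 \<cdot>\<^bsub>D\<^esub> s0"
    using D.End_Unit D.Comp_Hom[OF s0 q1] unfolding bij_betw_def by (metis (no_types, lifting) imageE)
  then have c: "q1 \<cdot>\<^bsub>D\<^esub> s0 = Scale D c (Id D (Unit D))" by simp
  note I1 = D.Id_Hom[OF D.Unit_Obj]
  have Is: "?I \<star>\<^bsub>D\<^esub> s0 \<in> Hom D (FO X) (FO X \<boxtimes>\<^bsub>D\<^esub> S)" and sI: "s0 \<star>\<^bsub>D\<^esub> ?I \<in> Hom D (FO X) (S \<boxtimes>\<^bsub>D\<^esub> FO X)"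
    using D.TMor_Hom[OF I s0] D.TMor_Hom[OF s0 I] by (simp_all add: D.TObj_Unit[OF FX] D.Unit_TObj[OF FX])
  have "Scale D c ?I = (?I \<star>\<^bsub>D\<^esub> q1) \<cdot>\<^bsub>D\<^esub> (?I \<star>\<^bsub>D\<^esub> s0)"
    using D.Id_TMor_Comp[OF s0 q1 FX] by (simp add: c D.TMor_Scale_right[OF I I1] D.TMor_Unit[OF I])
  also have "\<dots> = (?I \<star>\<^bsub>D\<^esub> q1) \<cdot>\<^bsub>D\<^esub> (\<rho> X \<cdot>\<^bsub>D\<^esub> (s0 \<star>\<^bsub>D\<^esub> ?I))"
    using br D.Comp_Id[OF Is] by simp
  also have "\<dots> = Add D (q1 \<star>\<^bsub>D\<^esub> ?I) (f X \<cdot>\<^bsub>D\<^esub> (q2 \<star>\<^bsub>D\<^esub> ?I)) \<cdot>\<^bsub>D\<^esub> (s0 \<star>\<^bsub>D\<^esub> ?I)"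
    using D.Comp_assoc[OF sI \<rho>_Hom[OF X] H(7)] \<rho>_out(1)[OF X] by simp
  also have "\<dots> = Add D ((q1 \<star>\<^bsub>D\<^esub> ?I) \<cdot>\<^bsub>D\<^esub> (s0 \<star>\<^bsub>D\<^esub> ?I)) (f X \<cdot>\<^bsub>D\<^esub> ((q2 \<star>\<^bsub>D\<^esub> ?I) \<cdot>\<^bsub>D\<^esub> (s0 \<star>\<^bsub>D\<^esub> ?I)))"
    using D.Comp_Add_left[OF sI H(3) D.Comp_Hom[OF H(4) fX]] D.Comp_assoc[OF sI H(4) fX] by simp
  also have "(q1 \<star>\<^bsub>D\<^esub> ?I) \<cdot>\<^bsub>D\<^esub> (s0 \<star>\<^bsub>D\<^esub> ?I) = Scale D c ?I"
    using D.TMor_Id_Comp[OF s0 q1 FX] by (simp add: c D.TMor_Scale_left[OF I1 I] D.Unit_TMor[OF I])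
  also have "(q2 \<star>\<^bsub>D\<^esub> ?I) \<cdot>\<^bsub>D\<^esub> (s0 \<star>\<^bsub>D\<^esub> ?I) = ?I"
    using D.TMor_Id_Comp[OF s0 q2 FX] by (simp add: q2s D.Unit_TMor[OF I])
  finally have "Add D (Scale D c ?I) (f X) = Scale D c ?I" by (simp add: D.Comp_Id[OF fX])
  then show ?thesis by (rule D.Add_right_eq_self[OF D.Scale_Hom[OF I] fX])
qed

text \<open>The class of the extension must be the class of split extensions. An extension lies in its own class because the
  identity of \<open>S\<close> is a morphism of the centralizer.\<close>

lemma zero_if_Ext_trivial:
  assumes "carrier (Ext1 Z (Unit Z) (Unit Z)) = {\<one>\<^bsub>Ext1 Z (Unit Z) (Unit Z)\<^esub>}" and X: "X \<in> Obj C"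
  shows "f X = Zero D (FO X) (FO X)"
proof -
  let ?e = "((S, \<rho>), incl, proj)"
  let ?R = "extension_equiv Z (Unit Z) (Unit Z)"
  have e: "?e \<in> extensions Z (Unit Z) (Unit Z)"
    using incl_kernel proj_cokernel by (simp add: extensions_def short_exact_def)
  have Id: "((S, \<rho>), Id D S, (S, \<rho>)) \<in> Hom Z (S, \<rho>) (S, \<rho>)"
  proof -
    have "(Id D (FO X) \<star>\<^bsub>D\<^esub> Id D S) \<cdot>\<^bsub>D\<^esub> \<rho> X = \<rho> X \<cdot>\<^bsub>D\<^esub> (Id D S \<star>\<^bsub>D\<^esub> Id D (FO X))"
      if X: "X \<in> Obj C" for X
      using D.Comp_Id[OF \<rho>_Hom[OF X]] D.Id_Comp[OF \<rho>_Hom[OF X]] S_Obj OMap_Obj[OF X]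
      by (simp add: D.TMor_Id)
    then show ?thesis
      using half_braiding_\<rho> D.Id_Hom[OF S_Obj] by (auto simp: centralizer_Hom braided_maps_iff)
  qed
  have "isomorphism Z (S, \<rho>) (S, \<rho>) ((S, \<rho>), Id D S, (S, \<rho>))"
    unfolding isomorphism_def using Id D.Comp_Id[OF D.Id_Hom[OF S_Obj]]
    by (auto simp: centralizer_simps intro!: bexI[of _ "((S, \<rho>), Id D S, (S, \<rho>))"])
  moreover have "((S, \<rho>), Id D S, (S, \<rho>)) \<cdot>\<^bsub>Z\<^esub> incl = incl" "proj \<cdot>\<^bsub>Z\<^esub> ((S, \<rho>), Id D S, (S, \<rho>)) = proj"
    by (simp_all add: centralizer_simps D.Id_Comp[OF j1] D.Comp_Id[OF q2])
  ultimately have "(?e, ?e) \<in> ?R" using e unfolding extension_equiv_def by blast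
  moreover have "?R `` {?e} \<in> carrier (Ext1 Z (Unit Z) (Unit Z))"
    using e by (simp add: Ext1_def quotientI)
  ultimately have "?e \<in> \<one>\<^bsub>Ext1 Z (Unit Z) (Unit Z)\<^esub>" using assms(1) by auto
  then obtain s where "s \<in> Hom Z (Unit Z) (S, \<rho>)" "proj \<cdot>\<^bsub>Z\<^esub> s = Id Z (Unit Z)"
    by (auto simp: Ext1_def)
  then show ?thesis by (rule split_imp_zero[OF _ _ X])
qed

end

section \<open>Davydov--Yetter cohomology in degree one\<close>

lemma trivial_group_A_Mod_singleton:
  assumes "z \<oplus>\<^bsub>G\<^esub> z = z"
  shows "trivial_group ((G\<lparr>carrier := {z}\<rparr>) A_Mod {z})"
proof -
  let ?Q = "(G\<lparr>carrier := {z}\<rparr>) A_Mod {z}"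
  have Q: "carrier ?Q = {{z}}" "\<one>\<^bsub>?Q\<^esub> = {z}" "mult ?Q {z} {z} = {z}"
    using assms by (auto simp: A_FactGroup_def FactGroup_def RCOSETS_def r_coset_def set_mult_def)
  have "group ?Q"
    by (rule groupI) (auto simp: Q(1,2) Q(3)[simplified])
  then show ?thesis by (simp add: trivial_group_def Q)
qed

context tensor_functor
begin

lemma obj_lists_1: "Xs \<in> obj_lists C (Suc 0) \<longleftrightarrow> (\<exists>X \<in> Obj C. Xs = [X])"
  by (auto simp: obj_lists_def length_Suc_conv)

lemma ball_obj_lists_1: "(\<forall>Xs \<in> obj_lists C (Suc 0). P Xs) \<longleftrightarrow> (\<forall>X \<in> Obj C. P [X])"
  unfolding Ball_def obj_lists_1 by blast

lemma obj_lists_2: "Xs \<in> obj_lists C (Suc (Suc 0)) \<longleftrightarrow> (\<exists>X \<in> Obj C. \<exists>Y \<in> Obj C. Xs = [X, Y])"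
  by (auto simp: obj_lists_def length_Suc_conv)

lemma F_tensor_simps:
  "F_tensor D F [] = Unit D"
  "X \<in> Obj C \<Longrightarrow> F_tensor D F [X] = FO X"
  "X \<in> Obj C \<Longrightarrow> Y \<in> Obj C \<Longrightarrow> F_tensor D F [X, Y] = FO X \<boxtimes>\<^bsub>D\<^esub> FO Y"
  by (simp_all add: F_tensor_def tensor_objs_def D.TObj_Unit OMap_Obj)

text \<open>A scalar \<open>c\<close> gives \<open>id \<otimes> c - c \<otimes> id = 0\<close>.\<close>

lemma DY_diff_0:
  assumes p: "\<phi> [] \<in> Hom D (Unit D) (Unit D)" and X: "X \<in> Obj C"
  shows "DY_diff C D F 0 \<phi> [X] = Zero D (FO X) (FO X)"
proof -
  let ?I = "Id D (FO X)" and ?E = "hom_space D (FO X) (FO X)"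
  note FX = OMap_Obj[OF X] and I1 = D.Id_Hom[OF D.Unit_Obj]
  note I = D.Id_Hom[OF FX]
  interpret E: k_space ?E by (rule D.Hom_k_space[OF FX FX])
  obtain c where "Scale D c (Id D (Unit D)) = \<phi> []"
    using D.End_Unit p unfolding bij_betw_def by (metis (no_types, lifting) imageE)
  then have c: "\<phi> [] = Scale D c (Id D (Unit D))" by simp
  have 1: "?I \<star>\<^bsub>D\<^esub> \<phi> [] = Scale D c ?I" "\<phi> [] \<star>\<^bsub>D\<^esub> ?I = Scale D c ?I"
    by (simp_all add: c D.TMor_Scale_right[OF I I1] D.TMor_Scale_left[OF I1 I] D.TMor_Unit[OF I] D.Unit_TMor[OF I])
  have "[X] \<in> obj_lists C (Suc 0)" using X by (simp add: obj_lists_1)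
  then show ?thesis
    using 1 D.Add_Zero[OF D.Scale_Hom[OF I]] D.Add_uminus[OF D.Scale_Hom[OF I]] X
    by (simp add: DY_diff_def F_tensor_simps Let_def)
qed

lemma DY_diff_1:
  assumes p: "\<And>X. X \<in> Obj C \<Longrightarrow> \<phi> [X] \<in> Hom D (FO X) (FO X)" and X: "X \<in> Obj C" and Y: "Y \<in> Obj C"
  shows "DY_diff C D F 1 \<phi> [X, Y] = Add D (Add D (Id D (FO X) \<star>\<^bsub>D\<^esub> \<phi> [Y])
    (Scale D (-1) (\<phi> [X \<boxtimes>\<^bsub>C\<^esub> Y]))) (\<phi> [X] \<star>\<^bsub>D\<^esub> Id D (FO Y))"
proof -
  let ?T = "FO X \<boxtimes>\<^bsub>D\<^esub> FO Y"
  let ?E = "hom_space D ?T ?T"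
  note FX = OMap_Obj[OF X] and FY = OMap_Obj[OF Y] and XY = C.TObj_Obj[OF X Y]
  interpret E: k_space ?E by (rule D.Hom_k_space[OF D.TObj_Obj[OF FX FY] D.TObj_Obj[OF FX FY]])
  have m: "Scale D (-1) (\<phi> [X \<boxtimes>\<^bsub>C\<^esub> Y]) \<in> Hom D ?T ?T"
    using D.Scale_Hom[OF p[OF XY]] by (simp add: F_TObj[OF X Y])
  have "(\<Oplus>\<^bsub>?E\<^esub>i \<in> {1}. (-1) ^ i \<odot>\<^bsub>?E\<^esub> \<phi> (merge_at C i [X, Y])) = Scale D (-1) (\<phi> [X \<boxtimes>\<^bsub>C\<^esub> Y])"
    by (subst E.finsum_single) (use m in \<open>simp_all add: merge_at_def\<close>)
  moreover have "[X, Y] \<in> obj_lists C (Suc (Suc 0))" using X Y by (simp add: obj_lists_2)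
  moreover have "\<phi> [X] \<star>\<^bsub>D\<^esub> Id D (FO Y) \<in> Hom D ?T ?T" by (rule D.TMor_Hom[OF p[OF X] D.Id_Hom[OF FY]])
  ultimately show ?thesis
    using X Y D.Scale_one by (simp add: DY_diff_def F_tensor_simps Let_def)
qed

lemma cochain_1_iff:
  "\<phi> \<in> carrier (DY_cochains C D F 1) \<longleftrightarrow> \<phi> \<in> extensional (obj_lists C 1) \<and>
    (\<forall>X \<in> Obj C. \<phi> [X] \<in> Hom D (FO X) (FO X)) \<and>
    (\<forall>X Y. \<forall>u \<in> Hom C X Y. FM u \<cdot>\<^bsub>D\<^esub> \<phi> [X] = \<phi> [Y] \<cdot>\<^bsub>D\<^esub> FM u)"
proof -
  have tm: "tensor_mors D (map FM [u]) = FM u" if "u \<in> Hom C X Y" for u X Y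
    by (simp add: tensor_mors_def D.TMor_Unit[OF MMap_Hom[OF that]])
  have nat: "(\<forall>Xs \<in> obj_lists C (Suc 0). \<forall>Ys \<in> obj_lists C (Suc 0). \<forall>fs.
          length fs = Suc 0 \<and> (\<forall>i<Suc 0. fs ! i \<in> Hom C (Xs ! i) (Ys ! i)) \<longrightarrow>
          tensor_mors D (map FM fs) \<cdot>\<^bsub>D\<^esub> \<phi> Xs = \<phi> Ys \<cdot>\<^bsub>D\<^esub> tensor_mors D (map FM fs))
      \<longleftrightarrow> (\<forall>X Y. \<forall>u \<in> Hom C X Y. FM u \<cdot>\<^bsub>D\<^esub> \<phi> [X] = \<phi> [Y] \<cdot>\<^bsub>D\<^esub> FM u)" (is "?l \<longleftrightarrow> ?r")
  proof
    assume l: ?l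
    show ?r
    proof (intro allI ballI)
      fix X Y u assume u: "u \<in> Hom C X Y"
      have "[X] \<in> obj_lists C (Suc 0)" "[Y] \<in> obj_lists C (Suc 0)"
        using C.Hom_Obj[OF u] by (simp_all add: obj_lists_1)
      moreover have "length [u] = Suc 0 \<and> (\<forall>i<Suc 0. [u] ! i \<in> Hom C ([X] ! i) ([Y] ! i))"
        using u by simp
      ultimately show "FM u \<cdot>\<^bsub>D\<^esub> \<phi> [X] = \<phi> [Y] \<cdot>\<^bsub>D\<^esub> FM u"
        using l[rule_format, of "[X]" "[Y]" "[u]"] tm[OF u] by simp
    qed
  next
    assume r: ?r
    show ?l
    proof (intro allI ballI impI)
      fix Xs Ys fs assume "Xs \<in> obj_lists C (Suc 0)" and "Ys \<in> obj_lists C (Suc 0)"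
        and fs: "length fs = Suc 0 \<and> (\<forall>i<Suc 0. fs ! i \<in> Hom C (Xs ! i) (Ys ! i))"
      then obtain X Y where XY: "Xs = [X]" "Ys = [Y]" by (auto simp: obj_lists_1)
      obtain u where u: "fs = [u]" using fs by (auto simp: length_Suc_conv)
      then have "u \<in> Hom C X Y" using fs XY by simp
      then show "tensor_mors D (map FM fs) \<cdot>\<^bsub>D\<^esub> \<phi> Xs = \<phi> Ys \<cdot>\<^bsub>D\<^esub> tensor_mors D (map FM fs)"
        using r tm unfolding XY u by metis
    qed
  qed
  have hom: "(\<forall>Xs \<in> obj_lists C (Suc 0). \<phi> Xs \<in> Hom D (F_tensor D F Xs) (F_tensor D F Xs)) \<longleftrightarrow>
      (\<forall>X \<in> Obj C. \<phi> [X] \<in> Hom D (FO X) (FO X))"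
    by (simp add: ball_obj_lists_1 F_tensor_simps)
  show ?thesis
    unfolding DY_cochains_def One_nat_def using nat hom by simp
qed

lemma DY_zero_1: "\<zero>\<^bsub>DY_cochains C D F 1\<^esub> = (\<lambda>Xs \<in> obj_lists C 1. Zero D (F_tensor D F Xs) (F_tensor D F Xs))"
  by (simp add: DY_cochains_def)

lemma cocycle_derivation:
  assumes "\<phi> \<in> DY_cocycles C D F 1"
  shows "tensor_derivation C D F (\<lambda>X. \<phi> [X])"
proof -
  have c: "\<phi> \<in> carrier (DY_cochains C D F 1)" and d: "DY_diff C D F 1 \<phi> = \<zero>\<^bsub>DY_cochains C D F 2\<^esub>"
    using assms by (auto simp: DY_cocycles_def a_kernel_def' numeral_2_eq_2)
  have p: "\<And>X. X \<in> Obj C \<Longrightarrow> \<phi> [X] \<in> Hom D (FO X) (FO X)"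
    and n: "\<And>X Y u. u \<in> Hom C X Y \<Longrightarrow> FM u \<cdot>\<^bsub>D\<^esub> \<phi> [X] = \<phi> [Y] \<cdot>\<^bsub>D\<^esub> FM u"
    using c unfolding cochain_1_iff by blast+
  show ?thesis
  proof unfold_locales
    fix X Y assume X: "X \<in> Obj C" and Y: "Y \<in> Obj C"
    let ?T = "FO X \<boxtimes>\<^bsub>D\<^esub> FO Y"
    let ?a = "Id D (FO X) \<star>\<^bsub>D\<^esub> \<phi> [Y]" and ?b = "\<phi> [X] \<star>\<^bsub>D\<^esub> Id D (FO Y)" and ?c = "\<phi> [X \<boxtimes>\<^bsub>C\<^esub> Y]"
    note FX = OMap_Obj[OF X] and FY = OMap_Obj[OF Y] and XY = C.TObj_Obj[OF X Y]
    have a: "?a \<in> Hom D ?T ?T" by (rule D.TMor_Hom[OF D.Id_Hom[OF FX] p[OF Y]])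
    have b: "?b \<in> Hom D ?T ?T" by (rule D.TMor_Hom[OF p[OF X] D.Id_Hom[OF FY]])
    have c: "?c \<in> Hom D ?T ?T" using p[OF XY] by (simp add: F_TObj[OF X Y])
    note c' = D.Scale_Hom[OF c, of "-1"]
    have "[X, Y] \<in> obj_lists C (Suc (Suc 0))" using X Y by (simp add: obj_lists_2)
    then have "\<zero>\<^bsub>DY_cochains C D F 2\<^esub> [X, Y] = Zero D ?T ?T"
      using X Y by (simp add: DY_cochains_def F_tensor_simps numeral_2_eq_2)
    then have "Add D (Add D ?a (Scale D (-1) ?c)) ?b = Zero D ?T ?T"
      using DY_diff_1[OF p X Y] d by simp
    moreover have "Add D (Add D ?a (Scale D (-1) ?c)) ?b = Add D (Add D ?a ?b) (Scale D (-1) ?c)"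
      using D.Add_assoc[OF a c' b] D.Add_assoc[OF a b c'] D.Add_commute[OF b c'] by simp
    ultimately have "Add D ?a ?b = ?c"
      by (intro D.eq_if_diff_Zero[OF D.Add_Hom[OF a b] c]) simp
    then show "?c = Add D ?a ?b" by simp
  qed (fact p n)+
qed

lemma zero_cocycle: "\<zero>\<^bsub>DY_cochains C D F 1\<^esub> \<in> DY_cocycles C D F 1"
proof -
  let ?z = "\<zero>\<^bsub>DY_cochains C D F 1\<^esub>"
  have z: "?z [X] = Zero D (FO X) (FO X)" if "X \<in> Obj C" for X
    using that unfolding DY_zero_1 by (simp add: obj_lists_1 F_tensor_simps)
  have p: "?z [X] \<in> Hom D (FO X) (FO X)" if "X \<in> Obj C" for X
    using z[OF that] D.Zero_Hom OMap_Obj[OF that] by simp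
  have "FM u \<cdot>\<^bsub>D\<^esub> ?z [X] = ?z [Y] \<cdot>\<^bsub>D\<^esub> FM u" if "u \<in> Hom C X Y" for u X Y
    using C.Hom_Obj[OF that] z D.Comp_Zero[OF MMap_Hom[OF that]] D.Zero_Comp[OF MMap_Hom[OF that]]
    by (simp add: OMap_Obj)
  moreover have ext: "?z \<in> extensional (obj_lists C 1)" unfolding DY_zero_1 by simp
  ultimately have "?z \<in> carrier (DY_cochains C D F 1)"
    unfolding cochain_1_iff using p ext by blast
  moreover have "DY_diff C D F 1 ?z = \<zero>\<^bsub>DY_cochains C D F 2\<^esub>"
  proof (rule extensionalityI)
    show "DY_diff C D F 1 ?z \<in> extensional (obj_lists C (Suc (Suc 0)))"
      by (simp add: DY_diff_def)
    show "\<zero>\<^bsub>DY_cochains C D F 2\<^esub> \<in> extensional (obj_lists C (Suc (Suc 0)))"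
      by (simp add: DY_cochains_def numeral_2_eq_2)
    fix Xs assume Xs: "Xs \<in> obj_lists C (Suc (Suc 0))"
    then obtain X Y where X: "X \<in> Obj C" and Y: "Y \<in> Obj C" and XsXY: "Xs = [X, Y]"
      unfolding obj_lists_2 by blast
    let ?T = "FO X \<boxtimes>\<^bsub>D\<^esub> FO Y"
    note FX = OMap_Obj[OF X] and FY = OMap_Obj[OF Y] and XY = C.TObj_Obj[OF X Y]
    have T: "Zero D ?T ?T \<in> Hom D ?T ?T" using FX FY D.TObj_Obj by auto
    have "DY_diff C D F 1 ?z [X, Y] = Add D (Add D (Zero D ?T ?T) (Scale D (-1) (Zero D ?T ?T))) (Zero D ?T ?T)"
      using DY_diff_1[OF p X Y] z[OF X] z[OF Y] z[OF XY] F_TObj[OF X Y]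
        D.TMor_Zero[OF D.Id_Hom[OF FX] FY FY] D.Zero_TMor[OF D.Id_Hom[OF FY] FX FX] by simp
    also have "\<dots> = Zero D ?T ?T"
      by (simp add: D.Scale_Zero[OF T] D.Add_Zero[OF T])
    finally show "DY_diff C D F 1 ?z Xs = \<zero>\<^bsub>DY_cochains C D F 2\<^esub> Xs"
      using Xs X Y by (simp add: XsXY DY_cochains_def F_tensor_simps numeral_2_eq_2)
  qed
  ultimately show ?thesis by (simp add: DY_cocycles_def a_kernel_def' numeral_2_eq_2)
qed

lemma DY_coboundaries_1: "DY_coboundaries C D F 1 = {\<zero>\<^bsub>DY_cochains C D F 1\<^esub>}"
proof -
  have zero: "DY_diff C D F 0 \<phi> = \<zero>\<^bsub>DY_cochains C D F 1\<^esub>" if "\<phi> \<in> carrier (DY_cochains C D F 0)" for \<phi>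
  proof (rule extensionalityI)
    show "DY_diff C D F 0 \<phi> \<in> extensional (obj_lists C (Suc 0))" by (simp add: DY_diff_def)
    show "\<zero>\<^bsub>DY_cochains C D F 1\<^esub> \<in> extensional (obj_lists C (Suc 0))" by (simp add: DY_cochains_def)
    have p: "\<phi> [] \<in> Hom D (Unit D) (Unit D)"
      using that by (auto simp: DY_cochains_def obj_lists_def F_tensor_simps)
    fix Xs assume Xs: "Xs \<in> obj_lists C (Suc 0)"
    then obtain X where X: "X \<in> Obj C" "Xs = [X]" unfolding obj_lists_1 by blast
    then show "DY_diff C D F 0 \<phi> Xs = \<zero>\<^bsub>DY_cochains C D F 1\<^esub> Xs"
      using Xs DY_diff_0[where \<phi> = \<phi>, OF p X(1)] unfolding DY_zero_1 by (simp add: F_tensor_simps)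
  qed
  have ex: "(\<lambda>Xs \<in> obj_lists C 0. Zero D (Unit D) (Unit D)) \<in> carrier (DY_cochains C D F 0)"
    using D.Zero_Hom[OF D.Unit_Obj D.Unit_Obj] D.Comp_Id[OF D.Zero_Hom[OF D.Unit_Obj D.Unit_Obj]]
      D.Id_Comp[OF D.Zero_Hom[OF D.Unit_Obj D.Unit_Obj]]
    by (auto simp: DY_cochains_def obj_lists_def F_tensor_simps tensor_mors_def)
  have "DY_diff C D F 0 ` carrier (DY_cochains C D F 0)
      = (\<lambda>_. \<zero>\<^bsub>DY_cochains C D F 1\<^esub>) ` carrier (DY_cochains C D F 0)"
    by (rule image_cong[OF refl zero])
  also have "\<dots> = {\<zero>\<^bsub>DY_cochains C D F 1\<^esub>}" by (rule image_constant[OF ex])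
  finally show ?thesis by (simp add: DY_coboundaries_def)
qed

lemma DY_cohomology_1_trivial:
  assumes "\<And>f X. tensor_derivation C D F f \<Longrightarrow> X \<in> Obj C \<Longrightarrow> f X = Zero D (FO X) (FO X)"
  shows "trivial_group (DY_cohomology C D F 1)"
proof -
  let ?z = "\<zero>\<^bsub>DY_cochains C D F 1\<^esub>"
  have "\<phi> = ?z" if \<phi>: "\<phi> \<in> DY_cocycles C D F 1" for \<phi>
  proof (rule extensionalityI)
    have "\<phi> \<in> carrier (DY_cochains C D F 1)" using \<phi> by (auto simp: DY_cocycles_def a_kernel_def')
    then show "\<phi> \<in> extensional (obj_lists C 1)" unfolding cochain_1_iff by blast
    show "?z \<in> extensional (obj_lists C 1)" unfolding DY_zero_1 by simp
    fix Xs assume Xs: "Xs \<in> obj_lists C 1"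
    then obtain X where X: "X \<in> Obj C" "Xs = [X]" unfolding One_nat_def obj_lists_1 by blast
    then show "\<phi> Xs = ?z Xs"
      using Xs assms[OF cocycle_derivation[OF \<phi>] X(1)] unfolding DY_zero_1 by (simp add: F_tensor_simps)
  qed
  then have coc: "DY_cocycles C D F 1 = {?z}" using zero_cocycle by blast
  have "add (DY_cochains C D F 1) ?z ?z = ?z"
  proof (rule extensionalityI)
    show "add (DY_cochains C D F 1) ?z ?z Xs = ?z Xs" if Xs: "Xs \<in> obj_lists C 1" for Xs
    proof -
      obtain X where X: "X \<in> Obj C" "Xs = [X]" using Xs by (auto simp: obj_lists_1)
      show ?thesis
        using Xs X D.Add_Zero[OF D.Zero_Hom[OF OMap_Obj[OF X(1)] OMap_Obj[OF X(1)]]]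
        by (simp add: DY_cochains_def F_tensor_simps)
    qed
  qed (simp_all add: DY_cochains_def)
  then show ?thesis
    unfolding DY_cohomology_def coc DY_coboundaries_1
    by (rule trivial_group_A_Mod_singleton)
qed

end

theorem proposition4p8:
  fixes C :: "('c, 'f, 'k::field) tensor_cat"
    and D :: "('d, 'g, 'k) tensor_cat"
    and F :: "('c, 'f, 'd, 'g) funct"
  assumes "finite_strict_tensor_category C"
    and "finite_strict_tensor_category D"
    and "linear_functor C D F"
    and "exact_functor C D F"
    and "strict_monoidal_functor C D F"
  shows "(let Z = centralizer C D F; E = Ext1 Z (Unit Z) (Unit Z)
          in carrier E = {\<one>\<^bsub>E\<^esub>} \<longrightarrow> trivial_group (DY_cohomology C D F 1)) \<and>
         (CHAR('k) = 0 \<and> (\<forall>p :: 'k poly. degree p > 0 \<longrightarrow> (\<exists>x. poly p x = 0))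
          \<longrightarrow> trivial_group (DY_cohomology C D F 1))"
proof -
  interpret tensor_functor C D F
    by (intro tensor_functor.intro tensor_functor_axioms.intro assms)
  show ?thesis
    unfolding Let_def
  proof (intro conjI impI)
    assume ext: "carrier (Ext1 Z (Unit Z) (Unit Z)) = {\<one>\<^bsub>Ext1 Z (Unit Z) (Unit Z)\<^esub>}"
    obtain S j1 j2 q1 q2 where S: "is_biproduct D (Unit D) (Unit D) S j1 j2 q1 q2"
      using D.ex_biproduct[OF D.Unit_Obj D.Unit_Obj] by blast
    show "trivial_group (DY_cohomology C D F 1)"
    proof (rule DY_cohomology_1_trivial)
      fix f X assume f: "tensor_derivation C D F f" and X: "X \<in> Obj C"
      interpret derivation_extension C D F f S j1 j2 q1 q2
        by (intro derivation_extension.intro derivation_extension_axioms.intro f S)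
      show "f X = Zero D (FO X) (FO X)" by (rule zero_if_Ext_trivial[OF ext X])
    qed
  next
    assume char: "CHAR('k) = 0 \<and> (\<forall>p :: 'k poly. degree p > 0 \<longrightarrow> (\<exists>x. poly p x = 0))"
    show "trivial_group (DY_cohomology C D F 1)"
    proof (rule DY_cohomology_1_trivial)
      fix f X assume f: "tensor_derivation C D F f" and X: "X \<in> Obj C"
      show "f X = Zero D (FO X) (FO X)"
        by (rule tensor_derivation.tensor_derivation_zero[OF f assms(4) _ _ X]) (use char in auto)
    qed
  qed
qed

end
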